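(* Let $q\ge2$, $d\ge1$ and $\beta>0$, and suppose the ferromagnetic $q$-state Potts model on $\mathbb{Z}^d$ at inverse temperature $\beta$ with no external field has SSM. Then there is a constant $c>0$ (independent of $n$) such that for every $d$-dimensional cube $V\subset\mathbb{Z}^d$ of volume $n$, the Swendsen–Wang dynamics $\boldsymbol{SW}$ on the induced subgraph $G=(V,E)$ (free boundary) satisfies $\lambda(\boldsymbol{SW})\ge c$; hence its relaxation time is $O(1)$.
   Context: The ferromagnetic $q$-state Potts model is the spin system with spins $\{1,\dots,q\}$, edge potential $U(s_1,s_2)=\beta\mathbf 1(s_1=s_2)$, $\beta>0$, and vertex potential $W\equiv0$; with boundary condition $\psi$ on part of the outer boundary $\partial V$ its Gibbs distribution is $\mu^\psi(\sigma)\propto\exp(\beta\,[\#\{(u,v)\in E:\sigma(u)=\sigma(v)\}+\#\{u\in A^\psi,v\in V,u\sim v:\psi(u)=\sigma(v)\}])$. With free boundary this is $\pi(\sigma)\propto\exp(\beta\,\#\{(u,v)\in E:\sigma(u)=\sigma(v)\})$ on $\{1,\dots,q\}^V$. SSM: there exist $a,b>0$ such that for every $d$-dimensional cube $\Lambda$, all $B\subseteq\Lambda$, all $u\in\partial\Lambda$ and all boundary conditions $\psi,\psi_u$ on $\partial\Lambda$ differing only at $u$, $\|\mu^\psi_B-\mu^{\psi_u}_B\|_{TV}\le b\,e^{-a\,\mathrm{dist}(u,B)}$ (marginals on $B$, $\ell_1$ distance). Swendsen–Wang dynamics (with $p=1-e^{-\beta}$): from $\sigma_t$, (1) include each edge $(u,v)\in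 E$ with $\sigma_t(u)=\sigma_t(v)$ independently with probability $p$, obtaining $A_t\subseteq E$; (2) assign to each connected component of $(V,A_t)$ independently a uniformly random spin from $\{1,\dots,q\}$; (3) discard the edges to get $\sigma_{t+1}$. It is reversible w.r.t. $\pi$. $\lambda(P)=1-\max\{|\lambda_2|,|\lambda_N|\}$ for reversible $P$ with eigenvalues $1=\lambda_1\ge\dots\ge\lambda_N$. *)

theory Defs
  imports Complex_Main "HOL-Library.Multiset" "Jordan_Normal_Form.Char_Poly"
begin

text \<open>Points of Z^d are integer lists of length d.\<close>

definition l1dist :: "int list \<Rightarrow> int list \<Rightarrow> real" where
  "l1dist x y = real_of_int (\<Sum>i<length x. \<bar>x ! i - y ! i\<bar>)"

definition adj :: "int list \<Rightarrow> int list \<Rightarrow> bool" where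
  "adj x y \<longleftrightarrow> length x = length y \<and> (\<Sum>i<length x. \<bar>x ! i - y ! i\<bar>) = 1"

definition cube :: "nat \<Rightarrow> int list \<Rightarrow> nat \<Rightarrow> int list set" where
  "cube d c L = {x. length x = d \<and> (\<forall>i<d. c ! i \<le> x ! i \<and> x ! i < c ! i + int L)}"

definition is_cube :: "nat \<Rightarrow> int list set \<Rightarrow> bool" where
  "is_cube d V \<longleftrightarrow> (\<exists>c L. length c = d \<and> L \<ge> 1 \<and> V = cube d c L)"

definition outer_boundary :: "int list set \<Rightarrow> int list set" where
  "outer_boundary V = {u. u \<notin> V \<and> (\<exists>v\<in>V. adj u v)}"

definition set_dist :: "int list \<Rightarrow> int list set \<Rightarrow> real" where
  "set_dist u B = Min (l1dist u ` B)"

definition edges :: "int list set \<Rightarrow> int list set set" where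
  "edges V = {{x, y} | x y. x \<in> V \<and> y \<in> V \<and> adj x y}"

definition configs :: "nat \<Rightarrow> int list set \<Rightarrow> (int list \<Rightarrow> nat) set" where
  "configs q B = {\<sigma>. (\<forall>x\<in>B. \<sigma> x \<in> {1..q}) \<and> (\<forall>x. x \<notin> B \<longrightarrow> \<sigma> x = 0)}"

definition restr :: "(int list \<Rightarrow> nat) \<Rightarrow> int list set \<Rightarrow> int list \<Rightarrow> nat" where
  "restr \<sigma> B = (\<lambda>x. if x \<in> B then \<sigma> x else 0)"

definition is_bc :: "nat \<Rightarrow> int list set \<Rightarrow> (int list \<Rightarrow> nat option) \<Rightarrow> bool" where
  "is_bc q \<Lambda> \<psi> \<longleftrightarrow> dom \<psi> \<subseteq> outer_boundary \<Lambda> \<and> ran \<psi> \<subseteq> {1..q}"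

definition mono_edges :: "int list set \<Rightarrow> (int list \<Rightarrow> nat) \<Rightarrow> int list set set" where
  "mono_edges V \<sigma> = {{x, y} | x y. x \<in> V \<and> y \<in> V \<and> adj x y \<and> \<sigma> x = \<sigma> y}"

definition potts_weight ::
  "real \<Rightarrow> int list set \<Rightarrow> (int list \<Rightarrow> nat option) \<Rightarrow> (int list \<Rightarrow> nat) \<Rightarrow> real" where
  "potts_weight \<beta> \<Lambda> \<psi> \<sigma> = exp (\<beta> * (real (card (mono_edges \<Lambda> \<sigma>))
      + real (card {(u, v). v \<in> \<Lambda> \<and> adj u v \<and> \<psi> u = Some (\<sigma> v)})))"

definition potts_gibbs ::
  "nat \<Rightarrow> real \<Rightarrow> int list set \<Rightarrow> (int list \<Rightarrow> nat option) \<Rightarrow> (int list \<Rightarrow> nat) \<Rightarrow> real" where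
  "potts_gibbs q \<beta> \<Lambda> \<psi> \<sigma> =
     potts_weight \<beta> \<Lambda> \<psi> \<sigma> / (\<Sum>\<tau>\<in>configs q \<Lambda>. potts_weight \<beta> \<Lambda> \<psi> \<tau>)"

definition potts_marginal ::
  "nat \<Rightarrow> real \<Rightarrow> int list set \<Rightarrow> (int list \<Rightarrow> nat option) \<Rightarrow> int list set \<Rightarrow> (int list \<Rightarrow> nat) \<Rightarrow> real" where
  "potts_marginal q \<beta> \<Lambda> \<psi> B \<tau> =
     (\<Sum>\<sigma>\<in>{\<sigma> \<in> configs q \<Lambda>. restr \<sigma> B = \<tau>}. potts_gibbs q \<beta> \<Lambda> \<psi> \<sigma>)"

definition SSM :: "nat \<Rightarrow> nat \<Rightarrow> real \<Rightarrow> bool" where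
  "SSM q d \<beta> \<longleftrightarrow> (\<exists>a b. a > 0 \<and> b > 0 \<and>
     (\<forall>\<Lambda> B u \<psi> \<psi>u. is_cube d \<Lambda> \<longrightarrow> B \<subseteq> \<Lambda> \<longrightarrow> u \<in> outer_boundary \<Lambda> \<longrightarrow>
        is_bc q \<Lambda> \<psi> \<longrightarrow> is_bc q \<Lambda> \<psi>u \<longrightarrow> (\<forall>v. v \<noteq> u \<longrightarrow> \<psi> v = \<psi>u v) \<longrightarrow>
        (\<Sum>\<tau>\<in>configs q B. \<bar>potts_marginal q \<beta> \<Lambda> \<psi> B \<tau> - potts_marginal q \<beta> \<Lambda> \<psi>u B \<tau>\<bar>)
          \<le> b * exp (- a * set_dist u B)))"

definition conn_rel :: "int list set \<Rightarrow> int list set set \<Rightarrow> (int list \<times> int list) set" where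
  "conn_rel V A = ({(x, y). {x, y} \<in> A})\<^sup>* \<inter> (V \<times> V)"

definition components :: "int list set \<Rightarrow> int list set set \<Rightarrow> int list set set" where
  "components V A = V // conn_rel V A"

definition SW_kernel ::
  "nat \<Rightarrow> real \<Rightarrow> int list set \<Rightarrow> (int list \<Rightarrow> nat) \<Rightarrow> (int list \<Rightarrow> nat) \<Rightarrow> real" where
  "SW_kernel q \<beta> V \<sigma> \<sigma>' =
     (let p = 1 - exp (- \<beta>); M = mono_edges V \<sigma> in
      \<Sum>A\<in>Pow M. p ^ card A * (1 - p) ^ (card M - card A) *
        (if \<forall>(x, y)\<in>conn_rel V A. \<sigma>' x = \<sigma>' y
         then (1 / real q) ^ card (components V A) else 0))"

text \<open>Transition matrix on the state space configs q V, via an enumeration of it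
  (the spectrum does not depend on the chosen enumeration).\<close>
definition state_enum :: "nat \<Rightarrow> int list set \<Rightarrow> nat \<Rightarrow> (int list \<Rightarrow> nat)" where
  "state_enum q V = (SOME f. bij_betw f {..<card (configs q V)} (configs q V))"

definition SW_matrix :: "nat \<Rightarrow> real \<Rightarrow> int list set \<Rightarrow> real mat" where
  "SW_matrix q \<beta> V = (let N = card (configs q V); f = state_enum q V in
     mat N N (\<lambda>(i, j). SW_kernel q \<beta> V (f i) (f j)))"

text \<open>Spectral gap lambda(P) = 1 - max(|lambda_2|, |lambda_N|): eigenvalues with multiplicity
  are the roots of the characteristic polynomial; removing one copy of lambda_1 = 1 leaves
  lambda_2, ..., lambda_N.\<close>
definition spectral_gap :: "real mat \<Rightarrow> real" where
  "spectral_gap P = 1 - Max (cmod ` set_mset (proots (char_poly (map_mat complex_of_real P)) - {#1#}))"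

end

theory Submission
  imports Defs
begin

text \<open>
  The edge set chosen by a Swendsen--Wang step from \<open>\<sigma>\<close> is the set of monochromatic edges that are open in
  a Bernoulli percolation \<open>U\<close> independent of \<open>\<sigma>\<close>. Revealing \<open>U\<close> together with all spins outside a set
  \<open>T\<close> of vertices isolated in \<open>U\<close> determines that edge set, so the quadratic form of the dynamics is at most the
  \<open>U\<close>-average of the forms of the heat baths on such sets \<open>T\<close>. We let \<open>T\<close> be the union of those tiles
  of a random tiling by disjoint, well separated cubes around which all edges are closed. By SSM a change of
  one spin next to a tile influences the heat bath in the tile by an amount polylogarithmic in its side length \<open>L\<close>,
  whereas a vertex lies on the boundary of a tile with only about \<open>1/L\<close> times the probability that it
  is covered. For large \<open>L\<close> the averaged heat bath therefore contracts the
  Lipschitz seminorm for single spin changes by a factor \<open>1 - \<kappa>\<close>, hence, being self-adjoint, has spectral gap at least \<open>\<kappa>\<close>.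
  SSM concerns cubes only, so the tiles have to be cubes inside \<open>V\<close>;
  varying their side length keeps the vertices near the boundary of \<open>V\<close> from being exceptional.
\<close>

text \<open>Covering a vertex is a gain and bordering a tile is a loss, and both must be compared
  after tiles with open surroundings are discarded. The percolation therefore lives on a fixed edge
  set larger than that of \<open>V\<close>: every tile then has a frame with the same number
  \<open>k\<close> of edges, so both probabilities shrink by the same factor
  \<open>(1 - p) ^ k\<close>, which depends on \<open>L\<close> but not on the size of
  \<open>V\<close>. Contraction is measured in a Lipschitz seminorm because SSM speaks of single
  changes of a boundary spin. Comparing it with the quadratic norm costs a factor depending on
  \<open>V\<close>, which disappears when the operator is iterated. Few tiles inside
  \<open>V\<close> cover a vertex near a corner. Giving weight \<open>L\<close> to intervals at the
  ends repairs this, but makes the points bordering such an interval expensive; since a coordinate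
  borders an end interval for at most two lengths \<open>l\<close>, averaging over \<open>L\<close>
  lengths spreads this cost. It suffices that the influence of a boundary spin is small compared
  with \<open>L\<close>. With \<open>L = r ^ (d + 1)\<close> the sites within distance
  \<open>r\<close> contribute order \<open>r ^ d\<close>, and SSM makes the rest exponentially small
  in \<open>r\<close>.\<close>

section \<open>Deflation and the spectral gap\<close>

text \<open>The all-ones vector is a right eigenvector with eigenvalue 1. Conjugation by
  \<open>S\<close>, which puts it in place of the first basis vector, makes \<open>A\<close> block
  upper triangular with diagonal blocks 1 and \<open>B\<close>.\<close>

lemma char_poly_deflation:
  fixes A :: "'a :: field mat"
  assumes A: "A \<in> carrier_mat (Suc n) (Suc n)"
    and row: "\<And>i. i \<le> n \<Longrightarrow> (\<Sum>j\<le>n. A $$ (i, j)) = 1"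
  defines "B \<equiv> mat n n (\<lambda>(i, j). A $$ (Suc i, Suc j) - A $$ (0, Suc j))"
  shows "char_poly A = [:-1, 1:] * char_poly B"
proof -
  define S :: "'a mat" where
    "S = mat (Suc n) (Suc n) (\<lambda>(i, j). if j = 0 \<or> i = j then 1 else 0)"
  define S' :: "'a mat" where
    "S' = mat (Suc n) (Suc n) (\<lambda>(i, j). if i = j then 1 else if j = 0 then -1 else 0)"
  define C :: "'a mat" where
    "C = four_block_mat (mat 1 1 (\<lambda>_. 1)) (mat 1 n (\<lambda>(i, j). A $$ (0, Suc j))) (0\<^sub>m n 1) B"
  have S_mult: "(X * S) $$ (i, j) = (if j = 0 then \<Sum>k\<le>n. X $$ (i, k) else X $$ (i, j))"
    if "X \<in> carrier_mat (Suc n) (Suc n)" "i \<le> n" "j \<le> n" for X i j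
  proof -
    have "(X * S) $$ (i, j) = (\<Sum>k<Suc n. X $$ (i, k) * (if j = 0 \<or> k = j then 1 else 0))"
      using that by (simp add: S_def times_mat_def scalar_prod_def atLeast0LessThan del: sum.lessThan_Suc)
    also have "\<dots> = (if j = 0 then \<Sum>k\<le>n. X $$ (i, k) else X $$ (i, j))"
      using that by (auto simp: lessThan_Suc_atMost if_distrib cong: if_cong)
    finally show ?thesis .
  qed
  have S'_mult: "(S' * X) $$ (i, j) = (if i = 0 then X $$ (0, j) else X $$ (i, j) - X $$ (0, j))"
    if "X \<in> carrier_mat (Suc n) (Suc n)" "i \<le> n" "j \<le> n" for X i j
  proof -
    have "(S' * X) $$ (i, j) = (\<Sum>k<Suc n. (if i = k then 1 else if k = 0 then -1 else 0) * X $$ (k, j))"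
      using that by (simp add: S'_def times_mat_def scalar_prod_def atLeast0LessThan del: sum.lessThan_Suc)
    also have "\<dots> = (\<Sum>k<Suc n. (if i = k then X $$ (k, j) else 0) + (if k = 0 \<and> i \<noteq> 0 then - X $$ (k, j) else 0))"
      by (intro sum.cong) auto
    also have "\<dots> = (if i = 0 then X $$ (0, j) else X $$ (i, j) - X $$ (0, j))"
      using that by (auto simp: sum.distrib simp del: sum.lessThan_Suc)
    finally show ?thesis .
  qed
  have carr: "S \<in> carrier_mat (Suc n) (Suc n)" "S' \<in> carrier_mat (Suc n) (Suc n)"
    "C \<in> carrier_mat (Suc n) (Suc n)" "A * S \<in> carrier_mat (Suc n) (Suc n)"
    using A by (auto simp: S_def S'_def C_def B_def)
  have inv: "S' * S = 1\<^sub>m (Suc n)"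
  proof (rule eq_matI)
    fix i j assume "i < dim_row (1\<^sub>m (Suc n) :: 'a mat)" "j < dim_col (1\<^sub>m (Suc n) :: 'a mat)"
    hence ij: "i \<le> n" "j \<le> n" by auto
    show "(S' * S) $$ (i, j) = 1\<^sub>m (Suc n) $$ (i, j)"
      unfolding S'_mult[OF carr(1) ij] using ij by (auto simp: S_def)
  qed (use carr in auto)
  have inv': "S * S' = 1\<^sub>m (Suc n)"
    by (rule mat_mult_left_right_inverse[OF carr(2,1) inv])
  \<comment> \<open>The first column of \<open>A * S\<close> consists of row sums, hence of ones;
    subtracting row 0 from the other rows clears the rest of it.\<close>
  have C_eq: "C = S' * (A * S)"
  proof (rule eq_matI)
    fix i j assume "i < dim_row (S' * (A * S))" "j < dim_col (S' * (A * S))"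
    hence ij: "i \<le> n" "j \<le> n" using carr A by auto
    show "C $$ (i, j) = (S' * (A * S)) $$ (i, j)"
      unfolding S'_mult[OF carr(4) ij] S_mult[OF A ij] S_mult[OF A le0 ij(2)]
      using ij row by (cases i; cases j) (auto simp: C_def B_def)
  qed (use carr A in auto)
  have "S * C * S' = (S * S') * A * (S * S')"
    using carr A by (simp add: C_eq assoc_mult_mat[of _ "Suc n" "Suc n" _ "Suc n" _ "Suc n"])
  hence "A = S * C * S'" using A by (simp add: inv')
  hence "similar_mat A C"
    using carr A inv inv' by (intro similar_matI[of _ _ S S' "Suc n"]) auto
  hence "char_poly A = char_poly C" by (rule char_poly_similar)
  also have "\<dots> = char_poly (mat 1 1 (\<lambda>_. 1)) * char_poly B"
    unfolding C_def by (rule char_poly_four_block_zeros_col) (auto simp: B_def)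
  also have "char_poly (mat 1 1 (\<lambda>_. 1 :: 'a)) = [:-1, 1:]"
    by (simp add: char_poly_def char_poly_matrix_def det_single)
  finally show ?thesis .
qed

text \<open>If 1 is a repeated eigenvalue, an arbitrary eigenvector for it need not be orthogonal to
  the constants. Passing through the deflated matrix yields a vector of total 0 for every remaining
  root, whatever its multiplicity.\<close>

lemma deflated_left_eigenvector:
  fixes A :: "'a :: field mat"
  assumes A: "A \<in> carrier_mat (Suc n) (Suc n)"
    and row: "\<And>i. i \<le> n \<Longrightarrow> (\<Sum>j\<le>n. A $$ (i, j)) = 1"
    and root: "poly (char_poly (mat n n (\<lambda>(i, j). A $$ (Suc i, Suc j) - A $$ (0, Suc j)))) l = 0"
  obtains z where "\<exists>i\<le>n. z i \<noteq> 0" "(\<Sum>i\<le>n. z i) = 0"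
    "\<And>j. j \<le> n \<Longrightarrow> (\<Sum>i\<le>n. z i * A $$ (i, j)) = l * z j"
proof -
  define B where "B = mat n n (\<lambda>(i, j). A $$ (Suc i, Suc j) - A $$ (0, Suc j))"
  have B: "B \<in> carrier_mat n n" "transpose_mat B \<in> carrier_mat n n" by (auto simp: B_def)
  have "eigenvalue (transpose_mat B) l"
    using root unfolding eigenvalue_root_char_poly[OF B(2)] char_poly_transpose_mat[OF B(1)]
    by (simp add: B_def)
  then obtain y where y: "y \<in> carrier_vec n" "y \<noteq> 0\<^sub>v n" "transpose_mat B *\<^sub>v y = l \<cdot>\<^sub>v y"
    using B unfolding eigenvalue_def eigenvector_def by auto
  have y_eq: "(\<Sum>i<n. y $ i * (A $$ (Suc i, Suc j) - A $$ (0, Suc j))) = l * y $ j" if "j < n" for j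
  proof -
    have "(transpose_mat B *\<^sub>v y) $ j = l * y $ j" using y that by simp
    moreover have "(transpose_mat B *\<^sub>v y) $ j = (\<Sum>i<n. y $ i * (A $$ (Suc i, Suc j) - A $$ (0, Suc j)))"
      using that y(1)
      by (simp add: B_def mult_mat_vec_def scalar_prod_def atLeast0LessThan mult.commute)
    ultimately show ?thesis by simp
  qed
  \<comment> \<open>The entry at 0 is forced by the total 0; the equation for column 0 then follows
    from the others because the rows of \<open>A\<close> sum to 1.\<close>
  define z where "z i = (case i of 0 \<Rightarrow> - (\<Sum>i<n. y $ i) | Suc k \<Rightarrow> y $ k)" for i
  have split0: "(\<Sum>i\<le>n. f i) = f 0 + (\<Sum>i<n. f (Suc i))" for f :: "nat \<Rightarrow> 'a"
    by (simp add: lessThan_Suc_atMost[symmetric] sum.lessThan_Suc_shift del: sum.lessThan_Suc)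
  have sum0: "(\<Sum>i\<le>n. z i) = 0" by (simp add: split0 z_def)
  have eq_Suc: "(\<Sum>i\<le>n. z i * A $$ (i, Suc j)) = l * z (Suc j)" if "j < n" for j
    using y_eq[OF that] by (simp add: split0 z_def algebra_simps sum_subtractf sum_distrib_right)
  have eq: "(\<Sum>i\<le>n. z i * A $$ (i, j)) = l * z j" if "j \<le> n" for j
  proof (cases j)
    case 0
    have "(\<Sum>i\<le>n. z i * A $$ (i, 0)) = (\<Sum>i\<le>n. z i * (1 - (\<Sum>j<n. A $$ (i, Suc j))))"
      using row by (intro sum.cong refl arg_cong2[of _ _ _ _ "(*)"]) (simp add: split0 algebra_simps)
    also have "\<dots> = (\<Sum>i\<le>n. z i) - (\<Sum>i\<le>n. \<Sum>j<n. z i * A $$ (i, Suc j))"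
      by (simp add: algebra_simps sum_subtractf sum_distrib_left)
    also have "(\<Sum>i\<le>n. \<Sum>j<n. z i * A $$ (i, Suc j)) = (\<Sum>j<n. \<Sum>i\<le>n. z i * A $$ (i, Suc j))"
      by (rule sum.swap)
    also have "\<dots> = (\<Sum>j<n. l * z (Suc j))" by (simp add: eq_Suc)
    also have "(\<Sum>i\<le>n. z i) - \<dots> = l * z 0"
      by (simp add: sum0) (simp add: z_def sum_distrib_left)
    finally show ?thesis using 0 by simp
  qed (use eq_Suc that in auto)
  have "\<exists>i\<le>n. z i \<noteq> 0"
  proof (rule ccontr)
    assume "\<not> ?thesis"
    hence "z (Suc k) = 0" if "k < n" for k using that by auto
    hence "y = 0\<^sub>v n" using y(1) by (intro eq_vecI) (auto simp: z_def)
    with y show False by simp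
  qed
  from that[OF this sum0 eq] show thesis .
qed

text \<open>A left eigenvector divided by \<open>w\<close> has mean zero, and pairing the eigenvalue
  equation with its conjugate writes the eigenvalue as a Rayleigh quotient. As \<open>Q\<close> is
  nonnegative there are no negative eigenvalues, so the one-sided bound on \<open>Q\<close> also
  bounds the modulus.\<close>

lemma spectral_gap_ge:
  fixes P :: "real mat" and w :: "nat \<Rightarrow> real" and N :: nat
  defines "Q \<equiv> \<lambda>g. \<Sum>i<N. \<Sum>j<N. w i * P $$ (i, j) * g i * g j"
  assumes P: "P \<in> carrier_mat N N" and N: "N \<ge> 2"
    and w: "\<And>i. i < N \<Longrightarrow> w i > 0"
    and rev: "\<And>i j. i < N \<Longrightarrow> j < N \<Longrightarrow> w i * P $$ (i, j) = w j * P $$ (j, i)"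
    and row: "\<And>i. i < N \<Longrightarrow> (\<Sum>j<N. P $$ (i, j)) = 1"
    and nonneg: "\<And>g. 0 \<le> Q g"
    and gap: "\<And>g. (\<Sum>i<N. w i * g i) = 0 \<Longrightarrow> Q g \<le> (1 - c) * (\<Sum>i<N. w i * (g i)\<^sup>2)"
  shows "c \<le> spectral_gap P"
proof -
  obtain n where n: "N = Suc n" "n \<ge> 1" using N by (cases N) auto
  define A where "A = map_mat complex_of_real P"
  define B where "B = mat n n (\<lambda>(i, j). A $$ (Suc i, Suc j) - A $$ (0, Suc j))"
  have A: "A \<in> carrier_mat (Suc n) (Suc n)" using P n by (auto simp: A_def)
  have A_nth: "A $$ (i, j) = of_real (P $$ (i, j))" if "i \<le> n" "j \<le> n" for i j
    using P n that by (auto simp: A_def)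
  have rowA: "(\<Sum>j\<le>n. A $$ (i, j)) = 1" if "i \<le> n" for i
    using row[of i] that n A_nth
    by (simp add: lessThan_Suc_atMost of_real_sum[symmetric] del: of_real_sum sum.lessThan_Suc)
  have Bc: "B \<in> carrier_mat n n" by (simp add: B_def)
  have cB0: "char_poly B \<noteq> 0" using degree_monic_char_poly[OF Bc] by auto
  have "char_poly A = [:-1, 1:] * char_poly B"
    unfolding B_def by (rule char_poly_deflation[OF A rowA])
  hence "proots (char_poly A) = proots [:-1, 1:] + proots (char_poly B)"
    using cB0 by (simp only:) (rule proots_mult; simp)
  hence ms: "proots (char_poly A) - {#1#} = proots (char_poly B)" by simp
  have "size (proots (char_poly B)) = n"
    using degree_monic_char_poly[OF Bc] by (simp add: size_proots_complex)
  hence ne: "set_mset (proots (char_poly B)) \<noteq> {}" using n by auto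
  have bound: "cmod l \<le> 1 - c" if "l \<in># proots (char_poly B)" for l
  proof -
    have root: "poly (char_poly B) l = 0" using that cB0 by simp
    obtain z where z: "\<exists>i\<le>n. z i \<noteq> 0" "(\<Sum>i\<le>n. z i) = 0"
      "\<And>j. j \<le> n \<Longrightarrow> (\<Sum>i\<le>n. z i * A $$ (i, j)) = l * z j"
      by (rule deflated_left_eigenvector[OF A rowA root[unfolded B_def]]) auto
    define g where "g i = Re (z i) / w i" for i
    define h where "h i = Im (z i) / w i" for i
    have wpos: "w i > 0" if "i \<le> n" for i using w[of i] that n by simp
    have gh: "Complex (w i * g i) (w i * h i) = z i" if "i \<le> n" for i
      using wpos[OF that] by (simp add: g_def h_def complex_eq_iff)
    have "(\<Sum>i\<le>n. Re (z i)) = 0" "(\<Sum>i\<le>n. Im (z i)) = 0"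
      using z(2) by (simp_all add: complex_eq_iff)
    hence mean: "(\<Sum>i<N. w i * g i) = 0" "(\<Sum>i<N. w i * h i) = 0"
      using wpos by (simp_all add: n lessThan_Suc_atMost g_def h_def less_imp_neq[THEN not_sym] del: sum.lessThan_Suc)
    define G where "G = (\<Sum>i<N. w i * (g i)\<^sup>2) + (\<Sum>i<N. w i * (h i)\<^sup>2)"
    have lG: "l * of_real G = of_real (Q g + Q h)"
    proof -
      have "l * of_real G = (\<Sum>j\<le>n. (l * z j) * Complex (g j) (- h j))"
      proof -
        have "of_real G = (\<Sum>j\<le>n. z j * Complex (g j) (- h j))"
          unfolding G_def n lessThan_Suc_atMost sum.distrib[symmetric] of_real_sum
          by (intro sum.cong) (auto simp: gh[symmetric] complex_eq_iff power2_eq_square algebra_simps)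
        thus ?thesis by (simp add: sum_distrib_left mult.assoc)
      qed
      also have "\<dots> = (\<Sum>j\<le>n. \<Sum>i\<le>n. z i * A $$ (i, j) * Complex (g j) (- h j))"
        by (simp add: z(3)[symmetric] sum_distrib_right)
      also have "\<dots> = (\<Sum>j\<le>n. \<Sum>i\<le>n. Complex (w i * P $$ (i, j) * g i * g j + w i * P $$ (i, j) * h i * h j)
           (w i * P $$ (i, j) * h i * g j - w i * P $$ (i, j) * g i * h j))"
        by (intro sum.cong refl) (auto simp: A_nth gh[symmetric] complex_eq_iff algebra_simps)
      also have "\<dots> = Complex (\<Sum>j\<le>n. \<Sum>i\<le>n. w i * P $$ (i, j) * g i * g j + w i * P $$ (i, j) * h i * h j)
         ((\<Sum>j\<le>n. \<Sum>i\<le>n. w i * P $$ (i, j) * h i * g j) - (\<Sum>j\<le>n. \<Sum>i\<le>n. w i * P $$ (i, j) * g i * h j))"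
        by (simp add: complex_eq_iff sum_subtractf)
      \<comment> \<open>By reversibility the two mixed sums agree, so the imaginary part
        cancels.\<close>
      also have "(\<Sum>j\<le>n. \<Sum>i\<le>n. w i * P $$ (i, j) * g i * h j) = (\<Sum>i\<le>n. \<Sum>j\<le>n. w i * P $$ (i, j) * g i * h j)"
        by (rule sum.swap)
      also have "\<dots> = (\<Sum>j\<le>n. \<Sum>i\<le>n. w i * P $$ (i, j) * h i * g j)"
        using rev n by (intro sum.cong refl) simp
      also have "(\<Sum>j\<le>n. \<Sum>i\<le>n. w i * P $$ (i, j) * g i * g j + w i * P $$ (i, j) * h i * h j) = Q g + Q h"
        unfolding Q_def n lessThan_Suc_atMost
        by (subst sum.swap) (simp add: sum.distrib)
      finally show ?thesis by (simp add: complex_eq_iff)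
    qed
    have "G > 0"
    proof -
      obtain i where i: "i \<le> n" "z i \<noteq> 0" using z by auto
      have "0 < (\<Sum>i<N. w i * (g i)\<^sup>2 + w i * (h i)\<^sup>2)"
      proof (rule sum_pos2[of _ i])
        have "g i \<noteq> 0 \<or> h i \<noteq> 0" using i wpos[of i] by (auto simp: g_def h_def complex_eq_iff)
        thus "0 < w i * (g i)\<^sup>2 + w i * (h i)\<^sup>2"
          using wpos[of i] i by (auto simp: distrib_left[symmetric] sum_power2_gt_zero_iff intro!: mult_pos_pos)
        show "0 \<le> w j * (g j)\<^sup>2 + w j * (h j)\<^sup>2" if "j \<in> {..<N}" for j
          using wpos[of j] that n by auto
      qed (use i n in auto)
      thus ?thesis by (simp add: G_def sum.distrib)
    qed
    have "cmod (l * of_real G) = Q g + Q h" unfolding lG norm_of_real using nonneg[of g] nonneg[of h] by simp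
    also have "\<dots> \<le> (1 - c) * G"
      using gap[OF mean(1)] gap[OF mean(2)] by (simp add: G_def distrib_left)
    finally show ?thesis using \<open>G > 0\<close> by (simp add: norm_mult)
  qed
  have "Max (cmod ` set_mset (proots (char_poly B))) \<le> 1 - c"
    using ne bound by (subst Max_le_iff) auto
  thus ?thesis unfolding spectral_gap_def A_def[symmetric] ms by simp
qed

section \<open>Heat baths\<close>

text \<open>Lagrange's identity: the difference of the two sides is half the double sum of the
  nonnegative terms \<open>c i * c j * (x i * y j - x j * y i)\<^sup>2\<close>.\<close>

lemma weighted_Cauchy_Schwarz:
  fixes c x y :: "'a \<Rightarrow> real"
  assumes "\<And>i. i \<in> I \<Longrightarrow> c i \<ge> 0"
  shows "(\<Sum>i\<in>I. c i * x i * y i)\<^sup>2 \<le> (\<Sum>i\<in>I. c i * (x i)\<^sup>2) * (\<Sum>i\<in>I. c i * (y i)\<^sup>2)"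
proof -
  let ?X = "\<Sum>i\<in>I. c i * (x i)\<^sup>2" and ?Y = "\<Sum>i\<in>I. c i * (y i)\<^sup>2" and ?Z = "\<Sum>i\<in>I. c i * x i * y i"
  have "0 \<le> (\<Sum>i\<in>I. \<Sum>j\<in>I. c i * c j * (x i * y j - x j * y i)\<^sup>2)"
    using assms by (intro sum_nonneg mult_nonneg_nonneg) auto
  also have "\<dots> = (\<Sum>i\<in>I. \<Sum>j\<in>I. c i * (x i)\<^sup>2 * (c j * (y j)\<^sup>2) + c i * (y i)\<^sup>2 * (c j * (x j)\<^sup>2)
      - 2 * ((c i * x i * y i) * (c j * x j * y j)))"
    by (intro sum.cong refl) (simp add: power2_eq_square algebra_simps)
  also have "\<dots> = ?X * ?Y + ?Y * ?X - 2 * (?Z * ?Z)"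
    by (simp only: sum.distrib sum_subtractf sum_product sum_distrib_left[symmetric])
  finally show ?thesis by (simp add: power2_eq_square algebra_simps)
qed

lemma finite_configs: "finite B \<Longrightarrow> finite (configs q B)"
  using finite_set_of_finite_funs[of B "{1..q}" 0]
  by (rule rev_finite_subset) (auto simp: configs_def)

lemma configs_nonempty: "q \<ge> 1 \<Longrightarrow> configs q B \<noteq> {}"
  by (auto simp: configs_def intro!: exI[of _ "\<lambda>x. if x \<in> B then 1 else 0"] split: if_splits)

lemma override_on_configs:
  "\<sigma> \<in> configs q V \<Longrightarrow> \<rho> \<in> configs q T \<Longrightarrow> T \<subseteq> V \<Longrightarrow> override_on \<sigma> \<rho> T \<in> configs q V"
  by (auto simp: configs_def override_on_def)

lemma restr_configs: "\<sigma> \<in> configs q V \<Longrightarrow> T \<subseteq> V \<Longrightarrow> restr \<sigma> T \<in> configs q T"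
  by (auto simp: configs_def restr_def)

text \<open>The conditional expectation of \<open>f\<close> given the spins off \<open>T\<close>,
  for the measure proportional to \<open>w\<close>.\<close>

definition heat_bath ::
  "nat \<Rightarrow> ((int list \<Rightarrow> nat) \<Rightarrow> real) \<Rightarrow> int list set \<Rightarrow> ((int list \<Rightarrow> nat) \<Rightarrow> real) \<Rightarrow> (int list \<Rightarrow> nat) \<Rightarrow> real"
  where "heat_bath q w T f \<sigma> = (\<Sum>\<rho>\<in>configs q T. w (override_on \<sigma> \<rho> T) * f (override_on \<sigma> \<rho> T)) /
      (\<Sum>\<rho>\<in>configs q T. w (override_on \<sigma> \<rho> T))"

lemma heat_bath_cong_off:
  assumes "\<And>x. x \<notin> T \<Longrightarrow> \<sigma> x = \<sigma>' x"
  shows "heat_bath q w T f \<sigma> = heat_bath q w T f \<sigma>'"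
proof -
  have "override_on \<sigma> \<rho> T = override_on \<sigma>' \<rho> T" for \<rho>
    using assms by (auto simp: override_on_def)
  thus ?thesis by (simp add: heat_bath_def)
qed

locale positive_weight =
  fixes q :: nat and V :: "int list set" and w :: "(int list \<Rightarrow> nat) \<Rightarrow> real"
  assumes q: "q \<ge> 1" and finV: "finite V" and w_pos: "w \<sigma> > 0"
begin

abbreviation "hb \<equiv> heat_bath q w"

lemma fin: "finite (configs q V)" "T \<subseteq> V \<Longrightarrow> finite (configs q T)"
  using finV by (auto intro: finite_configs finite_subset)

lemma normaliser_pos: "T \<subseteq> V \<Longrightarrow> (\<Sum>\<rho>\<in>configs q T. w (override_on \<sigma> \<rho> T)) > 0"
  using q by (intro sum_pos fin configs_nonempty w_pos)

lemma heat_bath_eqI: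
  assumes "T \<subseteq> V" "(\<Sum>\<rho>\<in>configs q T. w (override_on \<sigma> \<rho> T) * (f (override_on \<sigma> \<rho> T) - c)) = 0"
  shows "hb T f \<sigma> = c"
  using assms normaliser_pos[OF assms(1), of \<sigma>]
  by (simp add: heat_bath_def field_simps sum_subtractf sum_distrib_left)

lemma heat_bath_diff: "hb T (\<lambda>\<tau>. f \<tau> - g \<tau>) \<sigma> = hb T f \<sigma> - hb T g \<sigma>"
  by (simp add: heat_bath_def right_diff_distrib sum_subtractf diff_divide_distrib)

lemma heat_bath_const: "T \<subseteq> V \<Longrightarrow> hb T (\<lambda>_. c) \<sigma> = c"
  by (rule heat_bath_eqI) auto

lemma heat_bath_invariant: "hb T f (override_on \<sigma> \<rho> T) = hb T f \<sigma>"
  by (rule heat_bath_cong_off) auto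

lemma heat_bath_abs_le:
  assumes "T \<subseteq> V" "\<And>\<rho>. \<rho> \<in> configs q T \<Longrightarrow> \<bar>f (override_on \<sigma> \<rho> T)\<bar> \<le> c"
  shows "\<bar>hb T f \<sigma>\<bar> \<le> c"
proof -
  let ?W = "\<Sum>\<rho>\<in>configs q T. w (override_on \<sigma> \<rho> T)"
  have "\<bar>\<Sum>\<rho>\<in>configs q T. w (override_on \<sigma> \<rho> T) * f (override_on \<sigma> \<rho> T)\<bar>
      \<le> (\<Sum>\<rho>\<in>configs q T. w (override_on \<sigma> \<rho> T) * c)"
    using assms(2) w_pos by (intro order_trans[OF sum_abs] sum_mono) (auto simp: abs_mult less_imp_le intro!: mult_left_mono)
  also have "\<dots> = c * ?W" by (simp add: sum_distrib_left mult.commute)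
  finally show ?thesis using normaliser_pos[OF assms(1), of \<sigma>] by (simp add: heat_bath_def field_simps)
qed

text \<open>Swapping the spins of \<open>\<sigma>\<close> on \<open>T\<close> with the resampled spins is a bijection of the pairs
  \<open>(\<sigma>, \<rho>)\<close>; it exchanges the weights of the configuration before and after the update.\<close>
lemma heat_bath_projection:
  assumes T: "T \<subseteq> V"
    and h: "\<And>\<sigma> \<rho>. \<sigma> \<in> configs q V \<Longrightarrow> \<rho> \<in> configs q T \<Longrightarrow> h (override_on \<sigma> \<rho> T) = h \<sigma>"
  shows "(\<Sum>\<sigma>\<in>configs q V. w \<sigma> * h \<sigma> * hb T f \<sigma>) = (\<Sum>\<sigma>\<in>configs q V. w \<sigma> * h \<sigma> * f \<sigma>)"
proof -
  define W where "W \<sigma> = (\<Sum>\<rho>\<in>configs q T. w (override_on \<sigma> \<rho> T))" for \<sigma>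
  have W_pos: "W \<sigma> > 0" for \<sigma> using normaliser_pos[OF T] by (simp add: W_def)
  have W_inv: "W (override_on \<sigma> \<rho> T) = W \<sigma>" for \<sigma> \<rho>
    unfolding W_def by (intro sum.cong arg_cong[of _ _ w]) (auto simp: override_on_def)
  let ?X = "configs q V \<times> configs q T"
  let ?swap = "\<lambda>(\<sigma>, \<rho>). (override_on \<sigma> \<rho> T, restr \<sigma> T)"
  have "(\<Sum>\<sigma>\<in>configs q V. w \<sigma> * h \<sigma> * hb T f \<sigma>)
      = (\<Sum>(\<sigma>, \<rho>)\<in>?X. w \<sigma> * h \<sigma> * (w (override_on \<sigma> \<rho> T) * f (override_on \<sigma> \<rho> T)) / W \<sigma>)"
    by (simp add: heat_bath_def W_def[symmetric] sum.cartesian_product[symmetric] sum_divide_distrib sum_distrib_left)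
  also have "\<dots> = (\<Sum>(\<sigma>, \<rho>)\<in>?X. w (override_on \<sigma> \<rho> T) * h \<sigma> * (w \<sigma> * f \<sigma>) / W \<sigma>)"
  proof (rule sum.reindex_bij_witness[of _ ?swap ?swap])
    fix a assume a: "a \<in> ?X"
    obtain \<sigma> \<rho> where [simp]: "a = (\<sigma>, \<rho>)" by (cases a)
    have s: "\<sigma> \<in> configs q V" "\<rho> \<in> configs q T" using a by auto
    have *: "override_on (override_on \<sigma> \<rho> T) (restr \<sigma> T) T = \<sigma>"
      by (auto simp: override_on_def restr_def)
    have "restr (override_on \<sigma> \<rho> T) T = \<rho>"
      using s by (auto simp: override_on_def restr_def configs_def)
    with * show "?swap (?swap a) = a" "?swap (?swap a) = a" by auto
    show "?swap a \<in> ?X" "?swap a \<in> ?X"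
      using s override_on_configs[OF s T] restr_configs[OF s(1) T] by auto
    show "(case ?swap a of (\<sigma>, \<rho>) \<Rightarrow> w (override_on \<sigma> \<rho> T) * h \<sigma> * (w \<sigma> * f \<sigma>) / W \<sigma>) =
      (case a of (\<sigma>, \<rho>) \<Rightarrow> w \<sigma> * h \<sigma> * (w (override_on \<sigma> \<rho> T) * f (override_on \<sigma> \<rho> T)) / W \<sigma>)"
      using h[OF s] by (simp add: * W_inv)
  qed
  also have "\<dots> = (\<Sum>\<sigma>\<in>configs q V. \<Sum>\<rho>\<in>configs q T. w (override_on \<sigma> \<rho> T) * (h \<sigma> * (w \<sigma> * f \<sigma>) / W \<sigma>))"
    by (simp add: sum.cartesian_product[symmetric] ac_simps)
  also have "\<dots> = (\<Sum>\<sigma>\<in>configs q V. w \<sigma> * h \<sigma> * f \<sigma>)"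
    unfolding sum_distrib_right[symmetric] W_def[symmetric]
    using W_pos by (intro sum.cong) (auto simp: less_imp_neq[THEN not_sym])
  finally show ?thesis .
qed

text \<open>The function \<open>hb T g\<close> ignores the spins on \<open>T\<close>, so it may
  serve as the test function \<open>h\<close> of the projection property. The right-hand side is
  symmetric in \<open>f\<close> and \<open>g\<close>.\<close>

lemma heat_bath_self_adjoint:
  assumes "T \<subseteq> V"
  shows "(\<Sum>\<sigma>\<in>configs q V. w \<sigma> * f \<sigma> * hb T g \<sigma>) = (\<Sum>\<sigma>\<in>configs q V. w \<sigma> * hb T f \<sigma> * hb T g \<sigma>)"
  using heat_bath_projection[OF assms, of "hb T g" f] by (simp add: heat_bath_invariant ac_simps)

end

section \<open>The quadratic form of the Swendsen--Wang dynamics\<close>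

definition bern :: "real \<Rightarrow> 'e set \<Rightarrow> 'e set \<Rightarrow> real" where
  "bern p E U = p ^ card U * (1 - p) ^ (card E - card U)"

lemma bern_nonneg: "0 \<le> p \<Longrightarrow> p \<le> 1 \<Longrightarrow> bern p E U \<ge> 0"
  by (simp add: bern_def)

lemma bern_total:
  assumes "finite E"
  shows "(\<Sum>U\<in>Pow E. bern p E U) = 1"
proof -
  have "1 = (\<Prod>x\<in>E. p + (1 - p))" by simp
  also have "\<dots> = (\<Sum>U\<in>Pow E. p ^ card U * (1 - p) ^ card (E - U))"
    by (subst prod_add[OF assms]) simp
  also have "\<dots> = (\<Sum>U\<in>Pow E. bern p E U)"
    using assms by (intro sum.cong) (auto simp: bern_def card_Diff_subset finite_subset)
  finally show ?thesis by simp
qed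

text \<open>The weight of \<open>U\<close> factors over \<open>M\<close> and \<open>E - M\<close>,
  and the second factor sums to 1. This allows the coins thrown on the monochromatic edges to be
  replaced by coins on a fixed \<open>E\<close>, independent of the spins.\<close>

lemma bern_marginal:
  assumes E: "finite E" and "M \<subseteq> E" "A \<subseteq> M"
  shows "(\<Sum>U | U \<subseteq> E \<and> U \<inter> M = A. bern p E U) = bern p M A"
proof -
  have fin: "finite M" "finite A" using assms finite_subset by metis+
  have "(\<Sum>U | U \<subseteq> E \<and> U \<inter> M = A. bern p E U) = (\<Sum>U\<in>Pow (E - M). bern p E (A \<union> U))"
    using assms by (intro sum.reindex_bij_witness[of _ "\<lambda>U. A \<union> U" "\<lambda>U. U - M"])
      (auto intro!: arg_cong[of _ _ "bern p E"])
  also have "\<dots> = (\<Sum>U\<in>Pow (E - M). bern p M A * bern p (E - M) U)"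
  proof (intro sum.cong refl)
    fix U assume U: "U \<in> Pow (E - M)"
    have U': "finite U" using U E finite_subset by (metis PowD finite_Diff)
    have "card (A \<union> U) = card A + card U" using U U' assms fin by (intro card_Un_disjoint) auto
    moreover have "card E = card M + card (E - M)"
      using assms fin by (simp add: card_Diff_subset card_mono)
    moreover have "card A \<le> card M" "card U \<le> card (E - M)"
      using U assms fin by (auto intro!: card_mono)
    ultimately have "card E - card (A \<union> U) = (card M - card A) + (card (E - M) - card U)"
      by linarith
    thus "bern p E (A \<union> U) = bern p M A * bern p (E - M) U"
      using \<open>card (A \<union> U) = _\<close> by (simp add: bern_def power_add)
  qed
  also have "\<dots> = bern p M A"
    using E by (simp add: sum_distrib_left[symmetric] bern_total)
  finally show ?thesis .
qed

section \<open>Monochromatic edges and open components\<close>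

lemma mono_edges_subset: "mono_edges V \<sigma> \<subseteq> edges V"
  by (auto simp: mono_edges_def edges_def)

lemma adj_sym: "adj x y \<longleftrightarrow> adj y x"
  by (auto simp: adj_def abs_minus_commute)

lemma finite_edges: "finite V \<Longrightarrow> finite (edges V)"
  by (rule finite_subset[of _ "Pow V"]) (auto simp: edges_def)

lemma pair_in_mono_edges:
  "{x, y} \<in> mono_edges V \<sigma> \<longleftrightarrow> x \<in> V \<and> y \<in> V \<and> adj x y \<and> \<sigma> x = \<sigma> y"
  unfolding mono_edges_def by (auto simp: doubleton_eq_iff adj_sym)

lemma edge_in_mono_edges:
  assumes "e \<in> edges V"
  shows "e \<in> mono_edges V \<sigma> \<longleftrightarrow> (\<forall>x\<in>e. \<forall>y\<in>e. \<sigma> x = \<sigma> y)"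
  using assms pair_in_mono_edges[of _ _ V \<sigma>] unfolding edges_def by auto

lemma constant_on_components_iff:
  assumes A: "A \<subseteq> edges V"
  shows "(\<forall>(x, y)\<in>conn_rel V A. \<sigma> x = \<sigma> y) \<longleftrightarrow> A \<subseteq> mono_edges V \<sigma>"
proof
  assume *: "\<forall>(x, y)\<in>conn_rel V A. \<sigma> x = \<sigma> y"
  show "A \<subseteq> mono_edges V \<sigma>"
  proof
    fix e assume e: "e \<in> A"
    then obtain x y where xy: "e = {x, y}" "x \<in> V" "y \<in> V" "adj x y" using A by (auto simp: edges_def)
    hence "(x, y) \<in> conn_rel V A" using e by (auto simp: conn_rel_def)
    thus "e \<in> mono_edges V \<sigma>" using * xy pair_in_mono_edges by auto
  qed
next
  assume *: "A \<subseteq> mono_edges V \<sigma>"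
  have "\<sigma> x = \<sigma> y" if "(x, y) \<in> {(x, y). {x, y} \<in> A}\<^sup>*" for x y
    using that by induction (use * pair_in_mono_edges in auto)
  thus "\<forall>(x, y)\<in>conn_rel V A. \<sigma> x = \<sigma> y" by (auto simp: conn_rel_def)
qed

lemma equiv_conn_rel: "equiv V (conn_rel V A)"
proof (rule equivI)
  have s: "sym ({(x, y). {x, y} \<in> A}\<^sup>*)"
    by (intro sym_rtrancl symI) (auto simp: insert_commute)
  show "conn_rel V A \<subseteq> V \<times> V" "refl_on V (conn_rel V A)" "sym (conn_rel V A)" "trans (conn_rel V A)"
    using s by (auto simp: conn_rel_def refl_on_def sym_def trans_def)
qed

text \<open>A colouring constant on components is a free choice of one spin per component. The count
  turns the factor \<open>(1 / q) ^ card (components V A)\<close> of the kernel into a uniform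
  distribution.\<close>

lemma card_constant_on_components:
  assumes V: "finite V" and A: "A \<subseteq> edges V"
  shows "card {\<sigma> \<in> configs q V. A \<subseteq> mono_edges V \<sigma>} = q ^ card (components V A)"
proof -
  let ?R = "conn_rel V A" and ?C = "components V A"
  note eq = equiv_conn_rel[of V A]
  have finC: "finite ?C" using V eq unfolding components_def
    by (intro finite_quotient) (auto simp: equiv_def)
  \<comment> \<open>Reading a configuration at one chosen vertex of each component inverts the map
    \<open>?f\<close>, which spreads a colour over its component.\<close>
  define rep where "rep c = (SOME x. x \<in> c)" for c :: "int list set"
  have rep: "rep c \<in> c" if "c \<in> ?C" for c
    using in_quotient_imp_non_empty[OF eq] that unfolding rep_def components_def some_in_eq by blast
  let ?f = "\<lambda>\<phi> x. if x \<in> V then \<phi> (?R `` {x}) else (0::nat)"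
  have cls: "?R `` {x} \<in> ?C" if "x \<in> V" for x using that by (simp add: components_def quotientI)
  have "bij_betw ?f (PiE ?C (\<lambda>_. {1..q})) {\<sigma> \<in> configs q V. \<forall>(x, y)\<in>?R. \<sigma> x = \<sigma> y}"
  proof (rule bij_betw_byWitness[where f' = "\<lambda>\<sigma>. \<lambda>c\<in>?C. \<sigma> (rep c)"])
    show "\<forall>\<phi>\<in>PiE ?C (\<lambda>_. {1..q}). (\<lambda>c\<in>?C. ?f \<phi> (rep c)) = \<phi>"
    proof
      fix \<phi> assume \<phi>: "\<phi> \<in> PiE ?C (\<lambda>_. {1..q})"
      have "?f \<phi> (rep c) = \<phi> c" if c: "c \<in> ?C" for c
      proof -
        have "rep c \<in> V" using rep[OF c] c in_quotient_imp_subset[OF eq] by (auto simp: components_def)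
        moreover have "?R `` {rep c} = c"
          using quotient_eq_iff[OF eq cls[OF calculation, unfolded components_def] c[unfolded components_def], of "rep c" "rep c"]
            rep[OF c] eq calculation by (auto simp: equiv_def refl_on_def)
        ultimately show ?thesis by simp
      qed
      thus "(\<lambda>c\<in>?C. ?f \<phi> (rep c)) = \<phi>" using \<phi> by (auto simp: PiE_def extensional_def fun_eq_iff)
    qed
    show "\<forall>\<sigma>\<in>{\<sigma> \<in> configs q V. \<forall>(x, y)\<in>?R. \<sigma> x = \<sigma> y}. ?f (\<lambda>c\<in>?C. \<sigma> (rep c)) = \<sigma>"
    proof (intro ballI ext)
      fix \<sigma> x assume \<sigma>: "\<sigma> \<in> {\<sigma> \<in> configs q V. \<forall>(x, y)\<in>?R. \<sigma> x = \<sigma> y}"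
      show "?f (\<lambda>c\<in>?C. \<sigma> (rep c)) x = \<sigma> x"
      proof (cases "x \<in> V")
        case True
        have "(x, rep (?R `` {x})) \<in> ?R" using rep[OF cls[OF True]] by auto
        thus ?thesis using True cls[OF True] \<sigma> by auto
      qed (use \<sigma> in \<open>auto simp: configs_def\<close>)
    qed
    show "?f ` PiE ?C (\<lambda>_. {1..q}) \<subseteq> {\<sigma> \<in> configs q V. \<forall>(x, y)\<in>?R. \<sigma> x = \<sigma> y}"
    proof (intro image_subsetI)
      fix \<phi> assume \<phi>: "\<phi> \<in> PiE ?C (\<lambda>_. {1..q})"
      have "?f \<phi> x = ?f \<phi> y" if xy: "(x, y) \<in> ?R" for x y
        using equiv_class_eq[OF eq xy] xy by (auto simp: conn_rel_def)
      thus "?f \<phi> \<in> {\<sigma> \<in> configs q V. \<forall>(x, y)\<in>?R. \<sigma> x = \<sigma> y}"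
        using \<phi> cls by (auto simp: configs_def PiE_def Pi_def)
    qed
    show "(\<lambda>\<sigma>. \<lambda>c\<in>?C. \<sigma> (rep c)) ` {\<sigma> \<in> configs q V. \<forall>(x, y)\<in>?R. \<sigma> x = \<sigma> y} \<subseteq> PiE ?C (\<lambda>_. {1..q})"
    proof (intro image_subsetI PiE_I)
      fix \<sigma> c assume \<sigma>: "\<sigma> \<in> {\<sigma> \<in> configs q V. \<forall>(x, y)\<in>?R. \<sigma> x = \<sigma> y}" and c: "c \<in> ?C"
      have "rep c \<in> V" using rep[OF c] c in_quotient_imp_subset[OF eq] by (auto simp: components_def)
      thus "(\<lambda>c\<in>?C. \<sigma> (rep c)) c \<in> {1..q}" using c \<sigma> by (auto simp: configs_def)
    qed auto
  qed
  hence "card (PiE ?C (\<lambda>_. {1..q})) = card {\<sigma> \<in> configs q V. \<forall>(x, y)\<in>?R. \<sigma> x = \<sigma> y}"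
    by (rule bij_betw_same_card)
  thus ?thesis using constant_on_components_iff[OF A] finC by (simp add: card_PiE)
qed

text \<open>Left unnormalised: the form inequalities and the mean-zero condition are homogeneous in
  the weight.\<close>

definition gibbs_weight :: "real \<Rightarrow> int list set \<Rightarrow> (int list \<Rightarrow> nat) \<Rightarrow> real" where
  "gibbs_weight \<beta> V \<sigma> = exp (\<beta> * real (card (mono_edges V \<sigma>)))"

section \<open>The Swendsen--Wang kernel and the joint law of spins and bonds\<close>

locale potts =
  fixes q :: nat and \<beta> :: real and V :: "int list set"
  assumes q: "q \<ge> 2" and \<beta>: "\<beta> > 0" and finV: "finite V"
begin

abbreviation "w \<equiv> gibbs_weight \<beta> V"

definition "p = 1 - exp (- \<beta>)"
definition "\<Omega> A = {\<sigma> \<in> configs q V. A \<subseteq> mono_edges V \<sigma>}"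

sublocale positive_weight q V w
  using q finV by unfold_locales (auto simp: gibbs_weight_def)

lemma p: "0 < p" "p < 1" "0 \<le> p" "p \<le> 1"
  using \<beta> by (auto simp: p_def)

lemma finE: "finite (edges V)"
  using finV by (rule finite_edges)

lemma finM: "finite (mono_edges V \<sigma>)"
  using finE mono_edges_subset finite_subset by blast

lemma fin\<Omega>: "finite (\<Omega> A)" "\<Omega> A \<subseteq> configs q V"
  using fin by (auto simp: \<Omega>_def)

text \<open>The Edwards--Sokal coupling: since \<open>1 - p = exp (- \<beta>)\<close>, the Gibbs
  weight is \<open>1 - p\<close> to the power minus the number of monochromatic edges, which cancels
  against the closed edges. The joint weight of spins and bonds depends on \<open>A\<close> alone,
  so given \<open>A\<close> the spins are uniform on \<open>\<Omega> A\<close>.\<close>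

lemma weight_mult_bern:
  assumes "A \<subseteq> mono_edges V \<sigma>"
  shows "w \<sigma> * bern p (mono_edges V \<sigma>) A = (p / (1 - p)) ^ card A"
proof -
  have "w \<sigma> = (1 / (1 - p)) ^ card (mono_edges V \<sigma>)"
    by (simp add: gibbs_weight_def p_def exp_minus field_simps exp_of_nat_mult[symmetric] mult.commute)
  moreover have "card (mono_edges V \<sigma>) = (card (mono_edges V \<sigma>) - card A) + card A"
    using card_mono[OF finM assms] by simp
  ultimately have "w \<sigma> = (1 / (1 - p)) ^ (card (mono_edges V \<sigma>) - card A) * (1 / (1 - p)) ^ card A"
    by (metis power_add)
  thus ?thesis using p by (simp add: bern_def field_simps)
qed

lemma card\<Omega>: "A \<subseteq> edges V \<Longrightarrow> card (\<Omega> A) = q ^ card (components V A)"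
  unfolding \<Omega>_def using finV by (rule card_constant_on_components)

text \<open>Recolouring the components at random is a uniform draw from
  \<open>\<Omega> A\<close>.\<close>

lemma SW_kernel_eq:
  assumes "\<sigma> \<in> configs q V" "\<sigma>' \<in> configs q V"
  shows "SW_kernel q \<beta> V \<sigma> \<sigma>' =
    (\<Sum>A\<in>Pow (mono_edges V \<sigma>). bern p (mono_edges V \<sigma>) A * (of_bool (\<sigma>' \<in> \<Omega> A) / card (\<Omega> A)))"
proof -
  have "SW_kernel q \<beta> V \<sigma> \<sigma>' = (\<Sum>A\<in>Pow (mono_edges V \<sigma>). bern p (mono_edges V \<sigma>) A *
        (if \<forall>(x, y)\<in>conn_rel V A. \<sigma>' x = \<sigma>' y then (1 / real q) ^ card (components V A) else 0))"
    by (simp add: SW_kernel_def Let_def bern_def p_def)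
  also have "\<dots> = (\<Sum>A\<in>Pow (mono_edges V \<sigma>). bern p (mono_edges V \<sigma>) A * (of_bool (\<sigma>' \<in> \<Omega> A) / card (\<Omega> A)))"
  proof (intro sum.cong refl arg_cong2[of _ _ _ _ "(*)"])
    fix A assume "A \<in> Pow (mono_edges V \<sigma>)"
    hence A: "A \<subseteq> edges V" using mono_edges_subset by blast
    show "(if \<forall>(x, y)\<in>conn_rel V A. \<sigma>' x = \<sigma>' y then (1 / real q) ^ card (components V A) else 0)
       = of_bool (\<sigma>' \<in> \<Omega> A) / real (card (\<Omega> A))"
      using assms(2) by (simp add: constant_on_components_iff[OF A] card\<Omega>[OF A]) (simp add: \<Omega>_def power_divide)
  qed
  finally show ?thesis .
qed

lemma SW_kernel_row_sum:
  assumes \<sigma>: "\<sigma> \<in> configs q V"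
  shows "(\<Sum>\<sigma>'\<in>configs q V. SW_kernel q \<beta> V \<sigma> \<sigma>') = 1"
proof -
  have "(\<Sum>\<sigma>'\<in>configs q V. SW_kernel q \<beta> V \<sigma> \<sigma>') = (\<Sum>A\<in>Pow (mono_edges V \<sigma>).
      bern p (mono_edges V \<sigma>) A * ((\<Sum>\<sigma>'\<in>configs q V. of_bool (\<sigma>' \<in> \<Omega> A)) / card (\<Omega> A)))"
    by (simp add: SW_kernel_eq[OF \<sigma>] sum_distrib_left sum_divide_distrib) (rule sum.swap)
  also have "\<dots> = (\<Sum>A\<in>Pow (mono_edges V \<sigma>). bern p (mono_edges V \<sigma>) A)"
  proof (intro sum.cong refl)
    fix A assume A: "A \<in> Pow (mono_edges V \<sigma>)"
    hence "\<sigma> \<in> \<Omega> A" using \<sigma> by (auto simp: \<Omega>_def)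
    hence "card (\<Omega> A) > 0" using fin\<Omega> by (auto simp: card_gt_0_iff)
    moreover have "(\<Sum>\<sigma>'\<in>configs q V. of_bool (\<sigma>' \<in> \<Omega> A)) = real (card (\<Omega> A))"
      using fin\<Omega>[of A] fin by (simp add: of_bool_def sum.If_cases Int_absorb1)
    ultimately show "bern p (mono_edges V \<sigma>) A * ((\<Sum>\<sigma>'\<in>configs q V. of_bool (\<sigma>' \<in> \<Omega> A)) / card (\<Omega> A))
        = bern p (mono_edges V \<sigma>) A" by simp
  qed
  also have "\<dots> = 1" by (rule bern_total[OF finM])
  finally show ?thesis .
qed

text \<open>Extending the sum to all edge sets is harmless because the indicator of
  \<open>\<sigma> \<in> \<Omega> A\<close> kills the new terms. The range of summation no longer
  depends on \<open>\<sigma>\<close>, and the expression becomes visibly symmetric.\<close>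

lemma weight_SW_kernel:
  assumes \<sigma>: "\<sigma> \<in> configs q V" "\<sigma>' \<in> configs q V"
  shows "w \<sigma> * SW_kernel q \<beta> V \<sigma> \<sigma>' =
    (\<Sum>A\<in>Pow (edges V). (p / (1 - p)) ^ card A / card (\<Omega> A) * (of_bool (\<sigma> \<in> \<Omega> A) * of_bool (\<sigma>' \<in> \<Omega> A)))"
proof -
  have "w \<sigma> * SW_kernel q \<beta> V \<sigma> \<sigma>' = (\<Sum>A\<in>Pow (mono_edges V \<sigma>).
      w \<sigma> * bern p (mono_edges V \<sigma>) A * (of_bool (\<sigma>' \<in> \<Omega> A) / card (\<Omega> A)))"
    by (simp add: SW_kernel_eq[OF assms] sum_distrib_left mult.assoc)
  also have "\<dots> = (\<Sum>A\<in>Pow (mono_edges V \<sigma>). (p / (1 - p)) ^ card A / card (\<Omega> A) * (of_bool (\<sigma> \<in> \<Omega> A) * of_bool (\<sigma>' \<in> \<Omega> A)))"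
    using \<sigma> by (intro sum.cong refl) (auto simp: weight_mult_bern \<Omega>_def)
  also have "\<dots> = (\<Sum>A\<in>Pow (edges V). (p / (1 - p)) ^ card A / card (\<Omega> A) * (of_bool (\<sigma> \<in> \<Omega> A) * of_bool (\<sigma>' \<in> \<Omega> A)))"
    using mono_edges_subset finE by (intro sum.mono_neutral_left) (auto simp: \<Omega>_def)
  finally show ?thesis .
qed

lemma SW_reversible:
  assumes "\<sigma> \<in> configs q V" "\<sigma>' \<in> configs q V"
  shows "w \<sigma> * SW_kernel q \<beta> V \<sigma> \<sigma>' = w \<sigma>' * SW_kernel q \<beta> V \<sigma>' \<sigma>"
  by (simp only: weight_SW_kernel[OF assms] weight_SW_kernel[OF assms(2,1)] mult.commute[of "of_bool (\<sigma> \<in> _)"])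

definition SW_form :: "((int list \<Rightarrow> nat) \<Rightarrow> real) \<Rightarrow> real" where
  "SW_form f = (\<Sum>\<sigma>\<in>configs q V. \<Sum>\<sigma>'\<in>configs q V. w \<sigma> * SW_kernel q \<beta> V \<sigma> \<sigma>' * f \<sigma> * f \<sigma>')"

text \<open>A step goes to the bonds and back by the adjoint map, so the form is a sum of squares:
  the second moment of the conditional expectation of \<open>f\<close> given the bonds. Positivity
  follows at once.\<close>

lemma SW_form_eq:
  "SW_form f = (\<Sum>A\<in>Pow (edges V). (p / (1 - p)) ^ card A / card (\<Omega> A) * (\<Sum>\<sigma>\<in>\<Omega> A. f \<sigma>)\<^sup>2)"
proof -
  have ind: "(\<Sum>\<sigma>\<in>configs q V. of_bool (\<sigma> \<in> \<Omega> A) * f \<sigma>) = (\<Sum>\<sigma>\<in>\<Omega> A. f \<sigma>)" for A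
    using fin\<Omega>[of A] fin by (intro sum.mono_neutral_cong_right) auto
  have "SW_form f = (\<Sum>\<sigma>\<in>configs q V. \<Sum>\<sigma>'\<in>configs q V. \<Sum>A\<in>Pow (edges V).
      (p / (1 - p)) ^ card A / card (\<Omega> A) * ((of_bool (\<sigma> \<in> \<Omega> A) * f \<sigma>) * (of_bool (\<sigma>' \<in> \<Omega> A) * f \<sigma>')))"
    unfolding SW_form_def by (intro sum.cong refl) (simp add: weight_SW_kernel sum_distrib_right, simp add: ac_simps)
  also have "\<dots> = (\<Sum>\<sigma>\<in>configs q V. \<Sum>A\<in>Pow (edges V). \<Sum>\<sigma>'\<in>configs q V.
      (p / (1 - p)) ^ card A / card (\<Omega> A) * ((of_bool (\<sigma> \<in> \<Omega> A) * f \<sigma>) * (of_bool (\<sigma>' \<in> \<Omega> A) * f \<sigma>')))"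
    by (intro sum.cong refl sum.swap)
  also have "\<dots> = (\<Sum>A\<in>Pow (edges V). \<Sum>\<sigma>\<in>configs q V. \<Sum>\<sigma>'\<in>configs q V.
      (p / (1 - p)) ^ card A / card (\<Omega> A) * ((of_bool (\<sigma> \<in> \<Omega> A) * f \<sigma>) * (of_bool (\<sigma>' \<in> \<Omega> A) * f \<sigma>')))"
    by (rule sum.swap)
  also have "\<dots> = (\<Sum>A\<in>Pow (edges V). (p / (1 - p)) ^ card A / card (\<Omega> A) * (\<Sum>\<sigma>\<in>\<Omega> A. f \<sigma>)\<^sup>2)"
    by (simp only: sum_distrib_left[symmetric] sum_distrib_right[symmetric] ind power2_eq_square)
  finally show ?thesis .
qed

lemma SW_form_nonneg: "SW_form f \<ge> 0"
  unfolding SW_form_eq using p by (intro sum_nonneg mult_nonneg_nonneg) auto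

text \<open>Refining the conditioning, from the chosen edge set to \<open>U\<close> and the spins off \<open>T U\<close>,
  increases the second moment of the conditional expectation.\<close>
lemma SW_form_le_heat_bath:
  assumes E: "finite E" "edges V \<subseteq> E"
    and T: "\<And>U. U \<subseteq> E \<Longrightarrow> T U \<subseteq> V" "\<And>U e. U \<subseteq> E \<Longrightarrow> e \<in> U \<Longrightarrow> e \<inter> T U = {}"
  shows "SW_form f \<le> (\<Sum>U\<in>Pow E. bern p E U * (\<Sum>\<sigma>\<in>configs q V. w \<sigma> * f \<sigma> * hb (T U) f \<sigma>))"
proof -
  let ?M = "mono_edges V"
  \<comment> \<open>Joint weight of the coins \<open>U\<close> and the spins \<open>\<sigma>\<close>
    on the event that the chosen edge set is \<open>A\<close>.\<close>
  let ?\<mu> = "\<lambda>A U \<sigma>. bern p E U * w \<sigma> * of_bool (U \<inter> ?M \<sigma> = A)"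
  have ME: "?M \<sigma> \<subseteq> E" for \<sigma> using mono_edges_subset E by blast
  have marg: "(\<Sum>U\<in>Pow E. \<Sum>\<sigma>\<in>configs q V. ?\<mu> A U \<sigma> * g \<sigma>) = (p / (1 - p)) ^ card A * (\<Sum>\<sigma>\<in>\<Omega> A. g \<sigma>)"
    for A and g :: "(int list \<Rightarrow> nat) \<Rightarrow> real"
  proof -
    have "(\<Sum>U\<in>Pow E. ?\<mu> A U \<sigma>) = (p / (1 - p)) ^ card A * of_bool (\<sigma> \<in> \<Omega> A)" if \<sigma>: "\<sigma> \<in> configs q V" for \<sigma>
    proof (cases "A \<subseteq> ?M \<sigma>")
      case True
      have "(\<Sum>U\<in>Pow E. ?\<mu> A U \<sigma>) = (\<Sum>U | U \<subseteq> E \<and> U \<inter> ?M \<sigma> = A. bern p E U * w \<sigma>)"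
        using E(1) by (intro sum.mono_neutral_cong_right) auto
      also have "\<dots> = w \<sigma> * bern p (?M \<sigma>) A"
        by (simp add: sum_distrib_right[symmetric] bern_marginal[OF E(1) ME True])
      finally show ?thesis using weight_mult_bern[OF True] \<sigma> True by (simp add: \<Omega>_def)
    next
      case False
      hence "(\<Sum>U\<in>Pow E. ?\<mu> A U \<sigma>) = 0" by (intro sum.neutral) auto
      thus ?thesis using False by (simp add: \<Omega>_def)
    qed
    hence "(\<Sum>\<sigma>\<in>configs q V. (\<Sum>U\<in>Pow E. ?\<mu> A U \<sigma>) * g \<sigma>) = (\<Sum>\<sigma>\<in>configs q V. (p / (1 - p)) ^ card A * (of_bool (\<sigma> \<in> \<Omega> A) * g \<sigma>))"
      by (intro sum.cong) (auto simp: mult.assoc)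
    also have "\<dots> = (p / (1 - p)) ^ card A * (\<Sum>\<sigma>\<in>\<Omega> A. g \<sigma>)"
      unfolding sum_distrib_left[symmetric] using fin\<Omega>[of A] fin
      by (intro arg_cong2[of _ _ _ _ "(*)"] refl sum.mono_neutral_cong_right) auto
    finally show ?thesis by (simp add: sum_distrib_right sum.swap[of _ "configs q V"])
  qed
  \<comment> \<open>No edge of \<open>U\<close> touches \<open>T U\<close>, so resampling there does
    not alter \<open>U \<inter> ?M \<sigma>\<close>. The event is determined by the spins off
    \<open>T U\<close>, and \<open>f\<close> may be replaced by its conditional expectation.\<close>
  have proj: "(\<Sum>\<sigma>\<in>configs q V. ?\<mu> A U \<sigma> * f \<sigma>) = (\<Sum>\<sigma>\<in>configs q V. ?\<mu> A U \<sigma> * hb (T U) f \<sigma>)"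
    if U: "U \<subseteq> E" for A U
  proof -
    have inv: "U \<inter> ?M (override_on \<sigma> \<rho> (T U)) = U \<inter> ?M \<sigma>" for \<sigma> \<rho>
    proof -
      have "e \<in> ?M (override_on \<sigma> \<rho> (T U)) \<longleftrightarrow> e \<in> ?M \<sigma>" if e: "e \<in> U" for e
      proof (cases "e \<in> edges V")
        case True
        have "override_on \<sigma> \<rho> (T U) x = \<sigma> x" if "x \<in> e" for x
          using T(2)[OF U e] that by (auto simp: override_on_def)
        thus ?thesis by (simp add: edge_in_mono_edges[OF True])
      qed (use mono_edges_subset in blast)
      thus ?thesis by blast
    qed
    show ?thesis
      using arg_cong[OF heat_bath_projection[OF T(1)[OF U], of "\<lambda>\<sigma>. of_bool (U \<inter> ?M \<sigma> = A)" f], of "\<lambda>x. bern p E U * x"] inv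
      by (simp add: sum_distrib_left ac_simps)
  qed
  let ?X = "Pow E \<times> configs q V"
  have "(p / (1 - p)) ^ card A / card (\<Omega> A) * (\<Sum>\<sigma>\<in>\<Omega> A. f \<sigma>)\<^sup>2
      \<le> (\<Sum>U\<in>Pow E. \<Sum>\<sigma>\<in>configs q V. ?\<mu> A U \<sigma> * (hb (T U) f \<sigma>)\<^sup>2)" for A
  proof -
    define r where "r = (p / (1 - p)) ^ card A"
    have r: "r > 0" using p by (simp add: r_def)
    let ?S = "\<Sum>U\<in>Pow E. \<Sum>\<sigma>\<in>configs q V. ?\<mu> A U \<sigma> * (hb (T U) f \<sigma>)\<^sup>2"
    have nonneg: "?\<mu> A U \<sigma> \<ge> 0" for U \<sigma>
      using p w_pos[of \<sigma>] by (intro mult_nonneg_nonneg bern_nonneg) (auto simp: less_imp_le)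
    have S: "?S \<ge> 0" using nonneg by (intro sum_nonneg mult_nonneg_nonneg[OF nonneg]) auto
    have "(r * (\<Sum>\<sigma>\<in>\<Omega> A. f \<sigma>))\<^sup>2 = (\<Sum>(U, \<sigma>)\<in>?X. ?\<mu> A U \<sigma> * hb (T U) f \<sigma> * 1)\<^sup>2"
      by (simp add: r_def marg[symmetric] sum.cartesian_product[symmetric] proj)
    \<comment> \<open>Cauchy--Schwarz against the constant 1, whose total mass under
      \<open>?\<mu> A\<close> is \<open>r * card (\<Omega> A)\<close>.\<close>
    also have "\<dots> \<le> (\<Sum>(U, \<sigma>)\<in>?X. ?\<mu> A U \<sigma> * (hb (T U) f \<sigma>)\<^sup>2) * (\<Sum>(U, \<sigma>)\<in>?X. ?\<mu> A U \<sigma> * 1\<^sup>2)"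
      using weighted_Cauchy_Schwarz[of ?X "\<lambda>(U, \<sigma>). ?\<mu> A U \<sigma>" "\<lambda>(U, \<sigma>). hb (T U) f \<sigma>" "\<lambda>_. 1"] nonneg
      by (simp add: case_prod_unfold)
    also have "\<dots> = ?S * (r * card (\<Omega> A))"
      using marg[of A "\<lambda>_. 1"] by (simp add: sum.cartesian_product[symmetric] r_def)
    finally have *: "r * (r * (\<Sum>\<sigma>\<in>\<Omega> A. f \<sigma>)\<^sup>2) \<le> r * (?S * card (\<Omega> A))"
      by (simp add: power2_eq_square ac_simps)
    hence "r * (\<Sum>\<sigma>\<in>\<Omega> A. f \<sigma>)\<^sup>2 \<le> ?S * card (\<Omega> A)" using r by simp
    \<comment> \<open>If \<open>\<Omega> A\<close> is empty, division by zero makes the left-hand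
      side 0.\<close>
    thus ?thesis using S unfolding r_def[symmetric]
      by (cases "card (\<Omega> A) = 0") (auto simp: field_simps)
  qed
  hence "SW_form f \<le> (\<Sum>A\<in>Pow (edges V). \<Sum>U\<in>Pow E. \<Sum>\<sigma>\<in>configs q V. ?\<mu> A U \<sigma> * (hb (T U) f \<sigma>)\<^sup>2)"
    unfolding SW_form_eq by (intro sum_mono)
  also have "\<dots> = (\<Sum>U\<in>Pow E. \<Sum>\<sigma>\<in>configs q V. \<Sum>A\<in>Pow (edges V). ?\<mu> A U \<sigma> * (hb (T U) f \<sigma>)\<^sup>2)"
    by (subst sum.swap) (intro sum.cong refl sum.swap)
  also have "\<dots> = (\<Sum>U\<in>Pow E. \<Sum>\<sigma>\<in>configs q V. bern p E U * w \<sigma> * (hb (T U) f \<sigma>)\<^sup>2)"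
  proof (intro sum.cong refl)
    fix U \<sigma>
    \<comment> \<open>For given \<open>U\<close> and \<open>\<sigma>\<close> exactly one edge set
      \<open>A\<close> has positive weight.\<close>
    have "(\<Sum>A\<in>Pow (edges V). ?\<mu> A U \<sigma> * (hb (T U) f \<sigma>)\<^sup>2) = (\<Sum>A\<in>{U \<inter> ?M \<sigma>}. ?\<mu> A U \<sigma> * (hb (T U) f \<sigma>)\<^sup>2)"
      using mono_edges_subset finE by (intro sum.mono_neutral_right) auto
    thus "(\<Sum>A\<in>Pow (edges V). ?\<mu> A U \<sigma> * (hb (T U) f \<sigma>)\<^sup>2) = bern p E U * w \<sigma> * (hb (T U) f \<sigma>)\<^sup>2" by simp
  qed
  also have "\<dots> = (\<Sum>U\<in>Pow E. bern p E U * (\<Sum>\<sigma>\<in>configs q V. w \<sigma> * f \<sigma> * hb (T U) f \<sigma>))"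
  proof (intro sum.cong refl)
    fix U assume "U \<in> Pow E"
    hence "(\<Sum>\<sigma>\<in>configs q V. w \<sigma> * f \<sigma> * hb (T U) f \<sigma>) = (\<Sum>\<sigma>\<in>configs q V. w \<sigma> * hb (T U) f \<sigma> * hb (T U) f \<sigma>)"
      by (intro heat_bath_self_adjoint T(1)) auto
    thus "(\<Sum>\<sigma>\<in>configs q V. bern p E U * w \<sigma> * (hb (T U) f \<sigma>)\<^sup>2)
        = bern p E U * (\<Sum>\<sigma>\<in>configs q V. w \<sigma> * f \<sigma> * hb (T U) f \<sigma>)"
      by (simp add: sum_distrib_left power2_eq_square mult.assoc)
  qed
  finally show ?thesis .
qed

end

section \<open>From Lipschitz contraction to a spectral bound\<close>

context positive_weight
begin

text \<open>The set \<open>X\<close> of sites is a parameter because, after the other tiles have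
  been resampled, the bound is kept only for sites at the remaining tile.\<close>

definition lip_on :: "int list set \<Rightarrow> ((int list \<Rightarrow> nat) \<Rightarrow> real) \<Rightarrow> real \<Rightarrow> bool" where
  "lip_on X f l \<longleftrightarrow> (\<forall>\<sigma>\<in>configs q V. \<forall>x\<in>X. \<forall>s\<in>{1..q}. \<bar>f (\<sigma>(x := s)) - f \<sigma>\<bar> \<le> l)"

lemma lip_onD:
  "lip_on X f l \<Longrightarrow> \<sigma> \<in> configs q V \<Longrightarrow> x \<in> X \<Longrightarrow> s \<in> {1..q} \<Longrightarrow> \<bar>f (\<sigma>(x := s)) - f \<sigma>\<bar> \<le> l"
  by (simp add: lip_on_def)

lemma lip_on_subset: "lip_on X f l \<Longrightarrow> Y \<subseteq> X \<Longrightarrow> lip_on Y f l"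
  by (auto simp: lip_on_def)

lemma update_configs: "\<sigma> \<in> configs q V \<Longrightarrow> x \<in> V \<Longrightarrow> s \<in> {1..q} \<Longrightarrow> \<sigma>(x := s) \<in> configs q V"
  by (auto simp: configs_def)

lemma lip_on_nonneg: "lip_on X f l \<Longrightarrow> X \<noteq> {} \<Longrightarrow> l \<ge> 0"
proof -
  assume l: "lip_on X f l" and X: "X \<noteq> {}"
  obtain x where "x \<in> X" using X by blast
  moreover obtain \<sigma> where "\<sigma> \<in> configs q V" using configs_nonempty[OF q] by blast
  ultimately have "\<bar>f (\<sigma>(x := 1)) - f \<sigma>\<bar> \<le> l" using lip_onD[OF l] q by auto
  thus ?thesis by linarith
qed

text \<open>The spins on \<open>D\<close> are changed one at a time.\<close>

lemma lip_on_diff: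
  assumes l: "lip_on X f l" and "X \<subseteq> V" "finite D" "D \<subseteq> X"
    and "\<sigma> \<in> configs q V" "\<tau> \<in> configs q V" "\<And>x. x \<notin> D \<Longrightarrow> \<sigma> x = \<tau> x"
  shows "\<bar>f \<sigma> - f \<tau>\<bar> \<le> real (card D) * l"
  using assms(3-)
proof (induction D arbitrary: \<sigma>)
  case empty
  hence "\<sigma> = \<tau>" by auto
  thus ?case by simp
next
  case (insert x D)
  have s: "\<tau> x \<in> {1..q}" using insert.prems \<open>X \<subseteq> V\<close> by (auto simp: configs_def)
  have "\<bar>f (\<sigma>(x := \<tau> x)) - f \<tau>\<bar> \<le> real (card D) * l"
    using insert.prems \<open>X \<subseteq> V\<close> s by (intro insert.IH update_configs) auto
  moreover have "\<bar>f (\<sigma>(x := \<tau> x)) - f \<sigma>\<bar> \<le> l"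
    using insert.prems s by (intro lip_onD[OF l]) auto
  ultimately show ?case using insert.hyps by (simp add: algebra_simps)
qed

lemma lip_on_exists:
  assumes "X \<subseteq> V"
  obtains l where "lip_on X f l"
proof
  let ?S = "\<Sum>\<tau>\<in>configs q V. \<bar>f \<tau>\<bar>"
  have "\<bar>f \<sigma>\<bar> \<le> ?S" if "\<sigma> \<in> configs q V" for \<sigma>
    using that by (intro member_le_sum fin) auto
  hence "\<bar>f (\<sigma>(x := s)) - f \<sigma>\<bar> \<le> ?S + ?S" if "\<sigma> \<in> configs q V" "x \<in> X" "s \<in> {1..q}" for \<sigma> x s
    using that update_configs assms by (intro order_trans[OF abs_triangle_ineq4] add_mono) auto
  thus "lip_on X f (?S + ?S)" by (auto simp: lip_on_def)
qed

lemma total_weight_pos: "(\<Sum>\<sigma>\<in>configs q V. w \<sigma>) > 0"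
  using q by (intro sum_pos fin configs_nonempty w_pos)

text \<open>A mean-zero \<open>f\<close> satisfies \<open>f \<sigma>\<close> = average of
  \<open>f \<sigma> - f \<tau>\<close>, and any two configurations differ at no more than
  \<open>card V\<close> sites. This is where the Lipschitz seminorm comes to dominate the quadratic
  norm.\<close>

lemma lip_on_mean_zero:
  assumes l: "lip_on V f l" and mean: "(\<Sum>\<tau>\<in>configs q V. w \<tau> * f \<tau>) = 0" and \<sigma>: "\<sigma> \<in> configs q V"
  shows "\<bar>f \<sigma>\<bar> \<le> real (card V) * l"
proof -
  let ?W = "\<Sum>\<tau>\<in>configs q V. w \<tau>"
  have "f \<sigma> * ?W = (\<Sum>\<tau>\<in>configs q V. w \<tau> * (f \<sigma> - f \<tau>))"
    using mean by (simp add: right_diff_distrib sum_subtractf sum_distrib_left mult.commute)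
  also have "\<bar>\<dots>\<bar> \<le> (\<Sum>\<tau>\<in>configs q V. w \<tau> * (real (card V) * l))"
  proof (intro order_trans[OF sum_abs] sum_mono)
    fix \<tau> assume \<tau>: "\<tau> \<in> configs q V"
    have "\<bar>f \<sigma> - f \<tau>\<bar> \<le> real (card V) * l"
      using \<sigma> \<tau> finV by (intro lip_on_diff[OF l]) (auto simp: configs_def)
    thus "\<bar>w \<tau> * (f \<sigma> - f \<tau>)\<bar> \<le> w \<tau> * (real (card V) * l)"
      using w_pos[of \<tau>] by (simp add: abs_mult)
  qed
  finally have "\<bar>f \<sigma>\<bar> * ?W \<le> (real (card V) * l) * ?W"
    using total_weight_pos by (simp add: abs_mult sum_distrib_right[symmetric] mult.commute)
  thus ?thesis using total_weight_pos by (simp add: mult_le_cancel_right)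
qed

text \<open>By Cauchy--Schwarz the ratios of consecutive squared norms \<open>n k\<close> of the iterates are nondecreasing,
  so the first ratio is at most the exponential decay rate of \<open>n k\<close>.\<close>
lemma contraction_form_bound:
  fixes K :: "((int list \<Rightarrow> nat) \<Rightarrow> real) \<Rightarrow> (int list \<Rightarrow> nat) \<Rightarrow> real"
  assumes adj: "\<And>f g. (\<Sum>\<sigma>\<in>configs q V. w \<sigma> * f \<sigma> * K g \<sigma>) = (\<Sum>\<sigma>\<in>configs q V. w \<sigma> * K f \<sigma> * g \<sigma>)"
    and K1: "\<And>\<sigma>. \<sigma> \<in> configs q V \<Longrightarrow> K (\<lambda>_. 1) \<sigma> = 1"
    and contr: "\<And>f l. lip_on V f l \<Longrightarrow> lip_on V (K f) (\<rho> * l)" and \<rho>: "\<rho> \<ge> 0"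
    and mean: "(\<Sum>\<sigma>\<in>configs q V. w \<sigma> * f \<sigma>) = 0"
  shows "(\<Sum>\<sigma>\<in>configs q V. w \<sigma> * f \<sigma> * K f \<sigma>) \<le> \<rho> * (\<Sum>\<sigma>\<in>configs q V. w \<sigma> * (f \<sigma>)\<^sup>2)"
proof -
  obtain l where l: "lip_on V f l" by (rule lip_on_exists[OF order_refl])
  define F where "F k = (K ^^ k) f" for k
  have F_Suc: "F (Suc k) = K (F k)" and F0: "F 0 = f" for k by (simp_all add: F_def)
  define n where "n k = (\<Sum>\<sigma>\<in>configs q V. w \<sigma> * (F k \<sigma>)\<^sup>2)" for k
  have n_nonneg: "n k \<ge> 0" for k unfolding n_def
    using w_pos by (intro sum_nonneg mult_nonneg_nonneg) (auto simp: less_imp_le)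
  have CS: "(\<Sum>\<sigma>\<in>configs q V. w \<sigma> * F i \<sigma> * F j \<sigma>)\<^sup>2 \<le> n i * n j" for i j
    unfolding n_def using w_pos by (intro weighted_Cauchy_Schwarz) (auto simp: less_imp_le)
  have log_convex: "(n (Suc k))\<^sup>2 \<le> n k * n (Suc (Suc k))" for k
  proof -
    \<comment> \<open>One copy of \<open>K\<close> is moved to the other factor by
      self-adjointness.\<close>
    have "n (Suc k) = (\<Sum>\<sigma>\<in>configs q V. w \<sigma> * F k \<sigma> * F (Suc (Suc k)) \<sigma>)"
      using adj[of "F (Suc k)" "F k"] by (simp add: n_def F_Suc power2_eq_square ac_simps)
    thus ?thesis using CS[of k "Suc (Suc k)"] by simp
  qed
  have lipF: "lip_on V (F k) (\<rho> ^ k * l)" for k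
    by (induction k) (use l contr in \<open>auto simp: F_Suc F0 mult.assoc\<close>)
  have meanF: "(\<Sum>\<sigma>\<in>configs q V. w \<sigma> * F k \<sigma>) = 0" for k
  proof (induction k)
    case (Suc k)
    thus ?case using adj[of "\<lambda>_. 1" "F k"] K1 by (simp add: F_Suc)
  qed (use mean in \<open>simp add: F0\<close>)
  \<comment> \<open>This constant depends on the size of \<open>V\<close>, but only the exponential
    rate survives as \<open>k\<close> grows.\<close>
  define C where "C = (\<Sum>\<sigma>\<in>configs q V. w \<sigma>) * (real (card V) * l)\<^sup>2"
  have upper: "n k \<le> C * (\<rho>\<^sup>2) ^ k" for k
  proof -
    have "(F k \<sigma>)\<^sup>2 \<le> (real (card V) * (\<rho> ^ k * l))\<^sup>2" if "\<sigma> \<in> configs q V" for \<sigma>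
      using lip_on_mean_zero[OF lipF meanF that, of k] by (rule abs_le_square_iff[THEN iffD1, OF order_trans]) simp
    hence "n k \<le> (\<Sum>\<sigma>\<in>configs q V. w \<sigma> * (real (card V) * (\<rho> ^ k * l))\<^sup>2)"
      unfolding n_def using w_pos by (intro sum_mono mult_left_mono) (auto simp: less_imp_le)
    also have "\<dots> = C * (\<rho>\<^sup>2) ^ k"
      by (simp add: C_def sum_distrib_right[symmetric] power_mult_distrib power_mult[symmetric] mult.commute ac_simps)
    finally show ?thesis .
  qed
  have Q: "(\<Sum>\<sigma>\<in>configs q V. w \<sigma> * f \<sigma> * K f \<sigma>)\<^sup>2 \<le> n 0 * n 1"
    using CS[of 0 1] by (simp add: F_Suc F0)
  have n0: "n 0 = (\<Sum>\<sigma>\<in>configs q V. w \<sigma> * (f \<sigma>)\<^sup>2)" by (simp add: n_def F0)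
  show ?thesis
  proof (cases "n 0 = 0")
    case True
    thus ?thesis using Q n0 by simp
  next
    case False
    hence n0_pos: "n 0 > 0" using n_nonneg[of 0] by simp
    define t where "t = n 1 / n 0"
    have t: "t \<ge> 0" using n_nonneg by (simp add: t_def)
    have ratio: "n (Suc k) \<ge> t * n k" for k
    proof (induction k)
      case (Suc k)
      show ?case
      proof (cases "n k = 0")
        case True
        hence "n (Suc k) = 0" using log_convex[of k] by simp
        thus ?thesis using n_nonneg by simp
      next
        case False
        hence pos: "n k > 0" using n_nonneg[of k] by simp
        have "t * n (Suc k) * n k \<le> n (Suc k) * n (Suc k)"
          using mult_right_mono[OF Suc.IH n_nonneg[of "Suc k"]] by (simp add: ac_simps)
        also have "\<dots> \<le> n (Suc (Suc k)) * n k" using log_convex[of k] by (simp add: power2_eq_square mult.commute)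
        finally show ?thesis using pos by simp
      qed
    qed (use n0_pos in \<open>simp add: t_def\<close>)
    have lower: "n k \<ge> t ^ k * n 0" for k
    proof (induction k)
      case (Suc k)
      show ?case using order_trans[OF mult_left_mono[OF Suc.IH t] ratio[of k]] by (simp add: mult.assoc)
    qed simp
    \<comment> \<open>Otherwise the lower bound \<open>t ^ k * n 0\<close> would outgrow the upper
      bound and force \<open>n 0 = 0\<close>.\<close>
    have "t \<le> \<rho>\<^sup>2"
    proof (rule ccontr)
      assume "\<not> ?thesis"
      hence lt: "t > \<rho>\<^sup>2" "t > 0" using zero_le_power2[of \<rho>] by linarith+
      have "n 0 \<le> C * (\<rho>\<^sup>2 / t) ^ k" for k
        using order_trans[OF lower[of k] upper[of k]] lt by (simp add: power_divide field_simps)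
      moreover have "(\<lambda>k. C * (\<rho>\<^sup>2 / t) ^ k) \<longlonglongrightarrow> C * 0"
        using lt by (intro tendsto_mult_left LIMSEQ_realpow_zero) auto
      ultimately have "n 0 \<le> C * 0" by (intro LIMSEQ_le_const) auto
      thus False using n0_pos by simp
    qed
    hence "n 0 * n 1 \<le> (\<rho> * n 0)\<^sup>2"
      using n0_pos by (simp add: t_def power2_eq_square field_simps)
    hence "(\<Sum>\<sigma>\<in>configs q V. w \<sigma> * f \<sigma> * K f \<sigma>)\<^sup>2 \<le> (\<rho> * n 0)\<^sup>2" using Q by linarith
    hence "(\<Sum>\<sigma>\<in>configs q V. w \<sigma> * f \<sigma> * K f \<sigma>) \<le> \<rho> * n 0"
      by (rule power2_le_imp_le) (use \<rho> n0_pos in auto)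
    thus ?thesis by (simp add: n0)
  qed
qed

end

section \<open>Locality of the heat bath\<close>

context potts
begin

text \<open>The factor of \<open>w\<close> that resampling \<open>T\<close> can change. The
  remaining factor cancels from \<open>hb T\<close>, so the heat bath depends only on spins in
  \<open>T\<close> and next to it.\<close>

definition inner_weight :: "int list set \<Rightarrow> (int list \<Rightarrow> nat) \<Rightarrow> real" where
  "inner_weight T \<tau> = exp (\<beta> * real (card {e \<in> mono_edges V \<tau>. e \<inter> T \<noteq> {}}))"

lemma inner_weight_factor:
  "w \<tau> = inner_weight T \<tau> * exp (\<beta> * real (card {e \<in> mono_edges V \<tau>. e \<inter> T = {}}))"
proof -
  have "card (mono_edges V \<tau>) = card ({e \<in> mono_edges V \<tau>. e \<inter> T \<noteq> {}} \<union> {e \<in> mono_edges V \<tau>. e \<inter> T = {}})"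
    by (rule arg_cong[of _ _ card]) auto
  also have "\<dots> = card {e \<in> mono_edges V \<tau>. e \<inter> T \<noteq> {}} + card {e \<in> mono_edges V \<tau>. e \<inter> T = {}}"
    using finM by (intro card_Un_disjoint) auto
  finally show ?thesis by (simp add: gibbs_weight_def inner_weight_def exp_add[symmetric] distrib_left)
qed

lemma inner_weight_cong:
  assumes "\<And>x. x \<in> V \<Longrightarrow> x \<in> T \<or> (\<exists>y\<in>T. adj x y) \<Longrightarrow> \<tau> x = \<tau>' x"
  shows "inner_weight T \<tau> = inner_weight T \<tau>'"
proof -
  have "e \<in> mono_edges V \<tau> \<longleftrightarrow> e \<in> mono_edges V \<tau>'" if e: "e \<in> edges V" "e \<inter> T \<noteq> {}" for e
  proof -
    obtain x y where "e = {x, y}" "x \<in> V" "y \<in> V" "adj x y" using e by (auto simp: edges_def)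
    hence "\<tau> z = \<tau>' z" if "z \<in> e" for z
      using that e assms adj_sym by auto
    thus ?thesis by (simp add: edge_in_mono_edges[OF e(1)])
  qed
  hence "{e \<in> mono_edges V \<tau>. e \<inter> T \<noteq> {}} = {e \<in> mono_edges V \<tau>'. e \<inter> T \<noteq> {}}"
    using mono_edges_subset by blast
  thus ?thesis by (simp add: inner_weight_def)
qed

lemma heat_bath_inner: "hb T f \<sigma> = heat_bath q (inner_weight T) T f \<sigma>"
proof -
  define c where "c = exp (\<beta> * real (card {e \<in> mono_edges V \<sigma>. e \<inter> T = {}}))"
  have "w (override_on \<sigma> \<rho> T) = c * inner_weight T (override_on \<sigma> \<rho> T)" for \<rho>
  proof -
    have "e \<in> mono_edges V (override_on \<sigma> \<rho> T) \<longleftrightarrow> e \<in> mono_edges V \<sigma>" if e: "e \<in> edges V" "e \<inter> T = {}" for e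
    proof -
      have "override_on \<sigma> \<rho> T z = \<sigma> z" if "z \<in> e" for z using that e by (auto simp: override_on_def)
      thus ?thesis by (simp add: edge_in_mono_edges[OF e(1)])
    qed
    hence "{e \<in> mono_edges V (override_on \<sigma> \<rho> T). e \<inter> T = {}} = {e \<in> mono_edges V \<sigma>. e \<inter> T = {}}"
      using mono_edges_subset by blast
    thus ?thesis using inner_weight_factor[of "override_on \<sigma> \<rho> T" T] by (simp add: c_def)
  qed
  moreover have "c \<noteq> 0" by (simp add: c_def)
  ultimately show ?thesis
    by (simp add: heat_bath_def mult.assoc sum_distrib_left[symmetric])
qed

text \<open>The law of the resampled spins does not see \<open>v\<close>, so the change of the spin
  at \<open>v\<close> passes to the observable.\<close>

lemma heat_bath_update_far:
  assumes v: "v \<notin> T" "\<And>y. y \<in> T \<Longrightarrow> \<not> adj v y"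
  shows "hb T f (\<sigma>(v := s)) = hb T (\<lambda>\<tau>. f (\<tau>(v := s))) \<sigma>"
proof -
  have "override_on (\<sigma>(v := s)) \<rho> T = (override_on \<sigma> \<rho> T)(v := s)" for \<rho>
    using v by (auto simp: override_on_def)
  moreover have "inner_weight T (\<tau>(v := s)) = inner_weight T \<tau>" for \<tau>
    using v by (intro inner_weight_cong) auto
  ultimately show ?thesis unfolding heat_bath_inner unfolding heat_bath_def by simp
qed

lemma lip_on_heat_bath_far:
  assumes l: "lip_on X f l" and T: "T \<subseteq> V"
    and far: "\<And>x. x \<in> X \<Longrightarrow> x \<notin> T" "\<And>x y. x \<in> X \<Longrightarrow> y \<in> T \<Longrightarrow> \<not> adj x y"
  shows "lip_on X (hb T f) l"
  unfolding lip_on_def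
proof (intro ballI)
  fix \<sigma> x s assume *: "\<sigma> \<in> configs q V" "x \<in> X" "s \<in> {1..q}"
  have "hb T f (\<sigma>(x := s)) = hb T (\<lambda>\<tau>. f (\<tau>(x := s))) \<sigma>"
    using * far by (intro heat_bath_update_far) auto
  hence "hb T f (\<sigma>(x := s)) - hb T f \<sigma> = hb T (\<lambda>\<tau>. f (\<tau>(x := s)) - f \<tau>) \<sigma>"
    by (simp add: heat_bath_diff)
  also have "\<bar>\<dots>\<bar> \<le> l"
    using * T by (intro heat_bath_abs_le lip_onD[OF l] override_on_configs[of _ _ V]) auto
  finally show "\<bar>hb T f (\<sigma>(x := s)) - hb T f \<sigma>\<bar> \<le> l" .
qed

lemma sum_configs_Un:
  fixes F :: "(int list \<Rightarrow> nat) \<Rightarrow> real"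
  assumes "S \<inter> T = {}"
  shows "(\<Sum>\<rho>\<in>configs q (S \<union> T). F (override_on \<sigma> \<rho> (S \<union> T)))
      = (\<Sum>\<rho>\<in>configs q S. \<Sum>\<rho>'\<in>configs q T. F (override_on (override_on \<sigma> \<rho> S) \<rho>' T))"
  unfolding sum.cartesian_product
proof (rule sum.reindex_bij_witness[of _ "\<lambda>(\<rho>, \<rho>'). override_on \<rho> \<rho>' T" "\<lambda>\<rho>. (restr \<rho> S, restr \<rho> T)"])
  fix \<rho> assume \<rho>: "\<rho> \<in> configs q (S \<union> T)"
  show "(case (restr \<rho> S, restr \<rho> T) of (\<rho>, \<rho>') \<Rightarrow> override_on \<rho> \<rho>' T) = \<rho>"
    using \<rho> by (auto simp: override_on_def restr_def configs_def fun_eq_iff)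
  show "(restr \<rho> S, restr \<rho> T) \<in> configs q S \<times> configs q T"
    using \<rho> by (auto intro!: restr_configs[OF \<rho>])
  have "override_on (override_on \<sigma> (restr \<rho> S) S) (restr \<rho> T) T = override_on \<sigma> \<rho> (S \<union> T)"
    by (auto simp: override_on_def restr_def)
  thus "(case (restr \<rho> S, restr \<rho> T) of (\<rho>, \<rho>') \<Rightarrow> F (override_on (override_on \<sigma> \<rho> S) \<rho>' T)) =
      F (override_on \<sigma> \<rho> (S \<union> T))" by simp
next
  fix a assume "a \<in> configs q S \<times> configs q T"
  then obtain \<rho> \<rho>' where a: "a = (\<rho>, \<rho>')" "\<rho> \<in> configs q S" "\<rho>' \<in> configs q T" by auto
  have "restr (override_on \<rho> \<rho>' T) S = \<rho>" "restr (override_on \<rho> \<rho>' T) T = \<rho>'"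
    using a assms by (auto simp: override_on_def restr_def configs_def fun_eq_iff)
  thus "(restr (case a of (\<rho>, \<rho>') \<Rightarrow> override_on \<rho> \<rho>' T) S, restr (case a of (\<rho>, \<rho>') \<Rightarrow> override_on \<rho> \<rho>' T) T) = a"
    by (simp add: a)
  show "(case a of (\<rho>, \<rho>') \<Rightarrow> override_on \<rho> \<rho>' T) \<in> configs q (S \<union> T)"
    using a by (auto simp: override_on_def configs_def)
qed

text \<open>No edge meets both sets, so the inner weight factors and the two sets are resampled
  independently. This singles out the one tile next to a changed spin.\<close>

lemma heat_bath_Un:
  assumes ST: "S \<subseteq> V" "T \<subseteq> V" and disj: "S \<inter> T = {}"
    and far: "\<And>x y. x \<in> S \<Longrightarrow> y \<in> T \<Longrightarrow> \<not> adj x y"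
  shows "hb (S \<union> T) f \<sigma> = hb S (hb T f) \<sigma>"
proof -
  let ?o = "override_on"
  have far': "\<not> adj y x" if "x \<in> S" "y \<in> T" for x y using far[OF that] adj_sym by blast
  have iw: "inner_weight (S \<union> T) \<tau> = inner_weight S \<tau> * inner_weight T \<tau>" for \<tau>
  proof -
    have "{e \<in> mono_edges V \<tau>. e \<inter> (S \<union> T) \<noteq> {}} = {e \<in> mono_edges V \<tau>. e \<inter> S \<noteq> {}} \<union> {e \<in> mono_edges V \<tau>. e \<inter> T \<noteq> {}}"
      by auto
    moreover have "{e \<in> mono_edges V \<tau>. e \<inter> S \<noteq> {}} \<inter> {e \<in> mono_edges V \<tau>. e \<inter> T \<noteq> {}} = {}"
      using far far' disj by (auto simp: mono_edges_def)
    ultimately show ?thesis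
      using finM by (simp add: inner_weight_def card_Un_disjoint exp_add[symmetric] distrib_left)
  qed
  have iwS: "inner_weight S (?o (?o \<sigma> \<rho> S) \<rho>' T) = inner_weight S (?o \<sigma> \<rho> S)" for \<rho> \<rho>'
    using disj far' by (intro inner_weight_cong) (auto simp: override_on_def)
  have iwT: "inner_weight T (?o (?o \<sigma> \<rho> S) \<rho>' T) = inner_weight T (?o \<sigma> \<rho>' T)" for \<rho> \<rho>'
    using disj far by (intro inner_weight_cong) (auto simp: override_on_def)
  define DT where "DT = (\<Sum>\<rho>\<in>configs q T. inner_weight T (?o \<sigma> \<rho> T))"
  define DS where "DS = (\<Sum>\<rho>\<in>configs q S. inner_weight S (?o \<sigma> \<rho> S))"
  have "hb (S \<union> T) f \<sigma> = (\<Sum>\<rho>\<in>configs q S. \<Sum>\<rho>'\<in>configs q T. inner_weight S (?o \<sigma> \<rho> S) *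
      inner_weight T (?o \<sigma> \<rho>' T) * f (?o (?o \<sigma> \<rho> S) \<rho>' T)) /
      (\<Sum>\<rho>\<in>configs q S. \<Sum>\<rho>'\<in>configs q T. inner_weight S (?o \<sigma> \<rho> S) * inner_weight T (?o \<sigma> \<rho>' T))"
    unfolding heat_bath_inner unfolding heat_bath_def
      sum_configs_Un[OF disj, where F = "\<lambda>\<tau>. inner_weight (S \<union> T) \<tau> * f \<tau>"] sum_configs_Un[OF disj]
    unfolding iw iwS iwT ..
  also have "(\<Sum>\<rho>\<in>configs q S. \<Sum>\<rho>'\<in>configs q T. inner_weight S (?o \<sigma> \<rho> S) * inner_weight T (?o \<sigma> \<rho>' T)) = DS * DT"
    by (simp add: DS_def DT_def sum_product)
  also have "(\<Sum>\<rho>\<in>configs q S. \<Sum>\<rho>'\<in>configs q T. inner_weight S (?o \<sigma> \<rho> S) *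
      inner_weight T (?o \<sigma> \<rho>' T) * f (?o (?o \<sigma> \<rho> S) \<rho>' T)) / (DS * DT)
    = (\<Sum>\<rho>\<in>configs q S. inner_weight S (?o \<sigma> \<rho> S) * ((\<Sum>\<rho>'\<in>configs q T.
      inner_weight T (?o \<sigma> \<rho>' T) * f (?o (?o \<sigma> \<rho> S) \<rho>' T)) / DT)) / DS"
    by (simp add: sum_divide_distrib sum_distrib_left mult.assoc mult.commute[of DS])
  also have "\<dots> = hb S (hb T f) \<sigma>"
    unfolding heat_bath_inner unfolding heat_bath_def iwT DS_def DT_def ..
  finally show ?thesis .
qed

text \<open>Sites outside \<open>V\<close> carry no condition, which is the free boundary of
  \<open>V\<close>. A tile touching the boundary of \<open>V\<close> thus has a partial boundary
  condition, as SSM permits.\<close>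

definition boundary_of :: "int list set \<Rightarrow> (int list \<Rightarrow> nat) \<Rightarrow> int list \<Rightarrow> nat option" where
  "boundary_of b \<sigma> = (\<lambda>u. if u \<in> outer_boundary b \<inter> V then Some (\<sigma> u) else None)"

lemma is_bc_boundary_of: "\<sigma> \<in> configs q V \<Longrightarrow> is_bc q b (boundary_of b \<sigma>)"
  by (auto simp: is_bc_def boundary_of_def configs_def dom_def ran_def split: if_splits)

text \<open>An edge of \<open>V\<close> meeting \<open>b\<close> either lies inside \<open>b\<close>
  or joins \<open>b\<close> to its outer boundary; the latter correspond to the pairs counted in
  \<open>potts_weight\<close>.\<close>

lemma potts_weight_boundary_of:
  assumes b: "b \<subseteq> V" and \<rho>: "\<rho> \<in> configs q b"
  shows "potts_weight \<beta> b (boundary_of b \<sigma>) \<rho> = inner_weight b (override_on \<sigma> \<rho> b)"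
proof -
  let ?\<tau> = "override_on \<sigma> \<rho> b"
  let ?P = "{(u, x). x \<in> b \<and> adj u x \<and> boundary_of b \<sigma> u = Some (\<rho> x)}"
  let ?Q = "{e \<in> mono_edges V ?\<tau>. e \<inter> b \<noteq> {} \<and> \<not> e \<subseteq> b}"
  have P: "(u, x) \<in> ?P \<longleftrightarrow> x \<in> b \<and> u \<in> V \<and> u \<notin> b \<and> adj u x \<and> \<sigma> u = \<rho> x" for u x
    by (auto simp: boundary_of_def outer_boundary_def)
  have "card ?P = card ?Q"
  proof (rule bij_betw_same_card[of "\<lambda>(u, x). {u, x}"], rule bij_betw_imageI)
    show "inj_on (\<lambda>(u, x). {u, x}) ?P"
      by (auto simp: inj_on_def doubleton_eq_iff boundary_of_def outer_boundary_def split: if_splits)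
    show "(\<lambda>(u, x). {u, x}) ` ?P = ?Q"
    proof (intro equalityI subsetI)
      fix e assume "e \<in> (\<lambda>(u, x). {u, x}) ` ?P"
      then obtain u x where "e = {u, x}" "(u, x) \<in> ?P" by auto
      thus "e \<in> ?Q" unfolding P using b by (auto simp: pair_in_mono_edges)
    next
      fix e assume e: "e \<in> ?Q"
      then obtain x y where xy: "e = {x, y}" "x \<in> V" "y \<in> V" "adj x y" "?\<tau> x = ?\<tau> y"
        by (auto simp: mono_edges_def)
      hence "(x, y) \<in> ?P \<or> (y, x) \<in> ?P" unfolding P
        using e adj_sym by (auto simp: override_on_def split: if_splits)
      thus "e \<in> (\<lambda>(u, x). {u, x}) ` ?P"
        by (elim disjE; intro rev_image_eqI) (assumption, simp add: xy, assumption, simp add: xy insert_commute)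
    qed
  qed
  moreover have "mono_edges b \<rho> = {e \<in> mono_edges V ?\<tau>. e \<inter> b \<noteq> {} \<and> e \<subseteq> b}"
  proof (intro equalityI subsetI)
    fix e assume "e \<in> mono_edges b \<rho>"
    thus "e \<in> {e \<in> mono_edges V ?\<tau>. e \<inter> b \<noteq> {} \<and> e \<subseteq> b}"
      using b unfolding mono_edges_def[of b] by (auto simp: pair_in_mono_edges)
  next
    fix e assume e: "e \<in> {e \<in> mono_edges V ?\<tau>. e \<inter> b \<noteq> {} \<and> e \<subseteq> b}"
    then obtain x y where "e = {x, y}" "adj x y" "?\<tau> x = ?\<tau> y" by (auto simp: mono_edges_def)
    thus "e \<in> mono_edges b \<rho>" using e by (auto simp: pair_in_mono_edges)
  qed
  moreover have "{e \<in> mono_edges V ?\<tau>. e \<inter> b \<noteq> {}} = {e \<in> mono_edges V ?\<tau>. e \<inter> b \<noteq> {} \<and> e \<subseteq> b} \<union> ?Q"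
    by auto
  moreover have "card \<dots> = card {e \<in> mono_edges V ?\<tau>. e \<inter> b \<noteq> {} \<and> e \<subseteq> b} + card ?Q"
    using finM by (intro card_Un_disjoint) auto
  ultimately show ?thesis by (simp add: potts_weight_def inner_weight_def)
qed

lemma heat_bath_eq_gibbs:
  assumes b: "b \<subseteq> V"
  shows "hb b f \<sigma> = (\<Sum>\<rho>\<in>configs q b. potts_gibbs q \<beta> b (boundary_of b \<sigma>) \<rho> * f (override_on \<sigma> \<rho> b))"
  unfolding heat_bath_inner unfolding heat_bath_def potts_gibbs_def sum_divide_distrib
  by (simp add: potts_weight_boundary_of[OF b] sum_divide_distrib)

lemma potts_gibbs_sum:
  assumes "b \<subseteq> V"
  shows "(\<Sum>\<rho>\<in>configs q b. potts_gibbs q \<beta> b \<psi> \<rho>) = 1" "potts_gibbs q \<beta> b \<psi> \<rho> \<ge> 0"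
proof -
  have pos: "potts_weight \<beta> b \<psi> \<rho> > 0" for \<rho> by (simp add: potts_weight_def)
  have "(\<Sum>\<rho>\<in>configs q b. potts_weight \<beta> b \<psi> \<rho>) > 0"
    using fin(2)[OF assms] configs_nonempty[of q b] q pos by (intro sum_pos) auto
  thus "(\<Sum>\<rho>\<in>configs q b. potts_gibbs q \<beta> b \<psi> \<rho>) = 1" "potts_gibbs q \<beta> b \<psi> \<rho> \<ge> 0"
    using pos[of \<rho>] by (simp_all add: potts_gibbs_def sum_divide_distrib[symmetric] less_imp_le)
qed

text \<open>Freezing the spins of \<open>b - B\<close> costs at most \<open>card (b - B) * l\<close> under each measure; the
  frozen observable depends on \<open>B\<close> only, where the two marginals are close.\<close>
lemma gibbs_expectation_diff:
  fixes \<psi> \<psi>' :: "int list \<Rightarrow> nat option"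
  assumes b: "b \<subseteq> V" and B: "B \<subseteq> b" and l: "lip_on b f l" and \<sigma>: "\<sigma> \<in> configs q V" and l0: "l \<ge> 0"
  defines "\<mu> \<equiv> potts_gibbs q \<beta> b \<psi>" and "\<mu>' \<equiv> potts_gibbs q \<beta> b \<psi>'"
  shows "\<bar>\<Sum>\<rho>\<in>configs q b. (\<mu>' \<rho> - \<mu> \<rho>) * f (override_on \<sigma> \<rho> b)\<bar> \<le> (2 * card (b - B) + card B *
     (\<Sum>\<tau>\<in>configs q B. \<bar>potts_marginal q \<beta> b \<psi> B \<tau> - potts_marginal q \<beta> b \<psi>' B \<tau>\<bar>)) * l"
proof -
  obtain \<rho>0 where \<rho>0: "\<rho>0 \<in> configs q b" using configs_nonempty[of q b] q by auto
  have finb: "finite b" "finite B" "finite (b - B)" using finV b B by (meson finite_subset finite_Diff)+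
  have finc: "finite (configs q b)" "finite (configs q B)" using finb finite_configs by auto
  define g where "g \<rho> = f (override_on \<sigma> \<rho> b)" for \<rho>
  define h where "h \<tau> = g (override_on \<rho>0 \<tau> B)" for \<tau>
  define \<delta> where "\<delta> \<rho> = \<mu>' \<rho> - \<mu> \<rho>" for \<rho>
  have \<mu>: "sum \<mu> (configs q b) = 1" "sum \<mu>' (configs q b) = 1" "\<mu> \<rho> \<ge> 0" "\<mu>' \<rho> \<ge> 0" for \<rho>
    unfolding \<mu>_def \<mu>'_def using potts_gibbs_sum[OF b] by auto
  have g_diff: "\<bar>g \<rho> - g \<rho>'\<bar> \<le> real (card D) * l"
    if "\<rho> \<in> configs q b" "\<rho>' \<in> configs q b" "D \<subseteq> b" "\<And>x. x \<notin> D \<Longrightarrow> \<rho> x = \<rho>' x" for D \<rho> \<rho>'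
    unfolding g_def using that b finb \<sigma>
    by (intro lip_on_diff[OF l b] override_on_configs) (auto simp: override_on_def intro: finite_subset)
  have ov: "override_on \<rho>0 \<tau> B \<in> configs q b" if "\<tau> \<in> configs q B" for \<tau>
    using override_on_configs[OF \<rho>0 that B] .
  have rB: "restr \<rho> B \<in> configs q B" if "\<rho> \<in> configs q b" for \<rho> using restr_configs[OF that B] .
  have near: "\<bar>\<Sum>\<rho>\<in>configs q b. \<delta> \<rho> * (g \<rho> - h (restr \<rho> B))\<bar> \<le> 2 * (real (card (b - B)) * l)"
  proof -
    have "\<bar>\<Sum>\<rho>\<in>configs q b. \<delta> \<rho> * (g \<rho> - h (restr \<rho> B))\<bar> \<le> (\<Sum>\<rho>\<in>configs q b. (\<mu> \<rho> + \<mu>' \<rho>) * (real (card (b - B)) * l))"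
    proof (intro order_trans[OF sum_abs] sum_mono)
      fix \<rho> assume \<rho>: "\<rho> \<in> configs q b"
      have "\<bar>g \<rho> - h (restr \<rho> B)\<bar> \<le> real (card (b - B)) * l"
        unfolding h_def
      proof (rule g_diff[OF \<rho> ov[OF rB[OF \<rho>]]])
        fix x assume "x \<notin> b - B"
        thus "\<rho> x = override_on \<rho>0 (restr \<rho> B) B x"
          using \<rho> \<rho>0 by (auto simp: override_on_def restr_def configs_def)
      qed auto
      moreover have "\<bar>\<delta> \<rho>\<bar> \<le> \<mu> \<rho> + \<mu>' \<rho>" using \<mu>(3,4)[of \<rho>] by (simp add: \<delta>_def)
      ultimately show "\<bar>\<delta> \<rho> * (g \<rho> - h (restr \<rho> B))\<bar> \<le> (\<mu> \<rho> + \<mu>' \<rho>) * (real (card (b - B)) * l)"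
        unfolding abs_mult using \<mu>(3,4)[of \<rho>] by (intro mult_mono) auto
    qed
    also have "\<dots> = 2 * (real (card (b - B)) * l)"
      by (simp add: sum_distrib_right[symmetric] sum.distrib \<mu>)
    finally show ?thesis .
  qed
  define m where "m \<tau> = (\<Sum>\<rho>\<in>{\<rho> \<in> configs q b. restr \<rho> B = \<tau>}. \<delta> \<rho>)" for \<tau>
  have m: "m \<tau> = potts_marginal q \<beta> b \<psi>' B \<tau> - potts_marginal q \<beta> b \<psi> B \<tau>" for \<tau>
    by (simp add: m_def \<delta>_def \<mu>_def \<mu>'_def potts_marginal_def sum_subtractf)
  have group: "(\<Sum>\<rho>\<in>configs q b. \<delta> \<rho> * F (restr \<rho> B)) = (\<Sum>\<tau>\<in>configs q B. m \<tau> * F \<tau>)" for F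
  proof -
    have "(\<Sum>\<rho>\<in>configs q b. \<delta> \<rho> * F (restr \<rho> B)) = (\<Sum>\<tau>\<in>configs q B. \<Sum>\<rho>\<in>{\<rho> \<in> configs q b. restr \<rho> B = \<tau>}. \<delta> \<rho> * F (restr \<rho> B))"
      using finc rB by (intro sum.group[symmetric]) auto
    also have "\<dots> = (\<Sum>\<tau>\<in>configs q B. m \<tau> * F \<tau>)"
      unfolding m_def sum_distrib_right by (intro sum.cong) auto
    finally show ?thesis .
  qed
  have m0: "(\<Sum>\<tau>\<in>configs q B. m \<tau>) = 0"
    using group[of "\<lambda>_. 1"] \<mu> by (simp add: \<delta>_def sum_subtractf)
  define \<tau>0 where "\<tau>0 = restr \<rho>0 B"
  have far: "\<bar>\<Sum>\<tau>\<in>configs q B. m \<tau> * h \<tau>\<bar> \<le> (\<Sum>\<tau>\<in>configs q B. \<bar>m \<tau>\<bar>) * (real (card B) * l)"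
  proof -
    \<comment> \<open>The signed measure \<open>m\<close> has total mass 0, so \<open>h\<close> may
      be recentred and only its oscillation matters.\<close>
    have "(\<Sum>\<tau>\<in>configs q B. m \<tau> * h \<tau>) = (\<Sum>\<tau>\<in>configs q B. m \<tau> * (h \<tau> - h \<tau>0))"
      using m0 by (simp add: right_diff_distrib sum_subtractf sum_distrib_right[symmetric])
    also have "\<bar>\<dots>\<bar> \<le> (\<Sum>\<tau>\<in>configs q B. \<bar>m \<tau>\<bar> * (real (card B) * l))"
    proof (intro order_trans[OF sum_abs] sum_mono)
      fix \<tau> assume \<tau>: "\<tau> \<in> configs q B"
      have "\<bar>h \<tau> - h \<tau>0\<bar> \<le> real (card B) * l"
        unfolding h_def \<tau>0_def by (rule g_diff[OF ov[OF \<tau>] ov[OF rB[OF \<rho>0]] B]) auto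
      thus "\<bar>m \<tau> * (h \<tau> - h \<tau>0)\<bar> \<le> \<bar>m \<tau>\<bar> * (real (card B) * l)"
        unfolding abs_mult by (intro mult_left_mono) auto
    qed
    finally show ?thesis by (simp add: sum_distrib_right)
  qed
  have "(\<Sum>\<rho>\<in>configs q b. \<delta> \<rho> * g \<rho>) = (\<Sum>\<rho>\<in>configs q b. \<delta> \<rho> * (g \<rho> - h (restr \<rho> B))) + (\<Sum>\<tau>\<in>configs q B. m \<tau> * h \<tau>)"
    by (simp add: group[symmetric] right_diff_distrib sum_subtractf)
  hence "\<bar>\<Sum>\<rho>\<in>configs q b. \<delta> \<rho> * g \<rho>\<bar> \<le> 2 * (real (card (b - B)) * l) + (\<Sum>\<tau>\<in>configs q B. \<bar>m \<tau>\<bar>) * (real (card B) * l)"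
    using near far by linarith
  also have "(\<Sum>\<tau>\<in>configs q B. \<bar>m \<tau>\<bar>) = (\<Sum>\<tau>\<in>configs q B. \<bar>potts_marginal q \<beta> b \<psi> B \<tau> - potts_marginal q \<beta> b \<psi>' B \<tau>\<bar>)"
    by (simp add: m abs_minus_commute)
  finally show ?thesis by (simp add: \<delta>_def g_def algebra_simps)
qed

end

section \<open>Random tiles\<close>

text \<open>The first two clauses make different tiles independent under the heat bath; the last
  ensures that a vertex borders at most one of them.\<close>

definition separated :: "int list set set \<Rightarrow> bool" where
  "separated \<B> \<longleftrightarrow> (\<forall>b\<in>\<B>. \<forall>b'\<in>\<B>. b \<noteq> b' \<longrightarrow>
     (\<forall>x\<in>b. \<forall>y\<in>b'. x \<noteq> y \<and> \<not> adj x y \<and> (\<forall>v. \<not> (adj v x \<and> adj v y))))"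

lemma separatedD:
  assumes "separated \<B>" "b \<in> \<B>" "b' \<in> \<B>" "x \<in> b" "y \<in> b'" "x = y \<or> adj x y \<or> adj v x \<and> adj v y"
  shows "b = b'"
  using assms unfolding separated_def by blast

lemma separated_subset: "separated \<B> \<Longrightarrow> \<B>' \<subseteq> \<B> \<Longrightarrow> separated \<B>'"
  unfolding separated_def by blast

definition strong_mixing :: "nat \<Rightarrow> nat \<Rightarrow> real \<Rightarrow> real \<Rightarrow> real \<Rightarrow> bool" where
  "strong_mixing q d \<beta> a c \<longleftrightarrow> (\<forall>\<Lambda> B u \<psi> \<psi>u. is_cube d \<Lambda> \<longrightarrow> B \<subseteq> \<Lambda> \<longrightarrow> u \<in> outer_boundary \<Lambda> \<longrightarrow>
        is_bc q \<Lambda> \<psi> \<longrightarrow> is_bc q \<Lambda> \<psi>u \<longrightarrow> (\<forall>v. v \<noteq> u \<longrightarrow> \<psi> v = \<psi>u v) \<longrightarrow>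
        (\<Sum>\<tau>\<in>configs q B. \<bar>potts_marginal q \<beta> \<Lambda> \<psi> B \<tau> - potts_marginal q \<beta> \<Lambda> \<psi>u B \<tau>\<bar>)
          \<le> c * exp (- a * set_dist u B))"

lemma SSM_iff_strong_mixing: "SSM q d \<beta> \<longleftrightarrow> (\<exists>a c. a > 0 \<and> c > 0 \<and> strong_mixing q d \<beta> a c)"
  unfolding SSM_def strong_mixing_def ..

text \<open>Cost, in units of the Lipschitz constant, of changing the boundary condition of
  \<open>b\<close> at \<open>v\<close>. Sites within distance \<open>r\<close> are frozen under both
  measures, hence the factor 2; for the others, at most \<open>card b\<close>, strong mixing bounds
  the distance of the marginals.\<close>

definition influence :: "real \<Rightarrow> real \<Rightarrow> nat \<Rightarrow> int list \<Rightarrow> int list set \<Rightarrow> real" where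
  "influence a c r v b = 2 * card {x \<in> b. l1dist v x < real r} + card b * (c * exp (- a * real r))"

context potts
begin

text \<open>The spin at \<open>v\<close> enters in two ways: as an argument of \<open>f\<close>,
  which costs \<open>l\<close>, and through the boundary condition of \<open>b\<close>, which costs
  the influence times \<open>l\<close>.\<close>

lemma block_influence:
  assumes mix: "strong_mixing q d \<beta> a c" "a > 0" "c > 0"
    and b: "is_cube d b" "b \<subseteq> V" and v: "v \<in> outer_boundary b" "v \<in> V"
    and l: "lip_on (insert v b) f l" and \<sigma>: "\<sigma> \<in> configs q V" and s: "s \<in> {1..q}"
  shows "\<bar>hb b f (\<sigma>(v := s)) - hb b f \<sigma>\<bar> \<le> (1 + influence a c r v b) * l"
proof -
  have l0: "l \<ge> 0" using lip_on_nonneg[OF l] by simp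
  have finb: "finite b" using b finV finite_subset by blast
  have vb: "v \<notin> b" using v by (simp add: outer_boundary_def)
  let ?\<sigma>' = "\<sigma>(v := s)"
  define \<psi> where "\<psi> = boundary_of b \<sigma>"
  define \<psi>' where "\<psi>' = boundary_of b ?\<sigma>'"
  let ?\<mu> = "potts_gibbs q \<beta> b \<psi>" and ?\<mu>' = "potts_gibbs q \<beta> b \<psi>'"
  define B where "B = {x \<in> b. real r \<le> l1dist v x}"
  have B: "B \<subseteq> b" "b - B = {x \<in> b. l1dist v x < real r}" by (auto simp: B_def)
  have lb: "lip_on b f l" using l by (simp add: lip_on_def)
  have \<sigma>': "?\<sigma>' \<in> configs q V" using \<sigma> s v by (intro update_configs)
  have ov: "override_on ?\<sigma>' \<rho> b = (override_on \<sigma> \<rho> b)(v := s)" for \<rho>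
    using vb by (auto simp: override_on_def)
  have tv: "card B * (\<Sum>\<tau>\<in>configs q B. \<bar>potts_marginal q \<beta> b \<psi> B \<tau> - potts_marginal q \<beta> b \<psi>' B \<tau>\<bar>)
      \<le> card b * (c * exp (- a * real r))"
  \<comment> \<open>The distance to an empty \<open>B\<close> would be the \<open>Min\<close> of an
    empty set; there the factor \<open>card B\<close> is 0.\<close>
  proof (cases "B = {}")
    case False
    have finB: "finite B" using B finb finite_subset by blast
    have "real r \<le> set_dist v B"
      unfolding set_dist_def using False finB by (subst Min_ge_iff) (auto simp: B_def)
    hence "exp (- a * set_dist v B) \<le> exp (- a * real r)" using mix(2) by simp
    moreover have "(\<Sum>\<tau>\<in>configs q B. \<bar>potts_marginal q \<beta> b \<psi> B \<tau> - potts_marginal q \<beta> b \<psi>' B \<tau>\<bar>)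
        \<le> c * exp (- a * set_dist v B)"
      using mix(1) b(1) B(1) v(1) is_bc_boundary_of[OF \<sigma>, of b] is_bc_boundary_of[OF \<sigma>', of b]
      unfolding strong_mixing_def \<psi>_def \<psi>'_def by (auto simp: boundary_of_def)
    ultimately have "(\<Sum>\<tau>\<in>configs q B. \<bar>potts_marginal q \<beta> b \<psi> B \<tau> - potts_marginal q \<beta> b \<psi>' B \<tau>\<bar>)
        \<le> c * exp (- a * real r)"
      using mix(3) by (meson mult_left_mono less_imp_le order_trans)
    moreover have "card B \<le> card b" using B finb by (intro card_mono)
    ultimately show ?thesis by (intro mult_mono sum_nonneg) auto
  qed (use mix in simp)
  have "hb b f ?\<sigma>' - hb b f \<sigma> = (\<Sum>\<rho>\<in>configs q b. ?\<mu>' \<rho> * (f ((override_on \<sigma> \<rho> b)(v := s)) - f (override_on \<sigma> \<rho> b)))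
      + (\<Sum>\<rho>\<in>configs q b. (?\<mu>' \<rho> - ?\<mu> \<rho>) * f (override_on \<sigma> \<rho> b))"
    unfolding heat_bath_eq_gibbs[OF b(2)] ov \<psi>_def \<psi>'_def
    by (simp add: algebra_simps sum_subtractf sum.distrib)
  moreover have "\<bar>\<Sum>\<rho>\<in>configs q b. ?\<mu>' \<rho> * (f ((override_on \<sigma> \<rho> b)(v := s)) - f (override_on \<sigma> \<rho> b))\<bar> \<le> l"
  proof -
    have "\<bar>\<Sum>\<rho>\<in>configs q b. ?\<mu>' \<rho> * (f ((override_on \<sigma> \<rho> b)(v := s)) - f (override_on \<sigma> \<rho> b))\<bar>
        \<le> (\<Sum>\<rho>\<in>configs q b. ?\<mu>' \<rho> * l)"
      using potts_gibbs_sum(2)[OF b(2)] \<sigma> s b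
      by (intro order_trans[OF sum_abs] sum_mono)
        (auto simp: abs_mult intro!: mult_left_mono lip_onD[OF l] override_on_configs[of _ _ V])
    thus ?thesis using potts_gibbs_sum(1)[OF b(2)] by (simp add: sum_distrib_right[symmetric])
  qed
  moreover have "\<bar>\<Sum>\<rho>\<in>configs q b. (?\<mu>' \<rho> - ?\<mu> \<rho>) * f (override_on \<sigma> \<rho> b)\<bar> \<le> influence a c r v b * l"
  proof -
    have "\<bar>\<Sum>\<rho>\<in>configs q b. (?\<mu>' \<rho> - ?\<mu> \<rho>) * f (override_on \<sigma> \<rho> b)\<bar> \<le> (2 * card (b - B) + card B *
     (\<Sum>\<tau>\<in>configs q B. \<bar>potts_marginal q \<beta> b \<psi> B \<tau> - potts_marginal q \<beta> b \<psi>' B \<tau>\<bar>)) * l"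
      by (rule gibbs_expectation_diff[OF b(2) B(1) lb \<sigma> l0])
    also have "\<dots> \<le> influence a c r v b * l"
      using tv l0 by (intro mult_right_mono) (auto simp: influence_def B(2))
    finally show ?thesis .
  qed
  ultimately show ?thesis by (simp add: algebra_simps)
qed

text \<open>A covered spin is forgotten, and a spin away from all tiles only changes the observable.
  A bordering spin touches exactly one tile, to which \<open>block_influence\<close> applies after
  the other tiles have been resampled.\<close>

lemma tiles_influence:
  assumes mix: "strong_mixing q d \<beta> a c" "a > 0" "c > 0"
    and \<B>: "separated \<B>" "\<And>b. b \<in> \<B> \<Longrightarrow> is_cube d b \<and> b \<subseteq> V"
    and C: "\<And>b v. b \<in> \<B> \<Longrightarrow> v \<in> outer_boundary b \<Longrightarrow> influence a c r v b \<le> C"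
    and l: "lip_on V f l" and \<sigma>: "\<sigma> \<in> configs q V" and s: "s \<in> {1..q}" and v: "v \<in> V"
  shows "\<bar>hb (\<Union>\<B>) f (\<sigma>(v := s)) - hb (\<Union>\<B>) f \<sigma>\<bar>
    \<le> (1 - of_bool (v \<in> \<Union>\<B>) + C * of_bool (v \<in> outer_boundary (\<Union>\<B>))) * l"
proof -
  have TV: "\<Union>\<B> \<subseteq> V" using \<B>(2) by blast
  consider "v \<in> \<Union>\<B>" | "v \<notin> \<Union>\<B>" "v \<notin> outer_boundary (\<Union>\<B>)" | "v \<in> outer_boundary (\<Union>\<B>)" by blast
  thus ?thesis
  proof cases
    case 1
    hence "hb (\<Union>\<B>) f (\<sigma>(v := s)) = hb (\<Union>\<B>) f \<sigma>" by (intro heat_bath_cong_off) auto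
    moreover have "v \<notin> outer_boundary (\<Union>\<B>)" using 1 by (simp add: outer_boundary_def)
    ultimately show ?thesis using 1 by simp
  next
    case 2
    have "lip_on {v} f l" using l v by (simp add: lip_on_def)
    hence "lip_on {v} (hb (\<Union>\<B>) f) l"
      using 2 TV by (intro lip_on_heat_bath_far) (auto simp: outer_boundary_def)
    from lip_onD[OF this \<sigma> _ s] show ?thesis using 2 by simp
  next
    case 3
    then obtain b y where y: "y \<in> b" "adj v y" and b: "b \<in> \<B>" and vn: "v \<notin> \<Union>\<B>"
      by (auto simp: outer_boundary_def)
    define T where "T = \<Union>(\<B> - {b})"
    have far: "x \<noteq> z \<and> \<not> adj x z \<and> \<not> (adj u x \<and> adj u z)" if xz: "x \<in> b" "z \<in> T" for x z u
    proof -
      from xz(2) obtain b' where b': "b' \<in> \<B>" "b' \<noteq> b" "z \<in> b'" unfolding T_def by blast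
      show ?thesis using separatedD[OF \<B>(1) b b'(1) xz(1) b'(3), of u] b'(2) by argo
    qed
    have vo: "v \<in> outer_boundary b" using y b vn by (auto simp: outer_boundary_def)
    have T: "T \<subseteq> V" "b \<subseteq> V" "is_cube d b" using TV b \<B>(2) by (auto simp: T_def)
    have "\<Union>\<B> = b \<union> T" using b by (auto simp: T_def)
    hence hb_eq: "hb (\<Union>\<B>) f \<tau> = hb b (hb T f) \<tau>" for \<tau>
      using heat_bath_Un[of b T f \<tau>] far T by auto
    have "lip_on (insert v b) f l" using v T(2) by (intro lip_on_subset[OF l]) auto
    \<comment> \<open>By separation neither \<open>v\<close> nor a site of \<open>b\<close> touches
      \<open>T\<close>, so resampling \<open>T\<close> keeps the Lipschitz bound at these
      sites.\<close>
    hence lT: "lip_on (insert v b) (hb T f) l"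
    proof (rule lip_on_heat_bath_far[OF _ T(1)])
      fix x assume x: "x \<in> insert v b"
      show "x \<notin> T" using x far[of x x] vn unfolding T_def by blast
      fix z assume z: "z \<in> T"
      show "\<not> adj x z" using x far[OF _ z] far[OF y(1) z, of v] y by blast
    qed
    have "\<bar>hb b (hb T f) (\<sigma>(v := s)) - hb b (hb T f) \<sigma>\<bar> \<le> (1 + influence a c r v b) * l"
      by (rule block_influence[OF mix T(3,2) vo v lT \<sigma> s])
    also have "\<dots> \<le> (1 + C) * l"
      using C[OF b vo] lip_on_nonneg[OF l] v by (intro mult_right_mono) auto
    finally show ?thesis using 3 vn by (simp add: hb_eq)
  qed
qed

text \<open>The number \<open>\<kappa>\<close> bounds from below, at every vertex, the probability
  of being covered minus \<open>C\<close> times that of bordering the tiles. Hence the averaged heat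
  bath \<open>K\<close> contracts the Lipschitz seminorm by \<open>1 - \<kappa>\<close>.\<close>

lemma random_tiles_form_bound:
  fixes C \<kappa> :: real
  assumes mix: "strong_mixing q d \<beta> a c" "a > 0" "c > 0"
    and J: "finite J" "\<And>j. j \<in> J \<Longrightarrow> m j \<ge> 0" "sum m J = 1"
    and \<B>: "\<And>j. j \<in> J \<Longrightarrow> separated (\<B> j)" "\<And>j b. j \<in> J \<Longrightarrow> b \<in> \<B> j \<Longrightarrow> is_cube d b \<and> b \<subseteq> V"
    and C: "\<And>j b v. j \<in> J \<Longrightarrow> b \<in> \<B> j \<Longrightarrow> v \<in> outer_boundary b \<Longrightarrow> influence a c r v b \<le> C"
    and \<kappa>: "\<kappa> \<le> 1" "\<And>v. v \<in> V \<Longrightarrow>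
      \<kappa> \<le> (\<Sum>j\<in>J. m j * (of_bool (v \<in> \<Union>(\<B> j)) - C * of_bool (v \<in> outer_boundary (\<Union>(\<B> j)))))"
    and mean: "(\<Sum>\<sigma>\<in>configs q V. w \<sigma> * f \<sigma>) = 0"
  shows "(\<Sum>j\<in>J. m j * (\<Sum>\<sigma>\<in>configs q V. w \<sigma> * f \<sigma> * hb (\<Union>(\<B> j)) f \<sigma>))
    \<le> (1 - \<kappa>) * (\<Sum>\<sigma>\<in>configs q V. w \<sigma> * (f \<sigma>)\<^sup>2)"
proof -
  define K where "K g \<sigma> = (\<Sum>j\<in>J. m j * hb (\<Union>(\<B> j)) g \<sigma>)" for g \<sigma>
  have sub: "\<Union>(\<B> j) \<subseteq> V" if "j \<in> J" for j using \<B>(2)[OF that] by blast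
  have form: "(\<Sum>\<sigma>\<in>configs q V. w \<sigma> * h \<sigma> * K g \<sigma>) = (\<Sum>j\<in>J. m j * (\<Sum>\<sigma>\<in>configs q V. w \<sigma> * h \<sigma> * hb (\<Union>(\<B> j)) g \<sigma>))"
    for g h
    by (simp add: K_def sum_distrib_left) (subst sum.swap, simp add: ac_simps)
  have sa: "(\<Sum>\<sigma>\<in>configs q V. w \<sigma> * h \<sigma> * hb (\<Union>(\<B> j)) g \<sigma>) = (\<Sum>\<sigma>\<in>configs q V. w \<sigma> * g \<sigma> * hb (\<Union>(\<B> j)) h \<sigma>)"
    if "j \<in> J" for j g h
    using heat_bath_self_adjoint[OF sub[OF that], of h g] heat_bath_self_adjoint[OF sub[OF that], of g h]
    by (simp add: ac_simps)
  have adj: "(\<Sum>\<sigma>\<in>configs q V. w \<sigma> * h \<sigma> * K g \<sigma>) = (\<Sum>\<sigma>\<in>configs q V. w \<sigma> * K h \<sigma> * g \<sigma>)" for g h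
  proof -
    have "(\<Sum>\<sigma>\<in>configs q V. w \<sigma> * h \<sigma> * K g \<sigma>) = (\<Sum>\<sigma>\<in>configs q V. w \<sigma> * g \<sigma> * K h \<sigma>)"
      unfolding form by (intro sum.cong refl arg_cong2[of _ _ _ _ "(*)"] sa)
    thus ?thesis by (simp add: ac_simps)
  qed
  have "(\<Sum>\<sigma>\<in>configs q V. w \<sigma> * f \<sigma> * K f \<sigma>) \<le> (1 - \<kappa>) * (\<Sum>\<sigma>\<in>configs q V. w \<sigma> * (f \<sigma>)\<^sup>2)"
  proof (rule contraction_form_bound[OF adj _ _ _ mean])
    show "K (\<lambda>_. 1) \<sigma> = 1" for \<sigma> using sub J by (simp add: K_def heat_bath_const)
    show "0 \<le> 1 - \<kappa>" using \<kappa> by simp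
    fix g l assume l: "lip_on V g l"
    show "lip_on V (K g) ((1 - \<kappa>) * l)"
      unfolding lip_on_def
    proof (intro ballI)
      fix \<sigma> v s assume *: "\<sigma> \<in> configs q V" "v \<in> V" "s \<in> {1..q}"
      have "K g (\<sigma>(v := s)) - K g \<sigma> = (\<Sum>j\<in>J. m j * (hb (\<Union>(\<B> j)) g (\<sigma>(v := s)) - hb (\<Union>(\<B> j)) g \<sigma>))"
        by (simp add: K_def right_diff_distrib sum_subtractf)
      also have "\<bar>\<dots>\<bar> \<le> (\<Sum>j\<in>J. m j * ((1 - of_bool (v \<in> \<Union>(\<B> j)) + C * of_bool (v \<in> outer_boundary (\<Union>(\<B> j)))) * l))"
      proof (intro order_trans[OF sum_abs] sum_mono)
        fix j assume j: "j \<in> J"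
        have "\<bar>hb (\<Union>(\<B> j)) g (\<sigma>(v := s)) - hb (\<Union>(\<B> j)) g \<sigma>\<bar>
          \<le> (1 - of_bool (v \<in> \<Union>(\<B> j)) + C * of_bool (v \<in> outer_boundary (\<Union>(\<B> j)))) * l"
          by (rule tiles_influence[OF mix \<B>(1)[OF j] \<B>(2)[OF j] C[OF j] l *(1,3,2)])
        thus "\<bar>m j * (hb (\<Union>(\<B> j)) g (\<sigma>(v := s)) - hb (\<Union>(\<B> j)) g \<sigma>)\<bar>
          \<le> m j * ((1 - of_bool (v \<in> \<Union>(\<B> j)) + C * of_bool (v \<in> outer_boundary (\<Union>(\<B> j)))) * l)"
          unfolding abs_mult using J(2)[OF j] by (simp add: mult_left_mono)
      qed
      also have "\<dots> = (sum m J - (\<Sum>j\<in>J. m j * (of_bool (v \<in> \<Union>(\<B> j)) - C * of_bool (v \<in> outer_boundary (\<Union>(\<B> j)))))) * l"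
        unfolding sum_subtractf[symmetric] sum_distrib_right by (intro sum.cong refl) (simp add: algebra_simps)
      also have "\<dots> \<le> (1 - \<kappa>) * l"
        using \<kappa>(2)[OF *(2)] lip_on_nonneg[OF l] * J(3) by (intro mult_right_mono) auto
      finally show "\<bar>K g (\<sigma>(v := s)) - K g \<sigma>\<bar> \<le> (1 - \<kappa>) * l" .
    qed
  qed
  thus ?thesis unfolding form .
qed

text \<open>A tile is kept when \<open>U\<close> misses its frame \<open>F b\<close>, which contains
  every edge of \<open>E\<close> meeting the tile, so kept tiles are isolated in \<open>U\<close>.
  Equal frame sizes give every tile the same chance \<open>(1 - p) ^ k\<close>, and the balance of
  covering and bordering is merely rescaled.\<close>

lemma SW_form_le_tiles:
  fixes C \<kappa> :: real
  assumes mix: "strong_mixing q d \<beta> a c" "a > 0" "c > 0"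
    and I: "finite I" "I \<noteq> {}"
    and \<B>: "\<And>i. i \<in> I \<Longrightarrow> separated (\<B> i)" "\<And>i b. i \<in> I \<Longrightarrow> b \<in> \<B> i \<Longrightarrow> is_cube d b \<and> b \<subseteq> V"
    and C: "C \<ge> 0" "\<And>i b v. i \<in> I \<Longrightarrow> b \<in> \<B> i \<Longrightarrow> v \<in> outer_boundary b \<Longrightarrow> influence a c r v b \<le> C"
    and E: "finite E" "edges V \<subseteq> E"
    and F: "\<And>i b. i \<in> I \<Longrightarrow> b \<in> \<B> i \<Longrightarrow> F b \<subseteq> E \<and> card (F b) = k"
      "\<And>i b e. i \<in> I \<Longrightarrow> b \<in> \<B> i \<Longrightarrow> e \<in> E \<Longrightarrow> e \<inter> b \<noteq> {} \<Longrightarrow> e \<in> F b"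
    and \<kappa>: "\<kappa> \<le> 1" "\<And>v. v \<in> V \<Longrightarrow>
      real (card {i \<in> I. v \<in> \<Union>(\<B> i)}) - C * real (card {i \<in> I. v \<in> outer_boundary (\<Union>(\<B> i))}) \<ge> \<kappa> * card I"
    and mean: "(\<Sum>\<sigma>\<in>configs q V. w \<sigma> * f \<sigma>) = 0"
  shows "SW_form f \<le> (1 - (1 - p) ^ k * \<kappa>) * (\<Sum>\<sigma>\<in>configs q V. w \<sigma> * (f \<sigma>)\<^sup>2)"
proof -
  define \<B>' where "\<B>' = (\<lambda>(i, U). {b \<in> \<B> i. U \<inter> F b = {}})"
  define m where "m = (\<lambda>(i :: 'a, U). bern p E U / card I)"
  let ?J = "I \<times> Pow E"
  have \<B>'_eq: "\<B>' (i, U) = {b \<in> \<B> i. U \<inter> F b = {}}" for i U by (simp add: \<B>'_def)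
  have cI: "card I > 0" using I by (simp add: card_gt_0_iff)
  have "SW_form f \<le> (\<Sum>U\<in>Pow E. bern p E U * (\<Sum>\<sigma>\<in>configs q V. w \<sigma> * f \<sigma> * hb (\<Union>(\<B>' (i, U))) f \<sigma>))"
    if i: "i \<in> I" for i
  proof (rule SW_form_le_heat_bath[OF E])
    show "\<Union>(\<B>' (i, U)) \<subseteq> V" for U using \<B>(2)[OF i] by (auto simp: \<B>'_def)
    fix U e assume U: "U \<subseteq> E" "e \<in> U"
    show "e \<inter> \<Union>(\<B>' (i, U)) = {}"
      using F(2)[OF i, of _ e] U by (auto simp: \<B>'_def)
  qed
  hence "(\<Sum>i\<in>I. SW_form f / card I) \<le> (\<Sum>i\<in>I. (\<Sum>U\<in>Pow E. bern p E U * (\<Sum>\<sigma>\<in>configs q V. w \<sigma> * f \<sigma> * hb (\<Union>(\<B>' (i, U))) f \<sigma>)) / card I)"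
    by (intro sum_mono divide_right_mono) auto
  also have "(\<Sum>i\<in>I. SW_form f / card I) = SW_form f" using cI by simp
  also have "(\<Sum>i\<in>I. (\<Sum>U\<in>Pow E. bern p E U * (\<Sum>\<sigma>\<in>configs q V. w \<sigma> * f \<sigma> * hb (\<Union>(\<B>' (i, U))) f \<sigma>)) / card I)
     = (\<Sum>j\<in>?J. m j * (\<Sum>\<sigma>\<in>configs q V. w \<sigma> * f \<sigma> * hb (\<Union>(\<B>' j)) f \<sigma>))"
    by (simp add: sum.cartesian_product' m_def sum_divide_distrib)
  also have "\<dots> \<le> (1 - (1 - p) ^ k * \<kappa>) * (\<Sum>\<sigma>\<in>configs q V. w \<sigma> * (f \<sigma>)\<^sup>2)"
  proof (rule random_tiles_form_bound[OF mix _ _ _ _ _ _ _ _ mean, where C = C and r = r])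
    show "finite ?J" using I E by simp
    show "0 \<le> m j" if "j \<in> ?J" for j using p by (simp add: m_def bern_nonneg split_beta)
    show "sum m ?J = 1"
      using cI bern_total[OF E(1), of p] by (simp add: m_def sum.cartesian_product' sum_divide_distrib[symmetric])
    show "separated (\<B>' j)" if "j \<in> ?J" for j
      using that by (intro separated_subset[OF \<B>(1)[of "fst j"]]) (auto simp: \<B>'_def)
    show "is_cube d b \<and> b \<subseteq> V" if "j \<in> ?J" "b \<in> \<B>' j" for j b
      using that \<B>(2) by (auto simp: \<B>'_def)
    show "influence a c r v b \<le> C" if "j \<in> ?J" "b \<in> \<B>' j" "v \<in> outer_boundary b" for j b v
      using that C(2) by (auto simp: \<B>'_def)
    have "(1 - p) ^ k \<le> 1" using p by (intro power_le_one) auto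
    moreover have "(1 - p) ^ k * \<kappa> \<le> (1 - p) ^ k * 1" using \<kappa>(1) p by (intro mult_left_mono) auto
    ultimately show "(1 - p) ^ k * \<kappa> \<le> 1" by simp
    fix v assume v: "v \<in> V"
    let ?b = "\<lambda>i U. of_bool (v \<in> \<Union>(\<B>' (i, U))) - C * of_bool (v \<in> outer_boundary (\<Union>(\<B>' (i, U)))) :: real"
    let ?a = "\<lambda>i. of_bool (v \<in> \<Union>(\<B> i)) - C * of_bool (v \<in> outer_boundary (\<Union>(\<B> i))) :: real"
    have closed: "(\<Sum>U\<in>Pow E. bern p E U * of_bool (U \<inter> F b = {})) = (1 - p) ^ k" if "i \<in> I" "b \<in> \<B> i" for i b
    proof -
      have "(\<Sum>U\<in>Pow E. bern p E U * of_bool (U \<inter> F b = {})) = (\<Sum>U | U \<subseteq> E \<and> U \<inter> F b = {}. bern p E U)"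
        using E by (intro sum.mono_neutral_cong_right) auto
      also have "\<dots> = bern p (F b) {}" using F(1)[OF that] E by (intro bern_marginal) auto
      finally show ?thesis using F(1)[OF that] by (simp add: bern_def)
    qed
    \<comment> \<open>By separation at most one tile of the tiling contains or borders
      \<open>v\<close>, so only the state of its frame matters.\<close>
    have single: "(1 - p) ^ k * ?a i \<le> (\<Sum>U\<in>Pow E. bern p E U * ?b i U)" if i: "i \<in> I" for i
    proof -
      note sep = separatedD[OF \<B>(1)[OF i]]
      consider b where "b \<in> \<B> i" "v \<in> b" | b y where "v \<notin> \<Union>(\<B> i)" "b \<in> \<B> i" "y \<in> b" "adj v y"
        | "v \<notin> \<Union>(\<B> i)" "v \<notin> outer_boundary (\<Union>(\<B> i))"
        by (auto simp: outer_boundary_def)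
      thus ?thesis
      proof cases
        case (1 b)
        have eq: "b' = b" if "b' \<in> \<B> i" "y \<in> b'" "v = y \<or> adj v y" for b' y
          using sep[OF 1(1) that(1) 1(2) that(2), of v] that(3) by argo
        have "?b i U = of_bool (U \<inter> F b = {})" for U
        proof -
          have "v \<in> \<Union>(\<B>' (i, U)) \<longleftrightarrow> U \<inter> F b = {}"
            using 1 eq unfolding \<B>'_eq by blast
          moreover have "v \<notin> outer_boundary (\<Union>(\<B>' (i, U)))"
            using 1 eq unfolding \<B>'_eq outer_boundary_def by blast
          ultimately show ?thesis by simp
        qed
        thus ?thesis using closed[OF i 1(1)] 1 by (auto simp: outer_boundary_def)
      next
        case (2 b y)
        have eq: "b' = b" if "b' \<in> \<B> i" "z \<in> b'" "adj v z" for b' z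
          using sep[OF 2(2) that(1) 2(3) that(2), of v] that(3) 2(4) by argo
        have "?b i U = - C * of_bool (U \<inter> F b = {})" for U
        proof -
          have "v \<notin> \<Union>(\<B>' (i, U))" using 2 by (auto simp: \<B>'_def)
          moreover have "v \<in> outer_boundary (\<Union>(\<B>' (i, U))) \<longleftrightarrow> U \<inter> F b = {}"
            using 2 eq unfolding \<B>'_eq outer_boundary_def by blast
          ultimately show ?thesis by simp
        qed
        hence "(\<Sum>U\<in>Pow E. bern p E U * ?b i U) = - C * (\<Sum>U\<in>Pow E. bern p E U * of_bool (U \<inter> F b = {}))"
          by (simp add: sum_distrib_left mult.left_commute[of C] sum_negf)
        thus ?thesis using closed[OF i 2(2)] 2 by (auto simp: outer_boundary_def)
      next
        case 3
        have "?b i U = 0" for U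
          using 3 by (auto simp: \<B>'_def outer_boundary_def)
        thus ?thesis using 3 by simp
      qed
    qed
    have "(1 - p) ^ k * \<kappa> \<le> (1 - p) ^ k * ((\<Sum>i\<in>I. ?a i) / card I)"
    proof (intro mult_left_mono)
      have "(\<Sum>i\<in>I. ?a i) = real (card {i \<in> I. v \<in> \<Union>(\<B> i)}) - C * real (card {i \<in> I. v \<in> outer_boundary (\<Union>(\<B> i))})"
        using I by (simp add: sum_subtractf sum_distrib_left[symmetric] of_bool_def sum.If_cases Int_def)
      thus "\<kappa> \<le> (\<Sum>i\<in>I. ?a i) / card I" using \<kappa>(2)[OF v] cI by (simp add: field_simps)
    qed (use p in auto)
    also have "\<dots> = (\<Sum>i\<in>I. (1 - p) ^ k * ?a i / card I)"
      by (simp add: sum_distrib_left sum_divide_distrib)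
    also have "\<dots> \<le> (\<Sum>i\<in>I. (\<Sum>U\<in>Pow E. bern p E U * ?b i U) / card I)"
      using single by (intro sum_mono divide_right_mono) auto
    also have "\<dots> = (\<Sum>j\<in>?J. m j * (of_bool (v \<in> \<Union>(\<B>' j)) - C * of_bool (v \<in> outer_boundary (\<Union>(\<B>' j)))))"
      by (simp add: sum.cartesian_product' m_def sum_divide_distrib)
    finally show "(1 - p) ^ k * \<kappa> \<le> (\<Sum>j\<in>?J. m j * (of_bool (v \<in> \<Union>(\<B>' j)) - C * of_bool (v \<in> outer_boundary (\<Union>(\<B>' j)))))" .
  qed
  finally show ?thesis .
qed

end

section \<open>Cubes and tilings\<close>

lemma bij_betw_cube:
  "bij_betw (\<lambda>x. \<lambda>i\<in>{..<d}. x ! i) (cube d a n) (PiE {..<d} (\<lambda>i. {a ! i..<a ! i + int n}))"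
proof (rule bij_betw_byWitness[where f' = "\<lambda>f. map f [0..<d]"])
  show "\<forall>x\<in>cube d a n. map (\<lambda>i\<in>{..<d}. x ! i) [0..<d] = x"
    by (auto simp: cube_def intro!: nth_equalityI)
  show "\<forall>f\<in>PiE {..<d} (\<lambda>i. {a ! i..<a ! i + int n}). (\<lambda>i\<in>{..<d}. map f [0..<d] ! i) = f"
    by (auto simp: PiE_def extensional_def fun_eq_iff)
  show "(\<lambda>x. \<lambda>i\<in>{..<d}. x ! i) ` cube d a n \<subseteq> PiE {..<d} (\<lambda>i. {a ! i..<a ! i + int n})"
    by (intro image_subsetI PiE_I) (auto simp: cube_def)
  show "(\<lambda>f. map f [0..<d]) ` PiE {..<d} (\<lambda>i. {a ! i..<a ! i + int n}) \<subseteq> cube d a n"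
    by (intro image_subsetI) (auto simp: cube_def PiE_def Pi_def)
qed

lemma card_cube: "card (cube d a n) = n ^ d"
  using bij_betw_same_card[OF bij_betw_cube[of d a n]] by (simp add: card_PiE)

lemma finite_cube: "finite (cube d a n)"
  using bij_betw_finite[OF bij_betw_cube[of d a n]] by (simp add: finite_PiE)

lemma cube_mono:
  assumes "\<And>i. i < d \<Longrightarrow> b ! i \<le> a ! i" "\<And>i. i < d \<Longrightarrow> a ! i + int n \<le> b ! i + int m"
  shows "cube d a n \<subseteq> cube d b m"
proof
  fix x assume "x \<in> cube d a n"
  hence "length x = d" "\<And>i. i < d \<Longrightarrow> a ! i \<le> x ! i \<and> x ! i < a ! i + int n" by (auto simp: cube_def)
  thus "x \<in> cube d b m" using assms by (force simp: cube_def)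
qed

lemma adjE:
  assumes "adj x y"
  obtains i where "i < length x" "\<bar>x ! i - y ! i\<bar> = 1" "\<And>k. k < length x \<Longrightarrow> k \<noteq> i \<Longrightarrow> x ! k = y ! k"
proof -
  let ?f = "\<lambda>i. \<bar>x ! i - y ! i\<bar>"
  have sum: "(\<Sum>i<length x. ?f i) = 1" using assms unfolding adj_def by blast
  obtain i where i: "i < length x" "?f i \<noteq> 0"
  proof (rule ccontr)
    assume "\<not> thesis"
    hence "\<forall>i<length x. ?f i = 0" using that by auto
    hence "(\<Sum>i<length x. ?f i) = 0" by (intro sum.neutral) auto
    thus False using sum by simp
  qed
  have split: "(\<Sum>i<length x. ?f i) = ?f i + (\<Sum>k\<in>{..<length x} - {i}. ?f k)"
    using i by (intro sum.remove) auto
  have nonneg: "(\<Sum>k\<in>{..<length x} - {i}. ?f k) \<ge> 0" by (intro sum_nonneg) auto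
  have i1: "?f i = 1" using i split sum nonneg by linarith
  hence "(\<Sum>k\<in>{..<length x} - {i}. ?f k) = 0" using split sum by linarith
  hence "\<forall>k\<in>{..<length x} - {i}. ?f k = 0" by (subst (asm) sum_nonneg_eq_0_iff) auto
  thus thesis using that[OF i(1) i1] by auto
qed

lemma adj_coord_le:
  assumes "adj x y" "i < length x"
  shows "\<bar>x ! i - y ! i\<bar> \<le> 1"
proof -
  obtain k where "\<bar>x ! k - y ! k\<bar> = 1" "\<And>j. j < length x \<Longrightarrow> j \<noteq> k \<Longrightarrow> x ! j = y ! j"
    using adjE[OF assms(1)] by metis
  thus ?thesis using assms(2) by (cases "i = k") auto
qed

lemma adj_length: "adj x y \<Longrightarrow> length x = length y"
  by (simp add: adj_def)

text \<open>The ball lies in the corresponding ball of the maximum norm, a cube.\<close>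

lemma card_l1_ball_le:
  assumes "length v = d"
  shows "card {x \<in> cube d a n. l1dist v x < real r} \<le> (2 * r + 1) ^ d"
proof -
  have "{x \<in> cube d a n. l1dist v x < real r} \<subseteq> cube d (map (\<lambda>t. t - int r) v) (2 * r + 1)"
  proof
    fix x assume x: "x \<in> {x \<in> cube d a n. l1dist v x < real r}"
    hence "real_of_int (\<Sum>i<d. \<bar>v ! i - x ! i\<bar>) < real_of_int (int r)"
      using assms by (simp add: l1dist_def del: of_int_sum)
    hence sum: "(\<Sum>i<d. \<bar>v ! i - x ! i\<bar>) < int r" by (simp only: of_int_less_iff)
    have "\<bar>v ! i - x ! i\<bar> < int r" if "i < d" for i
      using member_le_sum[of i "{..<d}" "\<lambda>i. \<bar>v ! i - x ! i\<bar>"] that sum by simp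
    hence "v ! i - int r \<le> x ! i \<and> x ! i < v ! i - int r + int (2 * r + 1)" if "i < d" for i
      using that by fastforce
    thus "x \<in> cube d (map (\<lambda>t. t - int r) v) (2 * r + 1)"
      using x assms by (auto simp: cube_def)
  qed
  from card_mono[OF finite_cube this] show ?thesis by (simp add: card_cube)
qed

lemma influence_cube_le:
  assumes "v \<in> outer_boundary (cube d a n)" "n \<le> m" "c \<ge> 0"
  shows "influence \<alpha> c r v (cube d a n) \<le> 2 * (2 * real r + 1) ^ d + real m ^ d * (c * exp (- \<alpha> * real r))"
proof -
  obtain y where "y \<in> cube d a n" "adj v y" using assms(1) by (auto simp: outer_boundary_def)
  hence "length v = d" by (auto simp: cube_def adj_def)
  from card_l1_ball_le[OF this, of a n r]
  have "real (card {x \<in> cube d a n. l1dist v x < real r}) \<le> real ((2 * r + 1) ^ d)"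
    by (simp only: of_nat_le_iff)
  moreover have "real n ^ d \<le> real m ^ d" using assms by (intro power_mono) auto
  ultimately show ?thesis
    unfolding influence_def card_cube using assms by (intro add_mono mult_mono) (auto simp: ac_simps)
qed

definition shift :: "int list \<Rightarrow> int list \<Rightarrow> int list" where
  "shift a x = map2 (+) a x"

lemma shift_simps: "length a = d \<Longrightarrow> length x = d \<Longrightarrow> length (shift a x) = d"
  "length a = d \<Longrightarrow> length x = d \<Longrightarrow> i < d \<Longrightarrow> shift a x ! i = a ! i + x ! i"
  by (auto simp: shift_def)

lemma adj_shift: "length a = d \<Longrightarrow> length x = d \<Longrightarrow> length y = d \<Longrightarrow> adj (shift a x) (shift a y) \<longleftrightarrow> adj x y"
  by (simp add: adj_def shift_simps[of a d])

text \<open>Translation invariance, from which all frames get the same number of edges.\<close>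

lemma card_edges_cube:
  assumes a: "length a = d"
  shows "card (edges (cube d a n)) = card (edges (cube d (replicate d 0) n))"
proof -
  let ?C = "cube d (replicate d 0) n"
  have len: "length x = d" if "x \<in> ?C" for x using that by (simp add: cube_def)
  have inj: "inj_on (shift a) ?C"
    using a by (auto simp: inj_on_def cube_def shift_def list_eq_iff_nth_eq)
  have im: "shift a ` ?C = cube d a n"
  proof (intro equalityI subsetI)
    fix x assume x: "x \<in> cube d a n"
    define y where "y = map2 (-) x a"
    have "y \<in> ?C" using x a by (auto simp: cube_def y_def)
    moreover have "x = shift a y" using x a by (auto simp: cube_def y_def shift_def intro!: nth_equalityI)
    ultimately show "x \<in> shift a ` ?C" by blast
  qed (use a in \<open>auto simp: cube_def shift_def\<close>)
  have "edges (cube d a n) = (\<lambda>e. shift a ` e) ` edges ?C"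
  proof (intro equalityI subsetI)
    fix e assume "e \<in> edges (cube d a n)"
    then obtain x y where "e = {shift a x, shift a y}" "x \<in> ?C" "y \<in> ?C" "adj (shift a x) (shift a y)"
      unfolding edges_def im[symmetric] by blast
    hence "e = shift a ` {x, y}" "{x, y} \<in> edges ?C" using adj_shift[OF a] len by (auto simp: edges_def)
    thus "e \<in> (\<lambda>e. shift a ` e) ` edges ?C" by blast
  next
    fix e assume "e \<in> (\<lambda>e. shift a ` e) ` edges ?C"
    then obtain x y where "e = {shift a x, shift a y}" "x \<in> ?C" "y \<in> ?C" "adj x y"
      by (auto simp: edges_def)
    thus "e \<in> edges (cube d a n)" unfolding edges_def im[symmetric] using adj_shift[OF a] len by blast
  qed
  moreover have "inj_on (\<lambda>e. shift a ` e) (edges ?C)"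
    using inj_on_image_Pow[OF inj] by (rule inj_on_subset) (auto simp: edges_def)
  ultimately show ?thesis by (simp add: card_image)
qed

lemma edges_mono: "A \<subseteq> B \<Longrightarrow> edges A \<subseteq> edges B"
  by (auto simp: edges_def)

text \<open>One coordinate of a tiling. The interval \<open>[t, t + l)\<close> inside \<open>[0, N)\<close> belongs to the tiling with label
  \<open>(s, j)\<close> if \<open>t\<close> has residue \<open>s\<close>; only the intervals touching an end of \<open>[0, N)\<close> occur for \<open>j > 0\<close>. Summed over
  all labels, these two have weight \<open>L\<close> and all others weight 1, which makes up for the
  few intervals that cover points close to the ends.\<close>
definition admissible :: "nat \<Rightarrow> nat \<Rightarrow> nat \<Rightarrow> nat \<times> nat \<Rightarrow> int \<Rightarrow> bool" where
  "admissible L N l sj t \<longleftrightarrow> 0 \<le> t \<and> t + int l \<le> int N \<and> t mod int (2 * L + 2) = int (fst sj) \<and>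
     (snd sj = 0 \<or> t = 0 \<or> t + int l = int N)"

text \<open>Labels are drawn uniformly, so the number of labels for which an interval occurs acts as
  its probability weight.\<close>

definition labels :: "nat \<Rightarrow> (nat \<times> nat) set" where
  "labels L = {..<2 * L + 2} \<times> {..<L}"

definition covering :: "nat \<Rightarrow> nat \<Rightarrow> nat \<Rightarrow> int \<Rightarrow> (nat \<times> nat) set" where
  "covering L N l x = {sj \<in> labels L. \<exists>t. admissible L N l sj t \<and> t \<le> x \<and> x < t + int l}"

definition bordering :: "nat \<Rightarrow> nat \<Rightarrow> nat \<Rightarrow> int \<Rightarrow> (nat \<times> nat) set" where
  "bordering L N l x = {sj \<in> labels L. \<exists>t. admissible L N l sj t \<and> (x = t - 1 \<or> x = t + int l)}"

definition residue :: "nat \<Rightarrow> int \<Rightarrow> nat" where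
  "residue L t = nat (t mod int (2 * L + 2))"

lemma residue: "residue L t < 2 * L + 2" "int (residue L t) = t mod int (2 * L + 2)"
proof -
  have "0 \<le> t mod int (2 * L + 2)" "t mod int (2 * L + 2) < int (2 * L + 2)" by (auto intro: pos_mod_bound pos_mod_sign)
  thus "residue L t < 2 * L + 2" "int (residue L t) = t mod int (2 * L + 2)"
    unfolding residue_def by linarith+
qed

lemma finite_labels: "finite (labels L)" "finite (covering L N l x)" "finite (bordering L N l x)"
proof -
  show fin: "finite (labels L)" by (simp add: labels_def)
  show "finite (covering L N l x)" "finite (bordering L N l x)"
    by (rule finite_subset[OF _ fin], simp add: covering_def bordering_def)+
qed

text \<open>Near an end an end interval covers \<open>x\<close>, and it counts for \<open>L\<close>
  labels. Elsewhere all \<open>l\<close> starting points in \<open>{x - int l<..x}\<close> are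
  admissible, with distinct residues because \<open>l\<close> is below the period.\<close>

lemma card_covering_ge:
  assumes L: "L \<ge> 1" "L \<le> l" "l < 2 * L" "2 * L \<le> N" and x: "0 \<le> x" "x < int N"
  shows "L \<le> card (covering L N l x)"
proof -
  have end_case: "L \<le> card (covering L N l x)" if "t = 0 \<or> t + int l = int N" "t \<le> x" "x < t + int l" for t
  proof -
    have "{residue L t} \<times> {..<L} \<subseteq> covering L N l x"
      using that L residue[of L t] by (auto simp: covering_def labels_def admissible_def intro!: exI[of _ t])
    from card_mono[OF finite_labels(2) this] show ?thesis by (simp add: card_cartesian_product)
  qed
  consider "x < int l" | "int N - int l \<le> x" | "int l \<le> x" "x < int N - int l" by linarith
  thus ?thesis
  proof cases
    case 1 thus ?thesis using x by (intro end_case[of 0]) auto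
  next
    case 2 thus ?thesis using x by (intro end_case[of "int N - int l"]) auto
  next
    case 3
    let ?T = "{x - int l<..x}"
    have sub: "(\<lambda>t. (residue L t, 0)) ` ?T \<subseteq> covering L N l x"
    proof (intro image_subsetI)
      fix t assume "t \<in> ?T"
      thus "(residue L t, 0) \<in> covering L N l x"
        using 3 L residue[of L t] by (auto simp: covering_def labels_def admissible_def intro!: exI[of _ t])
    qed
    have "inj_on (\<lambda>t. (residue L t, 0 :: nat)) ?T"
    proof (rule inj_onI)
      fix t t' assume t: "t \<in> ?T" "t' \<in> ?T" "(residue L t, 0 :: nat) = (residue L t', 0)"
      hence "t mod int (2 * L + 2) = t' mod int (2 * L + 2)" using residue(2) by (metis prod.inject)
      hence "int (2 * L + 2) dvd t - t'" by (simp add: mod_eq_dvd_iff)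
      moreover have "\<bar>t - t'\<bar> < int (2 * L + 2)" using t L by auto
      ultimately have "t - t' = 0" using dvd_imp_le_int by (metis abs_of_nat linorder_not_le)
      thus "t = t'" by simp
    qed
    hence "l = card ((\<lambda>t. (residue L t, 0 :: nat)) ` ?T)" by (simp add: card_image)
    also have "\<dots> \<le> card (covering L N l x)" by (rule card_mono[OF finite_labels(2) sub])
    finally show ?thesis using L by simp
  qed
qed

lemma admissible_residue: "admissible L N l (s, j) t \<Longrightarrow> s = residue L t"
  using residue(2)[of L t] by (simp add: admissible_def)

text \<open>The \<open>l\<close> possible starting points give at most \<open>l\<close> labels with
  second component 0, and the two end intervals at most \<open>L\<close> labels each.\<close>

lemma card_covering_le:
  assumes L: "l < 2 * L"
  shows "card (covering L N l x) \<le> 4 * L"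
proof -
  let ?A = "(\<lambda>t. (residue L t, 0 :: nat)) ` {x - int l<..x}"
  let ?B = "{residue L 0, residue L (int N - int l)} \<times> {..<L}"
  have "covering L N l x \<subseteq> ?A \<union> ?B"
  proof
    fix sj assume "sj \<in> covering L N l x"
    then obtain s j t where t: "sj = (s, j)" "j < L" "admissible L N l (s, j) t" "t \<le> x" "x < t + int l"
      by (auto simp: covering_def labels_def)
    hence s: "s = residue L t" by (intro admissible_residue)
    have "j = 0 \<or> t = 0 \<or> t = int N - int l" using t by (auto simp: admissible_def)
    thus "sj \<in> ?A \<union> ?B" using t s by auto
  qed
  hence "card (covering L N l x) \<le> card (?A \<union> ?B)" by (intro card_mono) auto
  also have "\<dots> \<le> card ?A + card ?B" by (rule card_Un_le)
  also have "\<dots> \<le> l + 2 * L"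
  proof (intro add_mono)
    show "card ?A \<le> l" using card_image_le[of "{x - int l<..x}" "\<lambda>t. (residue L t, 0 :: nat)"] by simp
    have "card {residue L 0, residue L (int N - int l)} \<le> 2" by (simp add: card_insert_if)
    thus "card ?B \<le> 2 * L" by (simp add: card_cartesian_product)
  qed
  finally show ?thesis using L by simp
qed

text \<open>Only intervals starting at \<open>x + 1\<close> or \<open>x - l\<close> border
  \<open>x\<close>. As \<open>x\<close> lies inside \<open>[0, N)\<close>, the former can be an end
  interval only on the right and the latter only on the left, which gives the two
  coincidences.\<close>

lemma card_bordering_le:
  assumes x: "0 \<le> x" "x < int N"
  shows "card (bordering L N l x) \<le> 2 + L * of_bool (x = int l) + L * of_bool (x + 1 + int l = int N)"
proof -
  let ?S = "\<lambda>b. if b then {..<L} else {}"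
  let ?A = "{(residue L (x + 1), 0), (residue L (x - int l), 0)} :: (nat \<times> nat) set"
  let ?B = "{residue L (x - int l)} \<times> ?S (x = int l)"
  let ?C = "{residue L (x + 1)} \<times> ?S (x + 1 + int l = int N)"
  have "bordering L N l x \<subseteq> ?A \<union> ?B \<union> ?C"
  proof
    fix sj assume "sj \<in> bordering L N l x"
    then obtain s j t where t: "sj = (s, j)" "j < L" "admissible L N l (s, j) t" "t = x + 1 \<or> t = x - int l"
      by (auto simp: bordering_def labels_def)
    have s: "s = residue L t" using t by (intro admissible_residue)
    have "j = 0 \<or> t = 0 \<or> t + int l = int N" using t by (auto simp: admissible_def)
    thus "sj \<in> ?A \<union> ?B \<union> ?C" using t s x by auto
  qed
  hence "card (bordering L N l x) \<le> card (?A \<union> ?B \<union> ?C)" by (intro card_mono) auto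
  also have "\<dots> \<le> card ?A + card ?B + card ?C"
    by (intro order_trans[OF card_Un_le] add_mono card_Un_le order_refl)
  also have "\<dots> \<le> 2 + L * of_bool (x = int l) + L * of_bool (x + 1 + int l = int N)"
    by (intro add_mono) (auto simp: card_insert_if card_cartesian_product)
  finally show ?thesis .
qed

text \<open>Each coincidence of weight \<open>L\<close> happens for at most one length. Per length,
  bordering therefore costs 4 on average, whereas at least \<open>L\<close> labels cover.\<close>

lemma sum_card_bordering_le:
  assumes "0 \<le> x" "x < int N"
  shows "(\<Sum>l\<in>{L..<2 * L}. card (bordering L N l x)) \<le> 4 * L"
proof -
  have one: "(\<Sum>l\<in>{L..<2 * L}. L * of_bool (P l)) \<le> L" if "\<And>l l'. P l \<Longrightarrow> P l' \<Longrightarrow> l = l'" for P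
  proof (cases "\<exists>l0. P l0")
    case True
    then obtain l0 where "P l0" by blast
    hence "P l \<longleftrightarrow> l = l0" for l using that by blast
    hence "(\<Sum>l\<in>{L..<2 * L}. L * of_bool (P l)) = (\<Sum>l\<in>{L..<2 * L}. if l = l0 then L else 0)"
      by (intro sum.cong) auto
    also have "\<dots> \<le> L" by (simp only: sum.delta finite_atLeastLessThan) simp
    finally show ?thesis .
  qed simp
  have "(\<Sum>l\<in>{L..<2 * L}. card (bordering L N l x)) \<le>
      (\<Sum>l\<in>{L..<2 * L}. 2 + L * of_bool (x = int l) + L * of_bool (x + 1 + int l = int N))"
    by (intro sum_mono card_bordering_le assms)
  also have "\<dots> = 2 * L + (\<Sum>l\<in>{L..<2 * L}. L * of_bool (x = int l)) + (\<Sum>l\<in>{L..<2 * L}. L * of_bool (x + 1 + int l = int N))"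
    by (simp only: sum.distrib) simp
  also have "\<dots> \<le> 2 * L + L + L" by (intro add_mono one order_refl) auto
  finally show ?thesis by simp
qed

section \<open>Product tilings of a cube\<close>

definition tiling :: "nat \<Rightarrow> int list \<Rightarrow> nat \<Rightarrow> nat \<Rightarrow> nat \<times> (nat \<Rightarrow> nat \<times> nat) \<Rightarrow> int list set set" where
  "tiling d c N L = (\<lambda>(l, g). {cube d a l | a. length a = d \<and> (\<forall>i<d. admissible L N l (g i) (a ! i - c ! i))})"

text \<open>One side length serves all coordinates, so that tiles are cubes; the labels are chosen
  independently, so that counts become products.\<close>

definition tiling_index :: "nat \<Rightarrow> nat \<Rightarrow> (nat \<times> (nat \<Rightarrow> nat \<times> nat)) set" where
  "tiling_index d L = {L..<2 * L} \<times> PiE {..<d} (\<lambda>_. labels L)"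

lemma tilingE:
  assumes "b \<in> tiling d c N L (l, g)"
  obtains a where "b = cube d a l" "length a = d" "\<And>i. i < d \<Longrightarrow> admissible L N l (g i) (a ! i - c ! i)"
  using assms by (auto simp: tiling_def)

lemma tiling_subset:
  assumes "b \<in> tiling d c N L (l, g)"
  shows "b \<subseteq> cube d c N"
proof -
  obtain a where a: "b = cube d a l" "length a = d" "\<And>i. i < d \<Longrightarrow> admissible L N l (g i) (a ! i - c ! i)"
    using assms by (rule tilingE) blast
  have "0 \<le> a ! i - c ! i" "a ! i - c ! i + int l \<le> int N" if "i < d" for i
    using a(3)[OF that] by (auto simp: admissible_def)
  thus ?thesis unfolding a(1) by (intro cube_mono) force+
qed

lemma tiling_separated:
  assumes l: "l < 2 * L"
  shows "separated (tiling d c N L (l, g))"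
  unfolding separated_def
proof (intro ballI impI allI)
  fix b b' x y assume b: "b \<in> tiling d c N L (l, g)" "b' \<in> tiling d c N L (l, g)" "b \<noteq> b'" and xy: "x \<in> b" "y \<in> b'"
  obtain a where a: "b = cube d a l" "length a = d" "\<And>i. i < d \<Longrightarrow> admissible L N l (g i) (a ! i - c ! i)"
    using b(1) by (rule tilingE) blast
  obtain a' where a': "b' = cube d a' l" "length a' = d" "\<And>i. i < d \<Longrightarrow> admissible L N l (g i) (a' ! i - c ! i)"
    using b(2) by (rule tilingE) blast
  have "a \<noteq> a'" using a(1) a'(1) b(3) by auto
  then obtain k where k: "k < d" "a ! k \<noteq> a' ! k" using a(2) a'(2) by (auto simp: list_eq_iff_nth_eq)
  have "(a ! k - c ! k) mod int (2 * L + 2) = (a' ! k - c ! k) mod int (2 * L + 2)"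
    using a(3)[OF k(1)] a'(3)[OF k(1)] by (simp add: admissible_def)
  hence "int (2 * L + 2) dvd a ! k - a' ! k" by (simp add: mod_eq_dvd_iff)
  \<comment> \<open>A side length below \<open>2 * L\<close> leaves a gap of more than 2 in
    coordinate \<open>k\<close>, which also excludes a common neighbour.\<close>
  hence "int (2 * L + 2) \<le> \<bar>a ! k - a' ! k\<bar>" using dvd_imp_le_int[of "a ! k - a' ! k" "int (2 * L + 2)"] k(2) by simp
  moreover have "length x = d" "a ! k \<le> x ! k" "x ! k < a ! k + int l"
    "length y = d" "a' ! k \<le> y ! k" "y ! k < a' ! k + int l"
    using xy k(1) unfolding a(1) a'(1) by (auto simp: cube_def)
  ultimately have far: "\<bar>x ! k - y ! k\<bar> > 2" "length x = d" "length y = d" using l by auto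
  show "x \<noteq> y \<and> \<not> adj x y \<and> (\<forall>v. \<not> (adj v x \<and> adj v y))"
  proof (intro conjI allI notI)
    show False if "x = y" using that far by simp
    show False if "adj x y" using adj_coord_le[OF that, of k] far k by simp
    show False if "adj v x \<and> adj v y" for v
    proof -
      have v: "adj v x" "adj v y" using that by auto
      thus False using adj_coord_le[OF v(1), of k] adj_coord_le[OF v(2), of k] adj_length[OF v(1)] far k
        by simp
    qed
  qed
qed

lemma mem_tiling_iff:
  assumes v: "length v = d"
  shows "v \<in> \<Union>(tiling d c N L (l, g)) \<longleftrightarrow>
    (\<forall>i<d. \<exists>t. admissible L N l (g i) t \<and> t \<le> v ! i - c ! i \<and> v ! i - c ! i < t + int l)"
proof
  assume "v \<in> \<Union>(tiling d c N L (l, g))"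
  then obtain b where b: "b \<in> tiling d c N L (l, g)" "v \<in> b" by blast
  obtain a where a: "b = cube d a l" "length a = d" "\<And>i. i < d \<Longrightarrow> admissible L N l (g i) (a ! i - c ! i)"
    using b(1) by (rule tilingE) blast
  show "\<forall>i<d. \<exists>t. admissible L N l (g i) t \<and> t \<le> v ! i - c ! i \<and> v ! i - c ! i < t + int l"
  proof (intro allI impI)
    fix i assume i: "i < d"
    show "\<exists>t. admissible L N l (g i) t \<and> t \<le> v ! i - c ! i \<and> v ! i - c ! i < t + int l"
      using a(3)[OF i] b(2) i unfolding a(1) by (intro exI[of _ "a ! i - c ! i"]) (auto simp: cube_def)
  qed
next
  assume "\<forall>i<d. \<exists>t. admissible L N l (g i) t \<and> t \<le> v ! i - c ! i \<and> v ! i - c ! i < t + int l"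
  then obtain t where t: "\<And>i. i < d \<Longrightarrow> admissible L N l (g i) (t i) \<and> t i \<le> v ! i - c ! i \<and> v ! i - c ! i < t i + int l"
    by metis
  define a where "a = map (\<lambda>i. c ! i + t i) [0..<d]"
  have a: "length a = d" "a ! i = c ! i + t i" if "i < d" for i using that by (auto simp: a_def)
  have la: "length a = d" by (simp add: a_def)
  have "cube d a l \<in> tiling d c N L (l, g)"
    unfolding tiling_def using t a(2) la by fastforce
  moreover have "v \<in> cube d a l" using t a(2) v by (fastforce simp: cube_def)
  ultimately show "v \<in> \<Union>(tiling d c N L (l, g))" by blast
qed

text \<open>A step to a neighbour changes one coordinate only, so \<open>v\<close> leaves the tile
  in that coordinate and stays within its range in all the others.\<close>

lemma boundary_tiling:
  assumes "v \<in> outer_boundary (\<Union>(tiling d c N L (l, g)))"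
  shows "\<exists>i<d. (\<exists>t. admissible L N l (g i) t \<and> (v ! i - c ! i = t - 1 \<or> v ! i - c ! i = t + int l)) \<and>
    (\<forall>k<d. k \<noteq> i \<longrightarrow> (\<exists>t. admissible L N l (g k) t \<and> t \<le> v ! k - c ! k \<and> v ! k - c ! k < t + int l))"
proof -
  obtain b y where b: "b \<in> tiling d c N L (l, g)" "y \<in> b" "adj v y" "v \<notin> b"
    using assms by (auto simp: outer_boundary_def)
  obtain a where a: "b = cube d a l" "length a = d" "\<And>i. i < d \<Longrightarrow> admissible L N l (g i) (a ! i - c ! i)"
    using b(1) by (rule tilingE) blast
  have y: "length y = d" "\<And>i. i < d \<Longrightarrow> a ! i \<le> y ! i \<and> y ! i < a ! i + int l"
    using b(2) unfolding a(1) by (auto simp: cube_def)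
  have v: "length v = d" using adj_length[OF b(3)] y by simp
  obtain i where i: "i < d" "\<bar>v ! i - y ! i\<bar> = 1" "\<And>k. k < d \<Longrightarrow> k \<noteq> i \<Longrightarrow> v ! k = y ! k"
    using adjE[OF b(3)] v by metis
  have others: "a ! k \<le> v ! k \<and> v ! k < a ! k + int l" if "k < d" "k \<noteq> i" for k
    using y(2)[OF that(1)] i(3)[OF that] by simp
  have "\<not> (a ! i \<le> v ! i \<and> v ! i < a ! i + int l)"
  proof
    assume "a ! i \<le> v ! i \<and> v ! i < a ! i + int l"
    hence "a ! k \<le> v ! k \<and> v ! k < a ! k + int l" if "k < d" for k
      using others that by (cases "k = i") auto
    thus False using b(4) v unfolding a(1) cube_def by blast
  qed
  hence vi: "v ! i = a ! i - 1 \<or> v ! i = a ! i + int l" using i(2) y(2)[OF i(1)] by linarith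
  show ?thesis
  proof (intro exI[of _ i] conjI allI impI)
    show "\<exists>t. admissible L N l (g i) t \<and> (v ! i - c ! i = t - 1 \<or> v ! i - c ! i = t + int l)"
      using a(3)[OF i(1)] vi by (intro exI[of _ "a ! i - c ! i"]) auto
    fix k assume k: "k < d" "k \<noteq> i"
    show "\<exists>t. admissible L N l (g k) t \<and> t \<le> v ! k - c ! k \<and> v ! k - c ! k < t + int l"
      using a(3)[OF k(1)] others[OF k] by (intro exI[of _ "a ! k - c ! k"]) auto
  qed (rule i(1))
qed

lemma finite_tiling_index: "finite (tiling_index d L)"
  by (simp add: tiling_index_def finite_PiE finite_labels)

lemma card_tiling_index: "card (tiling_index d L) = L * ((2 * L + 2) * L) ^ d"
  by (simp add: tiling_index_def card_cartesian_product card_PiE labels_def)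

lemma card_tilings_covering:
  assumes L: "L \<ge> 1" "2 * L \<le> N" and v: "v \<in> cube d c N"
  shows "L * L ^ d \<le> card {i \<in> tiling_index d L. v \<in> \<Union>(tiling d c N L i)}"
proof -
  let ?x = "\<lambda>i. v ! i - c ! i"
  have len: "length v = d" and x: "\<And>i. i < d \<Longrightarrow> 0 \<le> ?x i \<and> ?x i < int N"
    using v by (auto simp: cube_def)
  have "L * L ^ d = (\<Sum>l\<in>{L..<2 * L}. \<Prod>i<d. L)" by simp
  also have "\<dots> \<le> (\<Sum>l\<in>{L..<2 * L}. \<Prod>i<d. card (covering L N l (?x i)))"
    using L x by (intro sum_mono prod_mono conjI card_covering_ge) auto
  also have "\<dots> = card (Sigma {L..<2 * L} (\<lambda>l. PiE {..<d} (\<lambda>i. covering L N l (?x i))))"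
    by (simp add: card_PiE finite_PiE finite_labels)
  also have "\<dots> \<le> card {i \<in> tiling_index d L. v \<in> \<Union>(tiling d c N L i)}"
  proof (intro card_mono subsetI)
    show "finite {i \<in> tiling_index d L. v \<in> \<Union>(tiling d c N L i)}" using finite_tiling_index by simp
    fix i assume "i \<in> Sigma {L..<2 * L} (\<lambda>l. PiE {..<d} (\<lambda>i. covering L N l (?x i)))"
    then obtain l g where i: "i = (l, g)" "l \<in> {L..<2 * L}" "g \<in> PiE {..<d} (\<lambda>i. covering L N l (?x i))" by auto
    have cov: "g k \<in> covering L N l (?x k)" if "k < d" for k using i(3) that by auto
    have "g \<in> PiE {..<d} (\<lambda>_. labels L)" using i(3) by (auto simp: PiE_def covering_def)
    moreover have "v \<in> \<Union>(tiling d c N L (l, g))"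
      unfolding mem_tiling_iff[OF len] using cov by (auto simp: covering_def)
    ultimately show "i \<in> {i \<in> tiling_index d L. v \<in> \<Union>(tiling d c N L i)}"
      using i by (simp add: tiling_index_def)
  qed
  finally show ?thesis .
qed

text \<open>Union bound over the coordinate in which \<open>v\<close> leaves a tile. Summing over
  \<open>l\<close> in that coordinate costs \<open>4 * L\<close> altogether rather than for each of
  the \<open>L\<close> lengths; this is the factor \<open>L\<close> gained over
  \<open>card_tilings_covering\<close>.\<close>

lemma card_tilings_bordering:
  assumes L: "L \<ge> 1" and v: "v \<in> cube d c N"
  shows "card {i \<in> tiling_index d L. v \<in> outer_boundary (\<Union>(tiling d c N L i))} \<le> d * (4 * L) ^ d"
proof -
  let ?x = "\<lambda>i. v ! i - c ! i"
  have len: "length v = d" and x: "\<And>i. i < d \<Longrightarrow> 0 \<le> ?x i \<and> ?x i < int N"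
    using v by (auto simp: cube_def)
  define S where "S i l = PiE {..<d} (\<lambda>k. if k = i then bordering L N l (?x k) else covering L N l (?x k))" for i l
  have finS: "finite (S i l)" for i l unfolding S_def by (intro finite_PiE) (auto simp: finite_labels)
  have "{i \<in> tiling_index d L. v \<in> outer_boundary (\<Union>(tiling d c N L i))} \<subseteq> (\<Union>i<d. Sigma {L..<2 * L} (S i))"
  proof
    fix j assume j: "j \<in> {i \<in> tiling_index d L. v \<in> outer_boundary (\<Union>(tiling d c N L i))}"
    then obtain l g where lg: "j = (l, g)" "l \<in> {L..<2 * L}" "g \<in> PiE {..<d} (\<lambda>_. labels L)"
      by (auto simp: tiling_index_def)
    have g: "g k \<in> labels L" if "k < d" for k using lg(3) that by auto
    obtain i where i: "i < d" "\<exists>t. admissible L N l (g i) t \<and> (?x i = t - 1 \<or> ?x i = t + int l)"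
      "\<forall>k<d. k \<noteq> i \<longrightarrow> (\<exists>t. admissible L N l (g k) t \<and> t \<le> ?x k \<and> ?x k < t + int l)"
      using boundary_tiling[of v d c N L l g] j lg by auto
    have "g k \<in> (if k = i then bordering L N l (?x k) else covering L N l (?x k))" if "k < d" for k
      using i g[OF that] that by (cases "k = i") (simp_all add: bordering_def covering_def)
    hence "g \<in> S i l" using lg(3) unfolding S_def by (auto simp: PiE_def)
    thus "j \<in> (\<Union>i<d. Sigma {L..<2 * L} (S i))" using lg i by auto
  qed
  hence "card {i \<in> tiling_index d L. v \<in> outer_boundary (\<Union>(tiling d c N L i))} \<le> card (\<Union>i<d. Sigma {L..<2 * L} (S i))"
    using finS by (intro card_mono) auto
  also have "\<dots> \<le> (\<Sum>i<d. card (Sigma {L..<2 * L} (S i)))" by (intro card_UN_le) auto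
  also have "\<dots> \<le> (\<Sum>i<d. (4 * L) ^ d)"
  proof (intro sum_mono)
    fix i assume i: "i \<in> {..<d}"
    have "card (S i l) \<le> card (bordering L N l (?x i)) * (4 * L) ^ (d - 1)" if l: "l \<in> {L..<2 * L}" for l
    proof -
      have "card (S i l) = (\<Prod>k<d. card (if k = i then bordering L N l (?x k) else covering L N l (?x k)))"
        unfolding S_def by (simp add: card_PiE)
      also have "\<dots> = card (bordering L N l (?x i)) *
          (\<Prod>k\<in>{..<d} - {i}. card (if k = i then bordering L N l (?x k) else covering L N l (?x k)))"
        using i by (subst prod.remove[of _ i]) auto
      also have "\<dots> \<le> card (bordering L N l (?x i)) * (\<Prod>k\<in>{..<d} - {i}. 4 * L)"
        using l by (intro mult_left_mono prod_mono) (auto intro!: card_covering_le)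
      also have "(\<Prod>k\<in>{..<d} - {i}. 4 * L) = (4 * L) ^ (d - 1)" using i by simp
      finally show ?thesis .
    qed
    hence "(\<Sum>l\<in>{L..<2 * L}. card (S i l)) \<le> (\<Sum>l\<in>{L..<2 * L}. card (bordering L N l (?x i)) * (4 * L) ^ (d - 1))"
      by (intro sum_mono)
    also have "\<dots> = (\<Sum>l\<in>{L..<2 * L}. card (bordering L N l (?x i))) * (4 * L) ^ (d - 1)"
      by (simp only: sum_distrib_right)
    also have "\<dots> \<le> 4 * L * (4 * L) ^ (d - 1)"
      using x i by (intro mult_right_mono sum_card_bordering_le) auto
    also have "\<dots> = (4 * L) ^ d" using i by (cases d) auto
    finally show "card (Sigma {L..<2 * L} (S i)) \<le> (4 * L) ^ d" using finS by simp
  qed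
  also have "\<dots> = d * (4 * L) ^ d" by simp
  finally show ?thesis .
qed

text \<open>All edges within distance one of a tile lie in a cube whose size does not depend on the tile, so
  the probability that all of them are closed is the same for every tile.\<close>
definition frame :: "nat \<Rightarrow> nat \<Rightarrow> int list set \<Rightarrow> int list set set" where
  "frame d L b = (let a = (SOME a. length a = d \<and> (\<exists>l. 1 \<le> l \<and> l < 2 * L \<and> b = cube d a l))
     in edges (cube d (map (\<lambda>t. t - 1) a) (2 * L + 2)))"

lemma frame:
  assumes b: "b = cube d a0 l0" "length a0 = d" "1 \<le> l0" "l0 < 2 * L" and sub: "b \<subseteq> cube d c N" and c: "length c = d"
  defines "E \<equiv> edges (cube d (map (\<lambda>t. t - 1) c) (N + 2 * L + 2))"
  shows "frame d L b \<subseteq> E" "card (frame d L b) = card (edges (cube d (replicate d 0) (2 * L + 2)))"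
    "e \<in> E \<Longrightarrow> e \<inter> b \<noteq> {} \<Longrightarrow> e \<in> frame d L b"
proof -
  define a where "a = (SOME a. length a = d \<and> (\<exists>l. 1 \<le> l \<and> l < 2 * L \<and> b = cube d a l))"
  have "length a = d \<and> (\<exists>l. 1 \<le> l \<and> l < 2 * L \<and> b = cube d a l)"
    unfolding a_def by (rule someI[of _ a0]) (use b in blast)
  then obtain l where l: "length a = d" "1 \<le> l" "l < 2 * L" "b = cube d a l" by blast
  \<comment> \<open>Side \<open>2 * L + 2\<close> holds the tile with one layer on each side,
    whatever \<open>l\<close> is. The corner \<open>a\<close> lies in the tile, hence in the large
    cube, so enlarging the latter by \<open>2 * L + 2\<close> makes room for
    \<open>?W\<close>.\<close>
  let ?W = "cube d (map (\<lambda>t. t - 1) a) (2 * L + 2)"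
  have fr: "frame d L b = edges ?W" unfolding frame_def Let_def a_def ..
  have "a \<in> b" using l by (auto simp: cube_def)
  hence a: "c ! i \<le> a ! i" "a ! i < c ! i + int N" if "i < d" for i using sub that by (auto simp: cube_def)
  have "?W \<subseteq> cube d (map (\<lambda>t. t - 1) c) (N + 2 * L + 2)"
  proof (intro cube_mono)
    fix i assume i: "i < d"
    show "map (\<lambda>t. t - 1) c ! i \<le> map (\<lambda>t. t - 1) a ! i"
      "map (\<lambda>t. t - 1) a ! i + int (2 * L + 2) \<le> map (\<lambda>t. t - 1) c ! i + int (N + 2 * L + 2)"
      using a[OF i] i l(1) c by simp_all
  qed
  thus "frame d L b \<subseteq> E" unfolding fr E_def by (rule edges_mono)
  show "card (frame d L b) = card (edges (cube d (replicate d 0) (2 * L + 2)))"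
    unfolding fr using l(1) by (intro card_edges_cube) simp
  assume e: "e \<in> E" "e \<inter> b \<noteq> {}"
  then obtain x y where xy: "e = {x, y}" "adj x y" "length x = d" "length y = d"
    by (auto simp: E_def edges_def cube_def)
  have near: "z \<in> ?W" if z: "length z = d" "z' \<in> b" "z = z' \<or> adj z z'" for z z'
  proof -
    have "\<bar>z ! i - z' ! i\<bar> \<le> 1" if "i < d" for i
      using z adj_coord_le[of z z' i] that by auto
    moreover have "a ! i \<le> z' ! i \<and> z' ! i < a ! i + int l" if "i < d" for i
      using z(2) that unfolding l(4) by (auto simp: cube_def)
    ultimately have "a ! i - 1 \<le> z ! i \<and> z ! i < a ! i - 1 + int (2 * L + 2)" if "i < d" for i
      using that l(3) by fastforce
    thus ?thesis using z(1) l(1) by (auto simp: cube_def)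
  qed
  have "x \<in> ?W \<and> y \<in> ?W"
  proof (cases "x \<in> b")
    case True
    thus ?thesis using near[of x x] near[of y x] xy adj_sym by blast
  next
    case False
    hence "y \<in> b" using e(2) xy by auto
    thus ?thesis using near[of y y] near[of x y] xy by blast
  qed
  thus "e \<in> frame d L b" unfolding fr xy(1) edges_def using xy(2) by blast
qed

section \<open>The spectral gap\<close>

text \<open>With \<open>L = r ^ (d + 1)\<close> the first term has order \<open>r ^ d\<close>, which
  is \<open>L / r\<close>, and in the second the exponential beats every power of
  \<open>r\<close>.\<close>

lemma tile_size_exists:
  fixes a c K :: real
  assumes a: "a > 0" and c: "c > 0" and K: "K > 0"
  obtains r L :: nat where "L \<ge> 1"
    "K * (2 * (2 * real r + 1) ^ d + real (2 * L) ^ d * (c * exp (- a * real r))) \<le> real L"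
proof -
  \<comment> \<open>The exponent of \<open>r\<close> in \<open>L ^ d\<close>. Up to the factor
    \<open>L\<close>, the function \<open>?h\<close> bounds the left-hand side; its constant 3 comes
    from \<open>2 * r + 1 \<le> 3 * r\<close>.\<close>
  define M where "M = (d + 1) * d"
  let ?h = "\<lambda>x :: real. K * (2 * 3 ^ d * inverse x + 2 ^ d * c * (inverse a ^ M * ((a * x) ^ M / exp (a * x))))"
  have lin: "filterlim (\<lambda>x. a * x) at_top at_top"
    using a by (intro filterlim_tendsto_pos_mult_at_top[OF tendsto_const]) (auto intro: filterlim_ident)
  have "(?h \<longlongrightarrow> K * (2 * 3 ^ d * 0 + 2 ^ d * c * (inverse a ^ M * 0))) at_top"
    by (intro tendsto_intros tendsto_inverse_0_at_top filterlim_ident filterlim_compose[OF tendsto_power_div_exp_0 lin])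
  hence "(?h \<longlongrightarrow> 0) at_top" by simp
  hence "((\<lambda>r. ?h (real r)) \<longlongrightarrow> 0) sequentially"
    by (rule filterlim_compose[OF _ filterlim_real_sequentially])
  hence "eventually (\<lambda>r. ?h (real r) < 1) sequentially" by (rule order_tendstoD) simp
  then obtain r where r: "r \<ge> 1" "?h (real r) < 1"
    using eventually_conj[OF _ eventually_ge_at_top[of 1]] by (metis (mono_tags, lifting) eventually_sequentially linorder_le_cases)
  define L where "L = r ^ (d + 1)"
  have x1: "real r \<ge> 1" using r by simp
  have pow: "inverse a ^ M * ((a * real r) ^ M / exp (a * real r)) = real r ^ M * exp (- a * real r)"
    using a by (simp add: power_mult_distrib exp_minus field_simps)
  have "(2 * real r + 1) ^ d \<le> (3 * real r) ^ d" using x1 by (intro power_mono) auto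
  also have "\<dots> = real L * (3 ^ d * inverse (real r))"
    using x1 by (simp add: L_def power_mult_distrib field_simps)
  finally have 1: "2 * (2 * real r + 1) ^ d \<le> real L * (2 * 3 ^ d * inverse (real r))" by simp
  have L1: "real L \<ge> 1" unfolding L_def of_nat_power by (rule one_le_power[OF x1])
  have "real (2 * L) ^ d * (c * exp (- a * real r)) = 2 ^ d * c * (real r ^ M * exp (- a * real r))"
    unfolding L_def M_def of_nat_mult of_nat_power power_mult_distrib power_mult by (simp add: ac_simps)
  also have "\<dots> \<le> real L * (2 ^ d * c * (real r ^ M * exp (- a * real r)))"
    using mult_right_mono[OF L1, of "2 ^ d * c * (real r ^ M * exp (- a * real r))"] c by simp
  finally have 2: "real (2 * L) ^ d * (c * exp (- a * real r)) \<le> real L * (2 ^ d * c * (real r ^ M * exp (- a * real r)))" .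
  have "K * (2 * (2 * real r + 1) ^ d + real (2 * L) ^ d * (c * exp (- a * real r)))
      \<le> K * (real L * (2 * 3 ^ d * inverse (real r)) + real L * (2 ^ d * c * (real r ^ M * exp (- a * real r))))"
    using 1 2 K by (intro mult_left_mono add_mono) auto
  also have "\<dots> = real L * ?h (real r)" unfolding pow by (simp add: algebra_simps)
  also have "\<dots> \<le> real L * 1" using r L1 by (intro mult_left_mono) auto
  finally have "K * (2 * (2 * real r + 1) ^ d + real (2 * L) ^ d * (c * exp (- a * real r))) \<le> real L" by simp
  moreover have "L \<ge> 1" using L1 by simp
  ultimately show thesis using that by blast
qed

lemma SW_form_gap:
  assumes q: "q \<ge> 2" and \<beta>: "\<beta> > 0" and ssm: "SSM q d \<beta>"
  obtains \<kappa> where "\<kappa> > 0" "\<And>V f. is_cube d V \<Longrightarrow> (\<Sum>\<sigma>\<in>configs q V. gibbs_weight \<beta> V \<sigma> * f \<sigma>) = 0 \<Longrightarrow>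
    potts.SW_form q \<beta> V f \<le> (1 - \<kappa>) * (\<Sum>\<sigma>\<in>configs q V. gibbs_weight \<beta> V \<sigma> * (f \<sigma>)\<^sup>2)"
proof -
  obtain a c where mix: "strong_mixing q d \<beta> a c" "a > 0" "c > 0"
    using ssm unfolding SSM_iff_strong_mixing by blast
  \<comment> \<open>The factor 2 lets bordering consume at most half of what covering gains;
    \<open>d + 1\<close> instead of \<open>d\<close> keeps the constant positive without using
    \<open>d \<ge> 1\<close>.\<close>
  obtain r L where L: "L \<ge> 1" and rL:
    "2 * (real d + 1) * 4 ^ d * (2 * (2 * real r + 1) ^ d + real (2 * L) ^ d * (c * exp (- a * real r))) \<le> real L"
    by (rule tile_size_exists[OF mix(2,3), of "2 * (real d + 1) * 4 ^ d" d]) auto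
  define C where "C = 2 * (2 * real r + 1) ^ d + real (2 * L) ^ d * (c * exp (- a * real r))"
  have C: "C \<ge> 0" using mix by (simp add: C_def)
  have LC: "2 * (C * (real d * 4 ^ d)) \<le> real L"
  proof -
    have "2 * (C * (real d * 4 ^ d)) \<le> 2 * (C * ((real d + 1) * 4 ^ d))"
      using C by (intro mult_left_mono mult_right_mono) auto
    also have "\<dots> = 2 * (real d + 1) * 4 ^ d * C" by simp
    also have "\<dots> \<le> real L" using rL by (simp only: C_def)
    finally show ?thesis .
  qed
  have infl: "influence a c r v (cube d x l) \<le> C" if "v \<in> outer_boundary (cube d x l)" "l \<le> 2 * L" for v x l
    unfolding C_def using influence_cube_le[OF that(1,2), of c a r] mix(3) by simp
  define k where "k = card (edges (cube d (replicate d 0) (2 * L + 2)))"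
  \<comment> \<open>Half of the covering count \<open>L * L ^ d\<close> divided by the number of
    tilings.\<close>
  define \<kappa>1 where "\<kappa>1 = 1 / (2 * real (2 * L + 2) ^ d)"
  have \<kappa>1: "\<kappa>1 > 0" "\<kappa>1 \<le> 1" 
  proof -
    define B where "B = real (2 * L + 2) ^ d"
    have "B \<ge> 1" unfolding B_def by (rule one_le_power) simp
    thus "\<kappa>1 > 0" "\<kappa>1 \<le> 1" unfolding \<kappa>1_def B_def[symmetric] by simp_all
  qed
  \<comment> \<open>The first factor is the probability that the frame of a tile is closed.\<close>
  define \<kappa> where "\<kappa> = exp (- \<beta>) ^ k * \<kappa>1"
  have "potts.SW_form q \<beta> V f \<le> (1 - \<kappa>) * (\<Sum>\<sigma>\<in>configs q V. gibbs_weight \<beta> V \<sigma> * (f \<sigma>)\<^sup>2)"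
    if V: "is_cube d V" and mean: "(\<Sum>\<sigma>\<in>configs q V. gibbs_weight \<beta> V \<sigma> * f \<sigma>) = 0" for V f
  proof -
    obtain x N where x: "length x = d" "N \<ge> 1" "V = cube d x N" using V by (auto simp: is_cube_def)
    interpret potts q \<beta> V using q \<beta> x finite_cube by unfold_locales auto
    have p_eq: "1 - p = exp (- \<beta>)" by (simp add: p_def)
    show ?thesis
    proof (cases "2 * L \<le> N")
      case True
      define E where "E = edges (cube d (map (\<lambda>t. t - 1) x) (N + 2 * L + 2))"
      have tile: "\<exists>a0 l0. b = cube d a0 l0 \<and> length a0 = d \<and> 1 \<le> l0 \<and> l0 < 2 * L"
        if "i \<in> tiling_index d L" "b \<in> tiling d x N L i" for i b
      proof -
        obtain l g where lg: "i = (l, g)" by (cases i)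
        hence l: "L \<le> l" "l < 2 * L" and "b \<in> tiling d x N L (l, g)" using that by (auto simp: tiling_index_def)
        from this(3) obtain a0 where "b = cube d a0 l" "length a0 = d" by (rule tilingE)
        thus ?thesis using l L by (intro exI[of _ a0] exI[of _ l]) simp
      qed
      have sub: "b \<subseteq> cube d x N" if "b \<in> tiling d x N L i" for i b
        using tiling_subset[of b d x N L "fst i" "snd i"] that by simp
      have "SW_form f \<le> (1 - (1 - p) ^ k * \<kappa>1) * (\<Sum>\<sigma>\<in>configs q V. w \<sigma> * (f \<sigma>)\<^sup>2)"
      proof (rule SW_form_le_tiles[OF mix, where I = "tiling_index d L" and \<B> = "tiling d x N L" and C = C and r = r
            and E = E and F = "frame d L"])
        show "finite (tiling_index d L)" by (rule finite_tiling_index)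
        show "tiling_index d L \<noteq> {}" using card_tiling_index[of d L] L by (metis card.empty mult_is_0 not_one_le_zero power_eq_0_iff zero_eq_add_iff_both_eq_0 zero_neq_numeral)
        show "separated (tiling d x N L i)" if "i \<in> tiling_index d L" for i
          using that by (cases i) (simp add: tiling_index_def tiling_separated)
        show "is_cube d b \<and> b \<subseteq> V" if "i \<in> tiling_index d L" "b \<in> tiling d x N L i" for i b
          using tile[OF that] sub[OF that(2)] x(3) unfolding is_cube_def by blast
        show "C \<ge> 0" by (rule C)
        show "influence a c r v b \<le> C" if "i \<in> tiling_index d L" "b \<in> tiling d x N L i" "v \<in> outer_boundary b" for i b v
          using tile[OF that(1,2)] that(3) infl less_imp_le by blast
        show "finite E" unfolding E_def by (intro finite_edges finite_cube)
        show "edges V \<subseteq> E" unfolding E_def x(3) using x(1) by (intro edges_mono cube_mono) auto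
        show "frame d L b \<subseteq> E \<and> card (frame d L b) = k" if "i \<in> tiling_index d L" "b \<in> tiling d x N L i" for i b
          using tile[OF that] frame(1,2)[OF _ _ _ _ sub[OF that(2)] x(1)] unfolding E_def k_def by blast
        show "e \<in> frame d L b" if "i \<in> tiling_index d L" "b \<in> tiling d x N L i" "e \<in> E" "e \<inter> b \<noteq> {}" for i b e
          using tile[OF that(1,2)] frame(3)[OF _ _ _ _ sub[OF that(2)] x(1), of _ _ L e] that(3,4) unfolding E_def by blast
        show "\<kappa>1 \<le> 1" by (rule \<kappa>1)
        fix v assume v: "v \<in> V"
        let ?cov = "card {i \<in> tiling_index d L. v \<in> \<Union>(tiling d x N L i)}"
        let ?bd = "card {i \<in> tiling_index d L. v \<in> outer_boundary (\<Union>(tiling d x N L i))}"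
        note v' = v[unfolded x(3)]
        have "real (L * L ^ d) \<le> real ?cov"
          unfolding of_nat_le_iff by (rule card_tilings_covering[OF L True v'])
        hence cov: "real L * real L ^ d \<le> real ?cov" by simp
        have "real ?bd \<le> real (d * (4 * L) ^ d)"
          unfolding of_nat_le_iff by (rule card_tilings_bordering[OF L v'])
        hence "C * real ?bd \<le> C * real (d * (4 * L) ^ d)" using C by (rule mult_left_mono)
        also have "\<dots> = C * (real d * 4 ^ d) * real L ^ d" by (simp add: power_mult_distrib)
        also have "\<dots> \<le> real L / 2 * real L ^ d" using LC by (intro mult_right_mono) auto
        finally have "real ?cov - C * real ?bd \<ge> real L * real L ^ d / 2" using cov by simp
        moreover have "\<kappa>1 * real (card (tiling_index d L)) = real L * real L ^ d / 2"
        proof -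
          have "real (card (tiling_index d L)) = real L * (real (2 * L + 2) ^ d * real L ^ d)"
            unfolding card_tiling_index of_nat_mult of_nat_power power_mult_distrib ..
          moreover have "real (2 * L + 2) ^ d > 0" by simp
          ultimately show ?thesis unfolding \<kappa>1_def by (simp add: field_simps)
        qed
        ultimately show "\<kappa>1 * real (card (tiling_index d L)) \<le> real ?cov - C * real ?bd" by simp
      qed (rule mean)
      thus ?thesis by (simp only: \<kappa>_def p_eq)
    next
      case False
      \<comment> \<open>When the side is below \<open>2 * L\<close>, the cube \<open>V\<close>
        itself is the only tile: it covers every vertex, no vertex of \<open>V\<close> borders it,
        and its frame consists of all edges.\<close>
      have "SW_form f \<le> (1 - (1 - p) ^ card (edges V) * 1) * (\<Sum>\<sigma>\<in>configs q V. w \<sigma> * (f \<sigma>)\<^sup>2)"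
      proof (rule SW_form_le_tiles[OF mix, where I = "{()}" and \<B> = "\<lambda>_. {V}" and C = C and r = r
            and E = "edges V" and F = "\<lambda>_. edges V"])
        show "influence a c r v b \<le> C" if "b \<in> {V}" "v \<in> outer_boundary b" for b v
          using that False infl[of v x N] x(3) by simp
      qed (use V C finE mean in \<open>auto simp: separated_def outer_boundary_def\<close>)
      also have "\<dots> \<le> (1 - \<kappa>) * (\<Sum>\<sigma>\<in>configs q V. w \<sigma> * (f \<sigma>)\<^sup>2)"
      proof (rule mult_right_mono)
        have "card (edges V) \<le> k"
          unfolding x(3) k_def card_edges_cube[OF x(1)] using False
          by (intro card_mono finite_edges finite_cube edges_mono cube_mono) auto
        hence "exp (- \<beta>) ^ k \<le> exp (- \<beta>) ^ card (edges V)" using \<beta> by (intro power_decreasing) auto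
        moreover have "\<kappa> \<le> exp (- \<beta>) ^ k" using \<kappa>1 unfolding \<kappa>_def by (simp add: mult_le_cancel_left1)
        ultimately show "1 - (1 - p) ^ card (edges V) * 1 \<le> 1 - \<kappa>" by (simp add: p_eq)
        show "0 \<le> (\<Sum>\<sigma>\<in>configs q V. w \<sigma> * (f \<sigma>)\<^sup>2)"
          using w_pos by (intro sum_nonneg mult_nonneg_nonneg) (auto simp: less_imp_le)
      qed
      finally show ?thesis .
    qed
  qed
  moreover have "\<kappa> > 0" using \<kappa>1 by (simp add: \<kappa>_def)
  ultimately show thesis using that by blast
qed

lemma (in potts) spectral_gap_SW_ge:
  assumes V: "V \<noteq> {}"
    and gap: "\<And>f. (\<Sum>\<sigma>\<in>configs q V. w \<sigma> * f \<sigma>) = 0 \<Longrightarrow> SW_form f \<le> (1 - \<kappa>) * (\<Sum>\<sigma>\<in>configs q V. w \<sigma> * (f \<sigma>)\<^sup>2)"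
  shows "\<kappa> \<le> spectral_gap (SW_matrix q \<beta> V)"
proof -
  define N where "N = card (configs q V)"
  define s where "s = state_enum q V"
  have "\<exists>f. bij_betw f {..<N} (configs q V)"
    using ex_bij_betw_nat_finite[OF fin(1)] by (simp add: N_def atLeast0LessThan)
  hence s: "bij_betw s {..<N} (configs q V)"
    unfolding s_def state_enum_def N_def by (rule someI_ex)
  have s_in: "s i \<in> configs q V" if "i < N" for i using s that by (auto simp: bij_betw_def)
  have mat: "SW_matrix q \<beta> V = mat N N (\<lambda>(i, j). SW_kernel q \<beta> V (s i) (s j))"
    by (simp add: SW_matrix_def Let_def N_def s_def)
  \<comment> \<open>With a second state, the multiset left after removing the eigenvalue 1 is
    nonempty and its maximum makes sense.\<close>
  have N2: "N \<ge> 2"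
  proof -
    let ?c = "\<lambda>n x. if x \<in> V then n else (0 :: nat)"
    have sub: "{?c 1, ?c 2} \<subseteq> configs q V" using q by (auto simp: configs_def)
    have "?c 1 \<noteq> ?c 2" using V by (auto simp: fun_eq_iff)
    thus ?thesis using card_mono[OF fin(1) sub] by (simp add: N_def)
  qed
  define lift where "lift g \<sigma> = g (inv_into {..<N} s \<sigma>)" for g :: "nat \<Rightarrow> real" and \<sigma>
  have lift: "lift g (s i) = g i" if "i < N" for g i
    using s that by (simp add: lift_def bij_betw_inv_into_left)
  have sum_s: "(\<Sum>\<sigma>\<in>configs q V. F \<sigma>) = (\<Sum>i<N. F (s i))" for F :: "_ \<Rightarrow> real"
    using sum.reindex_bij_betw[OF s, of F] by simp
  have form: "(\<Sum>i<N. \<Sum>j<N. w (s i) * SW_matrix q \<beta> V $$ (i, j) * g i * g j) = SW_form (lift g)" for g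
    unfolding SW_form_def sum_s by (intro sum.cong refl) (simp add: mat lift)
  show ?thesis
  proof (rule spectral_gap_ge[of _ N "\<lambda>i. w (s i)"])
    show "SW_matrix q \<beta> V \<in> carrier_mat N N" "2 \<le> N" by (simp_all add: mat N2)
    show "0 < w (s i)" for i by (rule w_pos)
    show "w (s i) * SW_matrix q \<beta> V $$ (i, j) = w (s j) * SW_matrix q \<beta> V $$ (j, i)" if "i < N" "j < N" for i j
      using that SW_reversible[OF s_in s_in] by (simp add: mat)
    show "(\<Sum>j<N. SW_matrix q \<beta> V $$ (i, j)) = 1" if "i < N" for i
      using SW_kernel_row_sum[OF s_in[OF that]] that by (simp add: sum_s mat)
    show "0 \<le> (\<Sum>i<N. \<Sum>j<N. w (s i) * SW_matrix q \<beta> V $$ (i, j) * g i * g j)" for g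
      unfolding form by (rule SW_form_nonneg)
    fix g :: "nat \<Rightarrow> real" assume "(\<Sum>i<N. w (s i) * g i) = 0"
    hence "(\<Sum>\<sigma>\<in>configs q V. w \<sigma> * lift g \<sigma>) = 0" by (simp add: sum_s lift)
    from gap[OF this] show "(\<Sum>i<N. \<Sum>j<N. w (s i) * SW_matrix q \<beta> V $$ (i, j) * g i * g j)
        \<le> (1 - \<kappa>) * (\<Sum>i<N. w (s i) * (g i)\<^sup>2)"
      unfolding form by (simp add: sum_s lift)
  qed
qed

theorem theorem3:
  fixes q d :: nat and \<beta> :: real
  assumes "q \<ge> 2" and "d \<ge> 1" and "\<beta> > 0"
    and "SSM q d \<beta>"
  shows "\<exists>c > 0. \<forall>V. is_cube d V \<longrightarrow> spectral_gap (SW_matrix q \<beta> V) \<ge> c"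
proof -
  obtain \<kappa> where \<kappa>: "\<kappa> > 0" "\<And>V f. is_cube d V \<Longrightarrow> (\<Sum>\<sigma>\<in>configs q V. gibbs_weight \<beta> V \<sigma> * f \<sigma>) = 0 \<Longrightarrow>
    potts.SW_form q \<beta> V f \<le> (1 - \<kappa>) * (\<Sum>\<sigma>\<in>configs q V. gibbs_weight \<beta> V \<sigma> * (f \<sigma>)\<^sup>2)"
    using SW_form_gap[OF assms(1,3,4)] by blast
  have "\<kappa> \<le> spectral_gap (SW_matrix q \<beta> V)" if V: "is_cube d V" for V
  proof -
    obtain x N where x: "length x = d" "N \<ge> 1" "V = cube d x N" using V by (auto simp: is_cube_def)
    have "x \<in> V" using x by (auto simp: cube_def)
    interpret potts q \<beta> V using assms x finite_cube by unfold_locales auto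
    show ?thesis using \<open>x \<in> V\<close> by (intro spectral_gap_SW_ge \<kappa>(2)[OF V]) auto
  qed
  thus ?thesis using \<kappa>(1) by blast
qed

end
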